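(* Fix a number $t>1$. The following hold. (a) For any probability measure $\mu\in\mathcal{ID}(\boxplus)$, we have $\Re F_\mu'(z)>1/2$ for all $z\in\mathbb C^+$, and $F_\mu$ extends continuously to $\mathbb R$. Moreover, $\mu^{sc}=0$, $\mu$ has at most one atom, and the density of $\mu^{ac}$ with respect to Lebesgue measure is analytic wherever positive. (b) For a probability measure $\mu$ on $\mathbb R$ let $H_t^\mu(z)=tz+(1-t)F_\mu(z)$, $z\in\mathbb C^+$, and let $\omega_t^\mu:\mathbb C^+\to\mathbb C^+$ be the analytic function with $H_t^\mu(\omega_t^\mu(z))=z$ for all $z\in\mathbb C^+$. The correspondence $H_t\longleftrightarrow\omega_t$ induces a bijective correspondence $$\Psi_t\colon\mathcal{ID}(\uplus)\to\mathcal{ID}(\boxplus),$$ where $\Psi_t(\mu)$ is the probability measure on $\mathbb R$ with $F_{\Psi_t(\mu)}=\omega_t^\mu$, and $\Psi_t$ has the property that $\Psi_t(\mu\uplus\nu)=\Psi_t(\mu)\boxplus\Psi_t(\nu)$ for all probability measures $\mu,\nu$ on $\mathbb R$.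
   Context: $\mathbb C^+=\{\Im z>0\}$. For a Borel probability measure $\mu$ on $\mathbb R$ let $G_\mu(z)=\int_{\mathbb R}\frac{d\mu(t)}{z-t}$ and $F_\mu=1/G_\mu$ on $\mathbb C^+$. $\mu^{ac},\mu^{sc}$ are the absolutely continuous and singular continuous parts of $\mu$ with respect to Lebesgue measure. Free additive convolution: $F_\mu$ has a right inverse $F_\mu^{-1}$ on a domain $\bigcup_{\alpha>0}\{z\in\mathbb C^+:\Im z>\beta_\alpha,\ |\Re z|<\alpha\Im z\}$ with $F_\mu^{-1}(z)/z\to1$ as $z\to\infty$ within cones; put $\varphi_\mu(z)=F_\mu^{-1}(z)-z$. Then $\mu\boxplus\nu$ is the unique probability measure on $\mathbb R$ with $\varphi_{\mu\boxplus\nu}=\varphi_\mu+\varphi_\nu$ on the common domain. Boolean additive convolution: $\mu\uplus\nu$ is the probability measure on $\mathbb R$ with $F_{\mu\uplus\nu}(z)=F_\mu(z)+F_\nu(z)-z$, $z\in\mathbb C^+$. For a convolution $\star$, $\mathcal{ID}(\star)$ is the set of probability measures $\mu$ such that for every $n\in\mathbb N$ there is a probability measure $\mu_n$ with $\mu=\mu_n\star\cdots\star\mu_n$ ($n$ factors). It is known that every probability measure on $\mathbb R$ belongs to $\mathcal{ID}(\uplus)$. For every probability measure $\mu$ on $\mathbb R$ the function $H_t^\mu$ has a unique analytic right inverse $\omega_t^\mu:\mathbb C^+\to\mathbb C^+$. *)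

theory Defs
  imports "HOL-Probability.Probability" "HOL-Complex_Analysis.Complex_Analysis"
begin

definition upper_half_plane :: "complex set" where
  "upper_half_plane = {z. 0 < Im z}"

definition cauchy_transform :: "real measure \<Rightarrow> complex \<Rightarrow> complex" where
  "cauchy_transform \<mu> z = (\<integral>t. 1 / (z - complex_of_real t) \<partial>\<mu>)"

definition F_transform :: "real measure \<Rightarrow> complex \<Rightarrow> complex" where
  "F_transform \<mu> z = 1 / cauchy_transform \<mu> z"


text \<open>Free additive convolution. The domain below lies in the upper half-plane for
  every choice of the bounds \<open>\<beta>\<close>, since \<open>\<bar>Re z\<bar> < \<alpha> * Im z\<close> forces \<open>Im z > 0\<close>.\<close>

definition cone_domain :: "(real \<Rightarrow> real) \<Rightarrow> complex set" where
  "cone_domain \<beta> = (\<Union>\<alpha>\<in>{0<..}. {z. \<beta> \<alpha> < Im z \<and> \<bar>Re z\<bar> < \<alpha> * Im z})"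

text \<open>\<open>\<phi>\<close> is \<open>F\<^sup>-\<^sup>1(z) - z\<close> on \<open>cone_domain \<beta>\<close>, so \<open>z + \<phi> z\<close> is the right inverse.
  On a given domain it is unique; on different domains any two choices agree on the
  (connected) intersection.\<close>

definition voiculescu_transform_on ::
    "real measure \<Rightarrow> (real \<Rightarrow> real) \<Rightarrow> (complex \<Rightarrow> complex) \<Rightarrow> bool" where
  "voiculescu_transform_on \<mu> \<beta> \<phi> \<longleftrightarrow>
     \<phi> holomorphic_on cone_domain \<beta> \<and>
     (\<forall>z\<in>cone_domain \<beta>. z + \<phi> z \<in> upper_half_plane \<and> F_transform \<mu> (z + \<phi> z) = z) \<and>
     (\<forall>\<alpha>>0. ((\<lambda>z. (z + \<phi> z) / z) \<longlongrightarrow> 1)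
        (inf at_infinity (principal {z. \<bar>Re z\<bar> < \<alpha> * Im z})))"

definition free_conv :: "real measure \<Rightarrow> real measure \<Rightarrow> real measure" (infixl "\<boxplus>" 65) where
  "\<mu> \<boxplus> \<nu> = (THE \<rho>. real_distribution \<rho> \<and>
     (\<exists>\<beta>\<^sub>1 \<beta>\<^sub>2 \<beta>\<^sub>3 \<phi>\<^sub>1 \<phi>\<^sub>2 \<phi>\<^sub>3.
        voiculescu_transform_on \<mu> \<beta>\<^sub>1 \<phi>\<^sub>1 \<and>
        voiculescu_transform_on \<nu> \<beta>\<^sub>2 \<phi>\<^sub>2 \<and>
        voiculescu_transform_on \<rho> \<beta>\<^sub>3 \<phi>\<^sub>3 \<and>
        (\<forall>z \<in> cone_domain \<beta>\<^sub>1 \<inter> cone_domain \<beta>\<^sub>2 \<inter> cone_domain \<beta>\<^sub>3. \<phi>\<^sub>3 z = \<phi>\<^sub>1 z + \<phi>\<^sub>2 z)))"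

definition boolean_conv :: "real measure \<Rightarrow> real measure \<Rightarrow> real measure" (infixl "\<uplus>" 65) where
  "\<mu> \<uplus> \<nu> = (THE \<rho>. real_distribution \<rho> \<and>
     (\<forall>z\<in>upper_half_plane. F_transform \<rho> z = F_transform \<mu> z + F_transform \<nu> z - z))"

text \<open>\<open>(star \<nu> ^^ (n - 1)) \<nu>\<close> is the convolution of \<open>n \<ge> 1\<close> copies of \<open>\<nu>\<close>.\<close>

definition inf_divisible ::
    "(real measure \<Rightarrow> real measure \<Rightarrow> real measure) \<Rightarrow> real measure set" where
  "inf_divisible star = {\<mu>. real_distribution \<mu> \<and>
     (\<forall>n\<ge>1. \<exists>\<nu>. real_distribution \<nu> \<and> \<mu> = (star \<nu> ^^ (n - 1)) \<nu>)}"


text \<open>Lebesgue decomposition of a Borel measure on the line into absolutely continuous,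
  singular continuous and atomic parts.\<close>

definition lebesgue_decomposition ::
    "real measure \<Rightarrow> real measure \<Rightarrow> real measure \<Rightarrow> real measure \<Rightarrow> bool" where
  "lebesgue_decomposition \<mu> a s d \<longleftrightarrow>
     sets a = sets borel \<and> sets s = sets borel \<and> sets d = sets borel \<and>
     (\<forall>A\<in>sets borel. emeasure \<mu> A = emeasure a A + emeasure s A + emeasure d A) \<and>
     absolutely_continuous lborel a \<and>
     (\<exists>N\<in>null_sets lborel. emeasure s (- N) = 0) \<and> (\<forall>x. emeasure s {x} = 0) \<and>
     (\<exists>C. countable C \<and> emeasure d (- C) = 0)"

definition ac_part :: "real measure \<Rightarrow> real measure" where
  "ac_part \<mu> = (THE a. \<exists>s d. lebesgue_decomposition \<mu> a s d)"

definition sc_part :: "real measure \<Rightarrow> real measure" where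
  "sc_part \<mu> = (THE s. \<exists>a d. lebesgue_decomposition \<mu> a s d)"

text \<open>A density is determined only almost everywhere, so pointwise claims about it need a
  representative. We take the one from Stieltjes inversion: wherever \<open>cauchy_transform \<mu>\<close>
  has a finite vertical boundary value \<open>l\<close>, the density equals \<open>- Im l / pi\<close>. This holds
  almost everywhere for every probability measure; the remaining null set is unconstrained.\<close>

definition is_ac_density :: "real measure \<Rightarrow> (real \<Rightarrow> real) \<Rightarrow> bool" where
  "is_ac_density \<mu> f \<longleftrightarrow>
     f \<in> borel_measurable borel \<and> (\<forall>x. 0 \<le> f x) \<and>
     ac_part \<mu> = density lborel (\<lambda>x. ennreal (f x)) \<and>
     (\<forall>x l. ((\<lambda>y. cauchy_transform \<mu> (Complex x y)) \<longlongrightarrow> l) (at_right 0)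
        \<longrightarrow> f x = - Im l / pi)"

definition real_analytic_at :: "(real \<Rightarrow> real) \<Rightarrow> real \<Rightarrow> bool" where
  "real_analytic_at f x \<longleftrightarrow>
     (\<exists>c r. 0 < r \<and> (\<forall>y. \<bar>y - x\<bar> < r \<longrightarrow> (\<lambda>n. c n * (y - x) ^ n) sums f y))"


definition H_map :: "real \<Rightarrow> real measure \<Rightarrow> complex \<Rightarrow> complex" where
  "H_map t \<mu> z = complex_of_real t * z + complex_of_real (1 - t) * F_transform \<mu> z"

definition is_right_inverse_H :: "real \<Rightarrow> real measure \<Rightarrow> (complex \<Rightarrow> complex) \<Rightarrow> bool" where
  "is_right_inverse_H t \<mu> w \<longleftrightarrow>
     w holomorphic_on upper_half_plane \<and> w ` upper_half_plane \<subseteq> upper_half_plane \<and>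
     (\<forall>z\<in>upper_half_plane. H_map t \<mu> (w z) = z)"

text \<open>The right inverse is unique on the upper half-plane; its values elsewhere are
  irrelevant, hence \<open>SOME\<close> rather than \<open>THE\<close>.\<close>

definition omega_map :: "real \<Rightarrow> real measure \<Rightarrow> complex \<Rightarrow> complex" where
  "omega_map t \<mu> = (SOME w. is_right_inverse_H t \<mu> w)"

definition Psi :: "real \<Rightarrow> real measure \<Rightarrow> real measure" where
  "Psi t \<mu> = (THE \<rho>. real_distribution \<rho> \<and>
     (\<forall>z\<in>upper_half_plane. F_transform \<rho> z = omega_map t \<mu> z))"

end

theory Submission
  imports Defs
begin

text \<open>Writing \<open>F\<^sub>\<mu>(z) = z + N(z)\<close>, probability measures correspond to the functions \<open>N\<close> with
  nonnegative imaginary part on the upper half-plane and \<open>N(i y) / y \<longlonglongrightarrow> 0\<close>; Boolean convolution adds the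
  \<open>N\<close>'s. The right inverse \<open>\<omega>\<close> of \<open>w \<mapsto> w - N(w)\<close> is constructed from the Schwarz-Pick inequality: the
  map is injective on the preimage of the half-plane, and proper there. As \<open>w - N(w)\<close> inverts
  \<open>\<omega>\<close>, the Voiculescu transform of the measure with \<open>F = \<omega>\<close> is \<open>- N\<close>, so that \<open>Psi t\<close> turns Boolean into
  free convolution. Conversely, if \<open>\<mu>\<close> is freely infinitely divisible, a normal family argument applied
  to its convolution roots shows that \<open>F\<^sub>\<mu>\<close> itself is such an \<open>\<omega>\<close>. The regularity of \<open>\<mu>\<close> follows from
  that of \<open>\<omega>\<close>: it expands distances up to a factor 1/2, extends continuously to the real line because a
  nondegenerate cluster set would force \<open>w - N(w)\<close> to be constant, and continues analytically
  wherever its boundary value is not real. Stieltjes inversion translates this to \<open>\<mu>\<close>.\<close>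

section \<open>Pick functions\<close>

text \<open>The ratio \<open>Im (N w) / Im w\<close> governs the whole argument. It is below 1
  exactly where \<open>w - N w\<close> lies in the upper half-plane, and by Schwarz-Pick the
  geometric mean of the ratios at two points is a Lipschitz constant of N between them. So N
  contracts strictly on the image of \<omega>. This gives injectivity, the factor 1/2 for distances
  (\<open>w - N w\<close> has Lipschitz constant 2 there), and the derivative bound: the derivative
  of \<omega> is 1 / (1 - u) with |u| < 1, and such numbers have real part above 1/2. The obstacle
  is the real line, where no boundary values of N are at hand. A nondegenerate cluster set that
  meets the open half-plane is excluded by the identity theorem. One that lies on the real line is a
  segment over which \<open>w - N w - x\<close> is O(Im w), so it continues across the segment by 0.
  Free divisibility enters through one explicit relation: the subordination function of the root of
  order k + 1 is (k F + z) / (k + 1), which tends to F.\<close>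

lemma mem_upper_half_plane [simp]: "z \<in> upper_half_plane \<longleftrightarrow> 0 < Im z"
  by (simp add: upper_half_plane_def)

lemma open_upper_half_plane [simp]: "open upper_half_plane"
  unfolding upper_half_plane_def by (rule open_halfspace_Im_gt)

lemma convex_upper_half_plane [simp]: "convex upper_half_plane"
  unfolding upper_half_plane_def by (rule convex_halfspace_Im_gt)

lemma connected_upper_half_plane [simp]: "connected upper_half_plane"
  by (rule convex_connected) simp

definition pick :: "(complex \<Rightarrow> complex) \<Rightarrow> bool" where
  "pick N \<longleftrightarrow> N holomorphic_on upper_half_plane \<and> (\<forall>z\<in>upper_half_plane. 0 \<le> Im (N z))"

lemma pickI:
  assumes "N holomorphic_on upper_half_plane" "\<And>z. 0 < Im z \<Longrightarrow> 0 \<le> Im (N z)"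
  shows "pick N"
  using assms by (auto simp: pick_def)

lemma pick_holomorphic: "pick N \<Longrightarrow> N holomorphic_on upper_half_plane"
  by (simp add: pick_def)

lemma pick_Im_nonneg: "pick N \<Longrightarrow> 0 < Im z \<Longrightarrow> 0 \<le> Im (N z)"
  by (simp add: pick_def)

lemma pick_continuous_on: "pick N \<Longrightarrow> continuous_on upper_half_plane N"
  by (simp add: pick_def holomorphic_on_imp_continuous_on)

lemma pick_isCont:
  assumes "pick N" "0 < Im z" shows "isCont N z"
  using pick_continuous_on[OF assms(1)] assms(2)
  by (simp add: continuous_on_eq_continuous_at)

lemma pick_add: "pick M \<Longrightarrow> pick N \<Longrightarrow> pick (\<lambda>z. M z + N z)"
  by (auto simp: pick_def intro!: holomorphic_intros)

lemma pick_scale: "pick N \<Longrightarrow> 0 \<le> c \<Longrightarrow> pick (\<lambda>z. complex_of_real c * N z)"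
  by (auto simp: pick_def intro!: holomorphic_intros)

text \<open>This identity turns bounds on the pseudohyperbolic distance, a quotient of moduli, into
  polynomial inequalities in \<open>cmod (a - b)\<close> and the two imaginary parts.\<close>

lemma norm_diff_cnj_square: "cmod (a - cnj b)^2 = cmod (a - b)^2 + 4 * (Im a * Im b)"
  unfolding cmod_power2 by (simp add: power2_eq_square algebra_simps)

section \<open>Cayley transforms and the Schwarz-Pick inequality\<close>

definition cayley :: "complex \<Rightarrow> complex \<Rightarrow> complex" where
  "cayley b z = (z - b) / (z - cnj b)"

definition inv_cayley :: "complex \<Rightarrow> complex \<Rightarrow> complex" where
  "inv_cayley b \<xi> = (b - \<xi> * cnj b) / (1 - \<xi>)"

lemma diff_cnj_nonzero: "0 < Im a \<Longrightarrow> 0 < Im b \<Longrightarrow> a - cnj b \<noteq> 0"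
  by (auto simp: complex_eq_iff)

lemma cayley_norm_less_1:
  assumes "0 < Im b" "0 < Im z" shows "cmod (cayley b z) < 1"
proof -
  have "cmod (z - b)^2 < cmod (z - cnj b)^2"
    using norm_diff_cnj_square[of z b] assms by simp
  then have "cmod (z - b) < cmod (z - cnj b)"
    by (rule power_less_imp_less_base) simp
  then show ?thesis
    using diff_cnj_nonzero[OF assms(2,1)] by (simp add: cayley_def norm_divide)
qed

lemma inv_cayley_Im_pos:
  assumes b: "0 < Im b" and x: "cmod \<xi> < 1" shows "0 < Im (inv_cayley b \<xi>)"
proof -
  have ne: "1 - \<xi> \<noteq> 0" using x by auto
  have "inv_cayley b \<xi> = (b - \<xi> * cnj b) * cnj (1 - \<xi>) / (cmod (1 - \<xi>))^2"
    unfolding inv_cayley_def by (rule complex_div_cnj)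
  then have "Im (inv_cayley b \<xi>) = Im ((b - \<xi> * cnj b) * cnj (1 - \<xi>)) / (cmod (1 - \<xi>))^2"
    by (metis Im_divide_of_real of_real_power)
  also have "Im ((b - \<xi> * cnj b) * cnj (1 - \<xi>)) = Im b * (1 - cmod \<xi> ^ 2)"
    unfolding cmod_power2 by (simp add: power2_eq_square algebra_simps)
  also have "Im b * (1 - cmod \<xi> ^ 2) / (cmod (1 - \<xi>))^2 > 0"
    using assms ne by (simp add: power_less_one_iff abs_square_less_1)
  finally show ?thesis .
qed

lemma inv_cayley_cayley:
  assumes "0 < Im b" "0 < Im z" shows "inv_cayley b (cayley b z) = z"
proof -
  have n1: "z - cnj b \<noteq> 0" using diff_cnj_nonzero[OF assms(2,1)] .
  have n2: "b - cnj b \<noteq> 0" using diff_cnj_nonzero[OF assms(1,1)] .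
  have "1 - cayley b z = (b - cnj b) / (z - cnj b)"
    using n1 by (simp add: cayley_def field_simps)
  moreover have "b - cayley b z * cnj b = z * (b - cnj b) / (z - cnj b)"
    using n1 by (simp add: cayley_def field_simps)
  ultimately show ?thesis using n1 n2 by (simp add: inv_cayley_def)
qed

lemma cayley_self [simp]: "cayley b b = 0" by (simp add: cayley_def)
lemma inv_cayley_0 [simp]: "inv_cayley b 0 = b" by (simp add: inv_cayley_def)

lemma cayley_holomorphic: "0 < Im b \<Longrightarrow> cayley b holomorphic_on upper_half_plane"
  unfolding cayley_def[abs_def] by (intro holomorphic_intros) (use diff_cnj_nonzero in auto)

lemma inv_cayley_holomorphic: "inv_cayley b holomorphic_on ball 0 1"
  unfolding inv_cayley_def[abs_def] by (intro holomorphic_intros) auto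

text \<open>Conjugating N by the Cayley transforms centred at w and \<open>N w\<close> gives a
  self-map of the disc that fixes 0, and the three claims are those of the Schwarz lemma. Strict
  positivity puts the target in the open disc; the applications below reach it by shifting N by a
  small imaginary constant or by proving it.\<close>

lemma schwarz_half_plane:
  assumes holN: "N holomorphic_on upper_half_plane"
    and pos: "\<And>z. 0 < Im z \<Longrightarrow> 0 < Im (N z)" and w: "0 < Im w"
  shows "0 < Im z \<Longrightarrow> cmod (cayley (N w) (N z)) \<le> cmod (cayley w z)"
    and "cmod (deriv N w) * Im w \<le> Im (N w)"
    and "cmod (deriv N w) * Im w = Im (N w) \<Longrightarrow>
      \<exists>\<alpha>. cmod \<alpha> = 1 \<and> deriv N w * of_real (Im w) = \<alpha> * of_real (Im (N w)) \<and>
        (\<forall>z. 0 < Im z \<longrightarrow> cayley (N w) (N z) = \<alpha> * cayley w z)"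
proof -
  define f where "f = cayley (N w) \<circ> (N \<circ> inv_cayley w)"
  have img: "inv_cayley w ` ball 0 1 \<subseteq> upper_half_plane"
    using inv_cayley_Im_pos[OF w] by auto
  have holNT: "(N \<circ> inv_cayley w) holomorphic_on ball 0 1"
    using holomorphic_on_compose_gen[OF inv_cayley_holomorphic holN] img by blast
  have holf: "f holomorphic_on ball 0 1"
    unfolding f_def
    by (rule holomorphic_on_compose_gen[OF holNT cayley_holomorphic])
       (use pos w inv_cayley_Im_pos[OF w] in auto)
  have f0: "f 0 = 0" by (simp add: f_def)
  have f1: "cmod (f \<xi>) < 1" if "cmod \<xi> < 1" for \<xi>
    using that pos w inv_cayley_Im_pos[OF w] by (simp add: f_def cayley_norm_less_1)
  note schwarz = Schwarz_Lemma[OF holf f0 f1]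
  have fc: "f (cayley w z) = cayley (N w) (N z)" if "0 < Im z" for z
    using that w by (simp add: f_def inv_cayley_cayley)
  show "cmod (cayley (N w) (N z)) \<le> cmod (cayley w z)" if "0 < Im z"
    using schwarz(1)[OF _ cayley_norm_less_1[OF w that]] fc[OF that] by simp
  have nw: "w - cnj w \<noteq> 0" "N w - cnj (N w) \<noteq> 0"
    using diff_cnj_nonzero w pos by auto
  have d1: "(inv_cayley w has_field_derivative (w - cnj w)) (at 0)"
    unfolding inv_cayley_def[abs_def]
    by (auto intro!: derivative_eq_intros simp: algebra_simps)
  have d2: "(N has_field_derivative deriv N w) (at (inv_cayley w 0))"
    using holN w by (auto intro!: holomorphic_derivI[where S = upper_half_plane])
  have d3: "(cayley (N w) has_field_derivative 1 / (N w - cnj (N w))) (at ((N \<circ> inv_cayley w) 0))"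
    unfolding cayley_def[abs_def]
    using nw by (auto intro!: derivative_eq_intros simp: divide_simps)
  have "(f has_field_derivative 1 / (N w - cnj (N w)) * (deriv N w * (w - cnj w))) (at 0)"
    unfolding f_def by (rule DERIV_chain[OF d3 DERIV_chain[OF d2 d1]])
  then have "deriv f 0 = 1 / (N w - cnj (N w)) * (deriv N w * (w - cnj w))"
    by (rule DERIV_imp_deriv)
  \<comment> \<open>Both \<open>w - cnj w\<close> and \<open>N w - cnj (N w)\<close> are 2 i times
    an imaginary part, so the factors 2 i cancel.\<close>
  also have "\<dots> = deriv N w * of_real (Im w) / of_real (Im (N w))"
    using nw pos[OF w] by (simp add: complex_diff_cnj)
  finally have df: "deriv f 0 = deriv N w * of_real (Im w) / of_real (Im (N w))" .
  show "cmod (deriv N w) * Im w \<le> Im (N w)"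
    using schwarz(2)[of 0] df pos[OF w] w by (simp add: norm_mult norm_divide)
  show "\<exists>\<alpha>. cmod \<alpha> = 1 \<and> deriv N w * of_real (Im w) = \<alpha> * of_real (Im (N w)) \<and>
        (\<forall>z. 0 < Im z \<longrightarrow> cayley (N w) (N z) = \<alpha> * cayley w z)"
    if eq: "cmod (deriv N w) * Im w = Im (N w)"
  proof -
    have "cmod (deriv f 0) = 1"
      using eq df pos[OF w] w by (simp add: norm_mult norm_divide)
    then obtain \<alpha> where a: "\<forall>z. cmod z < 1 \<longrightarrow> f z = \<alpha> * z" "cmod \<alpha> = 1"
      using schwarz(3)[of 0] by auto
    have "deriv f 0 = \<alpha>"
    proof (rule DERIV_imp_deriv)
      have "((\<lambda>z. \<alpha> * z) has_field_derivative \<alpha>) (at 0)"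
        by (auto intro!: derivative_eq_intros)
      then show "(f has_field_derivative \<alpha>) (at 0)"
        by (rule has_field_derivative_transform_within_open[where S = "ball 0 1"]) (use a in auto)
    qed
    then have "deriv N w * of_real (Im w) = \<alpha> * of_real (Im (N w))"
      using df pos[OF w] by (auto simp: field_simps)
    moreover have "\<forall>z. 0 < Im z \<longrightarrow> cayley (N w) (N z) = \<alpha> * cayley w z"
      using a fc cayley_norm_less_1[OF w] by metis
    ultimately show ?thesis using a by blast
  qed
qed

text \<open>Apply the strict case to N + i e and let e tend to 0. Clearing denominators first keeps
  the inequality meaningful where \<open>Im (N z)\<close> vanishes.\<close>

lemma schwarz_pick:
  assumes N: "pick N" and z: "0 < Im z" and w: "0 < Im w"
  shows "cmod (N z - N w)^2 * (Im z * Im w) \<le> cmod (z - w)^2 * (Im (N z) * Im (N w))"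
proof -
  have strict: "cmod (N z - N w)^2 * (Im z * Im w) \<le>
    cmod (z - w)^2 * ((Im (N z) + e) * (Im (N w) + e))" if e: "e > 0" for e
  proof -
    define M where "M = (\<lambda>z. N z + \<i> * of_real e)"
    have hol: "M holomorphic_on upper_half_plane"
      unfolding M_def by (intro holomorphic_intros pick_holomorphic N)
    have pos: "0 < Im (M z)" if "0 < Im z" for z
      using pick_Im_nonneg[OF N that] e by (simp add: M_def)
    define A B where "A = Im z * Im w" and "B = Im (M z) * Im (M w)"
    define X Y where "X = cmod (z - w)^2" and "Y = cmod (M z - M w)^2"
    have AB: "A > 0" "B > 0" using z w pos by (auto simp: A_def B_def)
    have XY: "X \<ge> 0" "Y \<ge> 0" by (auto simp: X_def Y_def)
    have "cmod (cayley (M w) (M z))^2 \<le> cmod (cayley w z)^2"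
      by (intro power_mono schwarz_half_plane(1)[OF hol pos w z]) auto
    then have "Y / (Y + 4 * B) \<le> X / (X + 4 * A)"
      unfolding cayley_def norm_divide power_divide norm_diff_cnj_square A_def B_def X_def Y_def .
    moreover have "Y + 4 * B > 0" "X + 4 * A > 0" using AB XY by auto
    ultimately have "Y * (X + 4 * A) \<le> X * (Y + 4 * B)"
      by (simp add: field_simps)
    then have "Y * A \<le> X * B" by (simp add: algebra_simps)
    then show ?thesis by (simp add: X_def Y_def A_def B_def M_def)
  qed
  have "((\<lambda>e. cmod (z - w)^2 * ((Im (N z) + e) * (Im (N w) + e))) \<longlongrightarrow>
      cmod (z - w)^2 * ((Im (N z) + 0) * (Im (N w) + 0))) (at_right 0)"
    by (intro tendsto_intros)
  moreover have "eventually (\<lambda>e. cmod (N z - N w)^2 * (Im z * Im w) \<le>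
    cmod (z - w)^2 * ((Im (N z) + e) * (Im (N w) + e))) (at_right 0)"
    using eventually_at_right_less by (rule eventually_mono) (rule strict)
  ultimately have "cmod (N z - N w)^2 * (Im z * Im w) \<le>
     cmod (z - w)^2 * ((Im (N z) + 0) * (Im (N w) + 0))"
    by (rule tendsto_lowerbound) simp
  then show ?thesis by simp
qed

text \<open>The working form of Schwarz-Pick: only the ratios \<open>Im N / Im\<close> at the two
  points matter, and their geometric mean is the Lipschitz constant.\<close>

lemma schwarz_pick_ratio:
  assumes N: "pick N" and z: "0 < Im z" and w: "0 < Im w"
    and c: "Im (N z) \<le> c * Im z" and d: "Im (N w) \<le> d * Im w"
  shows "cmod (N z - N w)^2 \<le> c * d * cmod (z - w)^2"
proof -
  have "Im (N z) * Im (N w) \<le> (c * Im z) * (d * Im w)"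
    using pick_Im_nonneg[OF N] z w c d by (intro mult_mono) (auto intro: order_trans)
  then have "cmod (N z - N w)^2 * (Im z * Im w) \<le> cmod (z - w)^2 * ((c * Im z) * (d * Im w))"
    using schwarz_pick[OF N z w] by (meson mult_left_mono order_trans zero_le_power2)
  then have "(cmod (N z - N w)^2) * (Im z * Im w) \<le> (c * d * cmod (z - w)^2) * (Im z * Im w)"
    by (simp add: mult_ac)
  then show ?thesis
    using z w by (meson mult_pos_pos mult_le_cancel_right_pos)
qed

lemma pick_lipschitz:
  assumes N: "pick N" and z: "0 < Im z" and w: "0 < Im w" and c: "0 \<le> c"
    and "Im (N z) \<le> c * Im z" "Im (N w) \<le> c * Im w"
  shows "cmod (N z - N w) \<le> c * cmod (z - w)"
proof -
  have "cmod (N z - N w)^2 \<le> (c * cmod (z - w))^2"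
    using schwarz_pick_ratio[OF assms(1-3,5,6)] by (simp add: power2_eq_square mult_ac)
  then show ?thesis by (rule power2_le_imp_le) (use c in auto)
qed

text \<open>Strictness at one of the points suffices, since the two ratios enter as a
  product.\<close>

lemma pick_strict_contraction:
  assumes N: "pick N" and z: "0 < Im z" and w: "0 < Im w"
    and c: "Im (N z) < Im z" and d: "Im (N w) \<le> Im w" and ne: "z \<noteq> w"
  shows "cmod (N z - N w) < cmod (z - w)"
proof -
  have "Im (N z) / Im z < 1" using c z by simp
  moreover have "cmod (N z - N w)^2 \<le> (Im (N z) / Im z) * cmod (z - w)^2"
    using schwarz_pick_ratio[OF N z w, of "Im (N z) / Im z" 1] assms by simp
  moreover have "cmod (z - w)^2 > 0" using ne by simp
  ultimately have "cmod (N z - N w)^2 < 1 * cmod (z - w)^2"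
    by (meson mult_strict_right_mono order_le_less_trans)
  then show ?thesis by (simp add: power_less_imp_less_base)
qed

lemma pick_deriv_bound:
  assumes N: "pick N" and w: "0 < Im w"
  shows "cmod (deriv N w) * Im w \<le> Im (N w)"
proof -
  have "cmod (deriv N w) * Im w \<le> Im (N w) + e" if "e > 0" for e
  proof -
    define M where "M = (\<lambda>z. N z + \<i> * of_real e)"
    have hol: "M holomorphic_on upper_half_plane"
      unfolding M_def by (intro holomorphic_intros pick_holomorphic N)
    have pos: "0 < Im (M z)" if "0 < Im z" for z
      using pick_Im_nonneg[OF N that] \<open>e > 0\<close> by (simp add: M_def)
    have "N field_differentiable at w"
      using pick_holomorphic[OF N] w by (auto intro: holomorphic_on_imp_differentiable_at)
    then have "deriv M w = deriv N w"
      unfolding M_def by (simp add: deriv_add)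
    then show ?thesis using schwarz_half_plane(2)[OF hol pos w] by (simp add: M_def)
  qed
  then show ?thesis by (rule field_le_epsilon)
qed

text \<open>The equality case: the hypotheses make the rotation factor of the Schwarz lemma equal to
  1, and since \<open>N w - w\<close> is real, the resulting Moebius map is a translation. It serves
  to exclude critical points of \<open>w - N w\<close> at which this function is real.\<close>

lemma pick_translation:
  assumes N: "pick N" and w: "0 < Im w" and d: "deriv N w = 1" and eq: "Im (N w) = Im w" and z: "0 < Im z"
  shows "N z - N w = z - w"
proof -
  have pos: "0 < Im (N z)" if z: "0 < Im z" for z
  proof (rule ccontr)
    assume "\<not> 0 < Im (N z)"
    then have 0: "Im (N z) = 0" using pick_Im_nonneg[OF N z] by simp
    then have "cmod (N z - N w)^2 * (Im z * Im w) \<le> 0"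
      using schwarz_pick[OF N z w] by simp
    moreover have "cmod (N z - N w)^2 * (Im z * Im w) > 0"
    proof -
      have "N z \<noteq> N w" using 0 w eq by auto
      then show ?thesis using w z by simp
    qed
    ultimately show False by simp
  qed
  have "cmod (deriv N w) * Im w = Im (N w)" using d eq by simp
  from schwarz_half_plane(3)[OF pick_holomorphic[OF N] pos w this]
  obtain \<alpha> where a: "deriv N w * of_real (Im w) = \<alpha> * of_real (Im (N w))"
    "cayley (N w) (N z) = \<alpha> * cayley w z" using z by auto
  have "\<alpha> = 1" using a(1) d eq w by simp
  have r: "cnj (N w) = cnj w + (N w - w)"
    using eq by (simp add: complex_eq_iff)
  have n1: "z - cnj w \<noteq> 0" using diff_cnj_nonzero[OF z w] .
  have n2: "N z - cnj (N w) \<noteq> 0" using diff_cnj_nonzero pos z w by blast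
  have "(N z - N w) * (z - cnj w) = (z - w) * (N z - cnj (N w))"
    using a(2) \<open>\<alpha> = 1\<close> n1 n2 by (simp add: cayley_def field_simps)
  then have "(N z - N w - (z - w)) * (w - cnj w) = 0"
    unfolding r by (simp add: algebra_simps)
  then show ?thesis using diff_cnj_nonzero[OF w w] by simp
qed

section \<open>Sublinear Pick functions and subordination\<close>

lemma Im_le_cmod: "Im z \<le> cmod z"
  using abs_Im_le_cmod[of z] by linarith

text \<open>In Nevanlinna's representation of N the quotient tends to i times the coefficient of z,
  so the limit condition says that N has no linear part.\<close>

definition sublinear_pick :: "(complex \<Rightarrow> complex) \<Rightarrow> bool" where
  "sublinear_pick N \<longleftrightarrow>
     pick N \<and> ((\<lambda>y. N (\<i> * complex_of_real y) / complex_of_real y) \<longlongrightarrow> 0) at_top"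

lemma sublinear_pick_imp_pick: "sublinear_pick N \<Longrightarrow> pick N"
  by (simp add: sublinear_pick_def)

text \<open>A single point \<open>v\<close> where \<open>Im N\<close> is small compared with \<open>Im v\<close> controls \<open>N\<close> in every cone,
  because the Schwarz-Pick inequality bounds the growth of \<open>N\<close> away from \<open>v\<close>.\<close>

lemma pick_cone_bound:
  assumes N: "pick N" and small: "\<And>\<delta>. 0 < \<delta> \<Longrightarrow> \<exists>v. 0 < Im v \<and> Im (N v) \<le> \<delta> * Im v"
    and \<alpha>: "0 < \<alpha>" and \<epsilon>: "0 < \<epsilon>"
  shows "\<exists>B>0. \<forall>z. B < Im z \<and> \<bar>Re z\<bar> \<le> \<alpha> * Im z \<longrightarrow> cmod (N z) \<le> \<epsilon> * Im z"
proof -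
  \<comment> \<open>On the cone \<open>cmod z\<close> is at most (\<alpha> + 1) \<open>Im z\<close>,
    and \<open>cmod v\<close> is at most B, hence below \<open>Im z\<close>; together
    \<open>cmod (z - v)\<close> is at most (\<alpha> + 2) \<open>Im z\<close>.\<close>
  define C where "C = (\<alpha> + 2)^2"
  have C: "C > 0" using \<alpha> by (simp add: C_def)
  \<comment> \<open>The 4 absorbs a factor 2 from \<open>cmod (N v) + A \<le> 2 * A\<close> and
    another from bounding \<open>cmod (N z)\<close> by 2 A.\<close>
  define \<delta> where "\<delta> = \<epsilon> / (4 * C)"
  have \<delta>: "\<delta> > 0" using \<epsilon> C by (simp add: \<delta>_def)
  obtain v where v: "0 < Im v" "Im (N v) \<le> \<delta> * Im v" using small[OF \<delta>] by blast
  define B where "B = max (cmod v) (2 * cmod (N v) / \<epsilon>)"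
  have B: "B > 0" using v Im_le_cmod[of v] by (simp add: B_def)
  have "cmod (N z) \<le> \<epsilon> * Im z" if z: "B < Im z" "\<bar>Re z\<bar> \<le> \<alpha> * Im z" for z
  proof -
    have z0: "0 < Im z" using B z by simp
    define A where "A = cmod (N z - N v)"
    have "cmod z \<le> \<bar>Re z\<bar> + \<bar>Im z\<bar>" by (rule cmod_le)
    then have "cmod (z - v) \<le> (\<alpha> + 2) * Im z"
      using norm_triangle_ineq4[of z v] z z0 by (simp add: B_def algebra_simps)
    then have zv: "cmod (z - v)^2 \<le> C * Im z ^ 2"
      unfolding C_def power_mult_distrib[symmetric] by (rule power_mono) simp
    have imN: "Im (N z) \<le> cmod (N v) + A"
      using norm_triangle_ineq2[of "N z" "N v"] Im_le_cmod[of "N z"] by (simp add: A_def)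
    have "A^2 \<le> (Im (N z) / Im z) * \<delta> * cmod (z - v)^2"
      unfolding A_def by (rule schwarz_pick_ratio) (use N z0 v in auto)
    also have "\<dots> \<le> (Im (N z) / Im z) * \<delta> * (C * Im z ^ 2)"
      using pick_Im_nonneg[OF N z0] z0 \<delta> by (intro mult_left_mono zv) auto
    also have "\<dots> = Im (N z) * (\<delta> * C * Im z)"
      using z0 by (simp add: power2_eq_square)
    also have "\<dots> \<le> (cmod (N v) + A) * (\<delta> * C * Im z)"
      using imN \<delta> C z0 by (intro mult_right_mono) auto
    finally have A2: "A^2 \<le> (cmod (N v) + A) * (\<delta> * C * Im z)" .
    have tri: "cmod (N z) \<le> cmod (N v) + A"
      using norm_triangle_ineq2[of "N z" "N v"] by (simp add: A_def)
    \<comment> \<open>The bound on A has A on both sides. Either A is dominated by the fixed number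
      \<open>cmod (N v)\<close>, which B makes negligible, or one factor A can be cancelled.\<close>
    show ?thesis
    proof (cases "A \<le> cmod (N v)")
      case True
      then have "cmod (N z) \<le> 2 * cmod (N v)" using tri by simp
      also have "\<dots> \<le> \<epsilon> * Im z"
        using z(1) \<epsilon> by (simp add: B_def field_simps)
      finally show ?thesis .
    next
      case False
      then have A0: "A > 0" by (smt (verit) norm_ge_zero)
      have "A * A \<le> (2 * A) * (\<delta> * C * Im z)"
      proof -
        have "(cmod (N v) + A) * (\<delta> * C * Im z) \<le> (2 * A) * (\<delta> * C * Im z)"
          using False \<delta> C z0 by (intro mult_right_mono) auto
        then show ?thesis using A2 by (simp add: power2_eq_square)
      qed
      then have "A * A \<le> A * (\<epsilon> / 2 * Im z)"
        using C by (simp add: \<delta>_def)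
      then have "A \<le> \<epsilon> / 2 * Im z" using A0 by (simp only: mult_le_cancel_left_pos)
      then show ?thesis using tri False by linarith
    qed
  qed
  then show ?thesis using B by blast
qed

text \<open>By the cone bound, small ratios at arbitrary points imply the limit along the imaginary
  axis. This is what lets sublinearity be carried through \<omega>, which does not preserve that
  axis.\<close>

lemma sublinear_pickI:
  assumes N: "pick N" and small: "\<And>\<delta>. 0 < \<delta> \<Longrightarrow> \<exists>v. 0 < Im v \<and> Im (N v) \<le> \<delta> * Im v"
  shows "sublinear_pick N"
  unfolding sublinear_pick_def
proof (intro conjI N tendstoI)
  fix e :: real assume e: "0 < e"
  obtain B where B: "B > 0" "\<And>z. B < Im z \<and> \<bar>Re z\<bar> \<le> 1 * Im z \<Longrightarrow> cmod (N z) \<le> e/2 * Im z"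
    using pick_cone_bound[OF N small, of 1 "e/2"] e by auto
  have "dist (N (\<i> * complex_of_real y) / complex_of_real y) 0 < e" if y: "y > B" for y
  proof -
    have "cmod (N (\<i> * complex_of_real y)) \<le> e/2 * y" using B(2)[of "\<i> * complex_of_real y"] y B(1) by auto
    then have "cmod (N (\<i> * complex_of_real y)) < e * y"
      using y B(1) e by (smt (verit) mult_strict_right_mono field_sum_of_halves)
    then show ?thesis using y B(1) by (simp add: norm_divide field_simps)
  qed
  then show "\<forall>\<^sub>F y in at_top. dist (N (\<i> * complex_of_real y) / complex_of_real y) 0 < e"
    by (intro eventually_mono[OF eventually_gt_at_top[of B]])
qed

lemma sublinear_pick_small:
  assumes "sublinear_pick N" "0 < \<delta>"
  shows "\<exists>y>M. 0 < y \<and> Im (N (\<i> * complex_of_real y)) \<le> \<delta> * y"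
proof -
  have "\<forall>\<^sub>F y in at_top. dist (N (\<i> * complex_of_real y) / complex_of_real y) 0 < \<delta>"
    using assms unfolding sublinear_pick_def by (intro tendstoD) auto
  then have "\<forall>\<^sub>F y in at_top. dist (N (\<i> * complex_of_real y) / complex_of_real y) 0 < \<delta> \<and> y > max M 0"
    using eventually_gt_at_top by (rule eventually_conj)
  then obtain y where y: "cmod (N (\<i> * complex_of_real y) / complex_of_real y) < \<delta>" "y > M" "y > 0"
    using eventually_happens by fastforce
  then have "cmod (N (\<i> * complex_of_real y)) < \<delta> * y" by (simp add: norm_divide field_simps)
  then show ?thesis using y Im_le_cmod[of "N (\<i> * complex_of_real y)"] by force
qed

lemma sublinear_pick_small':
  assumes "sublinear_pick N" "0 < \<delta>"
  shows "\<exists>v. 0 < Im v \<and> Im (N v) \<le> \<delta> * Im v"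
proof -
  obtain y where "y > 0" "Im (N (\<i> * complex_of_real y)) \<le> \<delta> * y"
    using sublinear_pick_small[OF assms] by blast
  then show ?thesis by (intro exI[of _ "\<i> * complex_of_real y"]) auto
qed

lemma sublinear_pick_cone:
  assumes "sublinear_pick N" "0 < \<alpha>" "0 < \<epsilon>"
  shows "\<exists>B>0. \<forall>z. B < Im z \<and> \<bar>Re z\<bar> \<le> \<alpha> * Im z \<longrightarrow> cmod (N z) \<le> \<epsilon> * Im z"
  using pick_cone_bound sublinear_pick_small' sublinear_pick_imp_pick assms by metis

lemma sublinear_pick_add:
  assumes "sublinear_pick M" "sublinear_pick N"
  shows "sublinear_pick (\<lambda>z. M z + N z)"
proof -
  have "((\<lambda>y. M (\<i> * complex_of_real y) / complex_of_real y + N (\<i> * complex_of_real y) / complex_of_real y)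
      \<longlongrightarrow> 0 + 0) at_top"
    using assms unfolding sublinear_pick_def by (intro tendsto_add) auto
  then show ?thesis
    using assms pick_add by (auto simp: sublinear_pick_def add_divide_distrib)
qed

lemma sublinear_pick_scale:
  assumes "sublinear_pick N" "0 \<le> c"
  shows "sublinear_pick (\<lambda>z. complex_of_real c * N z)"
proof -
  have "((\<lambda>y. complex_of_real c * (N (\<i> * complex_of_real y) / complex_of_real y))
      \<longlongrightarrow> complex_of_real c * 0) at_top"
    using assms unfolding sublinear_pick_def by (intro tendsto_mult) auto
  then show ?thesis
    using assms pick_scale by (auto simp: sublinear_pick_def)
qed

text \<open>Letting \<open>w = i y\<close> tend to infinity in the Schwarz-Pick inequality gives \<open>Im F z \<ge> Im z\<close>.\<close>

lemma Im_ge_of_asymptotic_id: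
  assumes F: "pick F" and z: "0 < Im z"
    and lim: "((\<lambda>y. F (\<i> * complex_of_real y) / complex_of_real y) \<longlongrightarrow> \<i>) at_top"
  shows "Im z \<le> Im (F z)"
proof -
  let ?v = "\<lambda>y. \<i> * complex_of_real y"
  have inv: "((\<lambda>y. c / complex_of_real y) \<longlongrightarrow> 0) at_top" for c
  proof -
    have "((\<lambda>y. c * complex_of_real (inverse y)) \<longlongrightarrow> c * complex_of_real 0) at_top"
      by (intro tendsto_intros tendsto_inverse_0_at_top filterlim_ident)
    then show ?thesis by (simp add: divide_inverse)
  qed
  have 1: "((\<lambda>y. cmod (F z / complex_of_real y - F (?v y) / complex_of_real y)^2 * Im z) \<longlongrightarrow>
      cmod (0 - \<i>)^2 * Im z) at_top"
    by (intro tendsto_intros inv lim)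
  have 2: "((\<lambda>y. cmod (z / complex_of_real y - \<i>)^2 * (Im (F z) * Im (F (?v y) / complex_of_real y))) \<longlongrightarrow>
      cmod (0 - \<i>)^2 * (Im (F z) * Im \<i>)) at_top"
    by (intro tendsto_intros inv lim)
  have le: "cmod (F z / complex_of_real y - F (?v y) / complex_of_real y)^2 * Im z \<le>
      cmod (z / complex_of_real y - \<i>)^2 * (Im (F z) * Im (F (?v y) / complex_of_real y))" if y: "y > 0" for y
  proof -
    have "cmod (F z - F (?v y))^2 * (Im z * y) \<le> cmod (z - ?v y)^2 * (Im (F z) * Im (F (?v y)))"
      using schwarz_pick[OF F z, of "?v y"] y by simp
    moreover have "F z / complex_of_real y - F (?v y) / complex_of_real y = (F z - F (?v y)) / complex_of_real y"
      by (simp add: diff_divide_distrib)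
    moreover have "z / complex_of_real y - \<i> = (z - ?v y) / complex_of_real y"
      using y by (simp add: diff_divide_distrib)
    ultimately show ?thesis
      using y by (simp add: norm_divide power_divide field_simps)
  qed
  have "cmod (0 - \<i>)^2 * Im z \<le> cmod (0 - \<i>)^2 * (Im (F z) * Im \<i>)"
    by (rule tendsto_le[OF _ 2 1]) (use le in \<open>auto intro: eventually_mono[OF eventually_gt_at_top[of 0]]\<close>)
  then show ?thesis by simp
qed

lemma sublinear_pick_of_asymptotic_id:
  assumes F: "pick F"
    and lim: "((\<lambda>y. F (\<i> * complex_of_real y) / complex_of_real y) \<longlongrightarrow> \<i>) at_top"
  shows "sublinear_pick (\<lambda>z. F z - z)"
proof -
  have "pick (\<lambda>z. F z - z)"
    using F Im_ge_of_asymptotic_id[OF F _ lim]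
    by (auto simp: pick_def intro!: holomorphic_intros)
  moreover have "((\<lambda>y. F (\<i> * complex_of_real y) / complex_of_real y - \<i>) \<longlongrightarrow> \<i> - \<i>) at_top"
    by (intro tendsto_intros lim)
  then have "((\<lambda>y. (F (\<i> * complex_of_real y) - \<i> * complex_of_real y) / complex_of_real y) \<longlongrightarrow> 0) at_top"
    by (rule filterlim_cong[THEN iffD1, rotated -1])
       (use eventually_gt_at_top[of 0] in \<open>auto elim!: eventually_mono simp: diff_divide_distrib\<close>)
  ultimately show ?thesis by (simp add: sublinear_pick_def)
qed

section \<open>Inverting w - N w over the half-plane\<close>

lemma pick_resolvent_inj:
  assumes N: "pick N" and z: "0 < Im z" and w: "0 < Im w"
    and eq: "z - N z = w - N w" and pos: "0 < Im (z - N z)"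
  shows "z = w"
proof (rule ccontr)
  assume "z \<noteq> w"
  moreover have "0 < Im (w - N w)" using eq pos by simp
  ultimately have "cmod (N z - N w) < cmod (z - w)"
    using pos by (intro pick_strict_contraction[OF N z w]) auto
  moreover have "N z - N w = z - w" using eq by (simp add: algebra_simps)
  ultimately show False by simp
qed

text \<open>This is the properness estimate. Ratios 1 at w and 1/4 at v give the Lipschitz constant
  1/2, so half of \<open>cmod (w - v)\<close> can be absorbed on the left.\<close>

lemma pick_resolvent_bound:
  assumes N: "pick N" and w: "0 < Im w" and v: "0 < Im v"
    and "Im (N w) \<le> Im w" and "Im (N v) \<le> Im v / 4"
  shows "cmod (w - v) \<le> 2 * cmod (w - N w + N v - v)"
proof -
  have "cmod (N w - N v)^2 \<le> 1 * (1/4) * cmod (w - v)^2"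
    by (rule schwarz_pick_ratio) (use assms in auto)
  then have "cmod (N w - N v)^2 \<le> (cmod (w - v) / 2)^2"
    by (simp add: power_divide)
  then have "cmod (N w - N v) \<le> cmod (w - v) / 2"
    by (rule power2_le_imp_le) simp
  moreover have "cmod (w - v) \<le> cmod (w - N w + N v - v) + cmod (N w - N v)"
    using norm_triangle_ineq[of "w - N w + N v - v" "N w - N v"] by simp
  ultimately show ?thesis by simp
qed

text \<open>Equivalently, \<omega> z is a fixed point of the map sending w to z + N w, the
  subordination equation of free convolution powers.\<close>

definition subordination :: "(complex \<Rightarrow> complex) \<Rightarrow> (complex \<Rightarrow> complex) \<Rightarrow> bool" where
  "subordination N \<omega> \<longleftrightarrow> \<omega> holomorphic_on upper_half_plane \<and>
     (\<forall>z\<in>upper_half_plane. \<omega> z \<in> upper_half_plane \<and> \<omega> z - N (\<omega> z) = z)"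

text \<open>The image of \<Omega> under H is open because H is injective and holomorphic, relatively
  closed by properness, and nonempty by sublinearity. Connectedness makes it the whole half-plane,
  so the inverse of H on \<Omega> is defined everywhere.\<close>

lemma subordination_exists:
  assumes N: "sublinear_pick N"
  shows "\<exists>\<omega>. subordination N \<omega>"
proof -
  note pN = sublinear_pick_imp_pick[OF N]
  define H where "H = (\<lambda>w. w - N w)"
  define \<Omega> where "\<Omega> = {w \<in> upper_half_plane. 0 < Im (H w)}"
  have holH: "H holomorphic_on upper_half_plane"
    unfolding H_def by (intro holomorphic_intros pick_holomorphic pN)
  have contH: "continuous_on upper_half_plane H"
    using holH by (rule holomorphic_on_imp_continuous_on)
  have "\<Omega> = upper_half_plane \<inter> H -` upper_half_plane"
    by (auto simp: \<Omega>_def)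
  then have open\<Omega>: "open \<Omega>"
    using continuous_open_preimage[OF contH] by simp
  have inj: "inj_on H \<Omega>"
    using pick_resolvent_inj[OF pN] by (auto simp: inj_on_def \<Omega>_def H_def)
  have hol\<Omega>: "H holomorphic_on \<Omega>"
    using holH by (rule holomorphic_on_subset) (auto simp: \<Omega>_def)
  have openH: "open (H ` \<Omega>)"
    by (rule open_mapping_thm3[OF hol\<Omega> open\<Omega> inj])
  have sub: "H ` \<Omega> \<subseteq> upper_half_plane"
    by (auto simp: \<Omega>_def)
  obtain v where v: "0 < Im v" "Im (N v) \<le> (1/4) * Im v"
    using sublinear_pick_small'[OF N, of "1/4"] by auto
  have "z \<in> H ` \<Omega>" if z: "z \<in> upper_half_plane" and cl: "z \<in> closure (H ` \<Omega>)" for z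
  proof -
    obtain f where f: "\<And>n. f n \<in> H ` \<Omega>" "f \<longlonglongrightarrow> z"
      using cl by (auto simp: closure_sequential)
    have "\<forall>n. \<exists>w. w \<in> \<Omega> \<and> f n = H w" using f(1) by blast
    then obtain w where w: "\<And>n. w n \<in> \<Omega>" "\<And>n. f n = H (w n)" by metis
    obtain K where K: "\<And>n. cmod (f n) \<le> K"
      using convergent_imp_bounded[OF f(2)] by (auto simp: bounded_iff)
    have "cmod (w n) \<le> cmod v + 2 * (K + cmod (N v - v))" for n
    proof -
      have "cmod (w n - v) \<le> 2 * cmod (w n - N (w n) + N v - v)"
        by (rule pick_resolvent_bound[OF pN]) (use v w(1)[of n] in \<open>auto simp: \<Omega>_def H_def\<close>)
      also have "w n - N (w n) + N v - v = f n + (N v - v)" by (simp add: w(2) H_def)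
      also have "cmod \<dots> \<le> K + cmod (N v - v)"
        using norm_triangle_ineq[of "f n" "N v - v"] K[of n] by simp
      finally show ?thesis using norm_triangle_sub[of "w n" v] by simp
    qed
    then have "bounded (range w)" by (auto simp: bounded_iff)
    then obtain l r where r: "strict_mono (r :: nat \<Rightarrow> nat)" "(w \<circ> r) \<longlonglongrightarrow> l"
      using bounded_imp_convergent_subsequence by blast
    have fr: "(\<lambda>n. f (r n)) \<longlonglongrightarrow> z"
      using LIMSEQ_subseq_LIMSEQ[OF f(2) r(1)] by (simp add: o_def)
    \<comment> \<open>H lowers imaginary parts, so preimages of points near z stay away from the
      real line, and their limit l is an interior point.\<close>
    have "Im z \<le> Im l"
    proof (rule LIMSEQ_le[OF tendsto_Im[OF fr] tendsto_Im[OF r(2)]])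
      show "\<exists>M. \<forall>n\<ge>M. Im (f (r n)) \<le> Im ((w \<circ> r) n)"
        using w pick_Im_nonneg[OF pN] by (auto simp: H_def \<Omega>_def)
    qed
    then have l: "0 < Im l" using z by simp
    then have "isCont H l"
      using contH by (simp add: continuous_on_eq_continuous_at)
    then have "(\<lambda>n. H ((w \<circ> r) n)) \<longlonglongrightarrow> H l"
      using r(2) by (rule isCont_tendsto_compose)
    then have "H l = z" using fr w(2) by (simp add: LIMSEQ_unique)
    then show ?thesis using l z by (auto simp: \<Omega>_def)
  qed
  then have eq: "upper_half_plane \<inter> closure (H ` \<Omega>) = H ` \<Omega>"
    using sub closure_subset[of "H ` \<Omega>"] by (intro equalityI subsetI) auto
  have "closedin (top_of_set upper_half_plane) (upper_half_plane \<inter> closure (H ` \<Omega>))"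
    by (rule closedin_closed_Int) simp
  then have clo: "closedin (top_of_set upper_half_plane) (H ` \<Omega>)"
    unfolding eq .
  have ope: "openin (top_of_set upper_half_plane) (H ` \<Omega>)"
    using openH sub by (simp add: openin_open_eq)
  have "v \<in> \<Omega>" using v by (auto simp: \<Omega>_def H_def)
  then have "H ` \<Omega> \<noteq> {}" by blast
  then have img: "H ` \<Omega> = upper_half_plane"
    using connected_upper_half_plane ope clo by (auto simp: connected_clopen)
  obtain g where g: "g holomorphic_on (H ` \<Omega>)" "\<And>z. z \<in> \<Omega> \<Longrightarrow> g (H z) = z"
    by (rule holomorphic_has_inverse[OF hol\<Omega> open\<Omega> inj]) simp
  have "g z \<in> upper_half_plane \<and> g z - N (g z) = z" if "z \<in> upper_half_plane" for z
  proof -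
    have "z \<in> H ` \<Omega>" using that unfolding img .
    then obtain w where w: "w \<in> \<Omega>" "z = H w" by (elim imageE) simp
    then have "g z = w" using g(2) by simp
    then show ?thesis using w by (auto simp: \<Omega>_def H_def)
  qed
  then show ?thesis using g(1) unfolding img subordination_def by blast
qed

lemma subordination_Im_pos: "subordination N \<omega> \<Longrightarrow> 0 < Im z \<Longrightarrow> 0 < Im (\<omega> z)"
  by (simp add: subordination_def)

lemma subordination_right_inverse: "subordination N \<omega> \<Longrightarrow> 0 < Im z \<Longrightarrow> \<omega> z - N (\<omega> z) = z"
  by (simp add: subordination_def)

lemma subordination_eq:
  assumes "subordination N \<omega>" "0 < Im z" shows "N (\<omega> z) = \<omega> z - z"
proof -
  have "N (\<omega> z) = \<omega> z - (\<omega> z - N (\<omega> z))" by simp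
  then show ?thesis unfolding subordination_right_inverse[OF assms] .
qed

lemma subordination_left_inverse:
  assumes N: "pick N" and \<omega>: "subordination N \<omega>" and w: "0 < Im w" "0 < Im (w - N w)"
  shows "\<omega> (w - N w) = w"
proof -
  have "0 < Im (\<omega> (w - N w))" "\<omega> (w - N w) - N (\<omega> (w - N w)) = w - N w"
    by (rule subordination_Im_pos[OF \<omega> w(2)] subordination_right_inverse[OF \<omega> w(2)])+
  then show ?thesis
    using pick_resolvent_inj[OF N _ w(1)] w(2) by metis
qed

text \<open>The difference \<omega> z - z equals \<open>N (\<omega> z)\<close>, hence is a Pick
  function. Its smallness is tested at v = w - N w, where \<omega> v = w, so that a small ratio of N
  at w is inherited.\<close>

lemma sublinear_pick_subordination:
  assumes N: "sublinear_pick N" and \<omega>: "subordination N \<omega>"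
  shows "sublinear_pick (\<lambda>z. \<omega> z - z)"
proof (rule sublinear_pickI)
  note pN = sublinear_pick_imp_pick[OF N]
  show "pick (\<lambda>z. \<omega> z - z)"
  proof (rule pickI)
    show "(\<lambda>z. \<omega> z - z) holomorphic_on upper_half_plane"
      using \<omega> unfolding subordination_def by (intro holomorphic_intros) auto
    show "0 \<le> Im (\<omega> z - z)" if "0 < Im z" for z
      using pick_Im_nonneg[OF pN subordination_Im_pos[OF \<omega> that]] subordination_eq[OF \<omega> that] by simp
  qed
  fix \<delta> :: real assume \<delta>: "0 < \<delta>"
  \<comment> \<open>The bound 1/2 keeps \<open>Im v\<close> at least \<open>Im w / 2\<close>, and
    \<delta>/2 pays for that loss.\<close>
  obtain w where w: "0 < Im w" "Im (N w) \<le> min (1/2) (\<delta>/2) * Im w"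
    using sublinear_pick_small'[OF N, of "min (1/2) (\<delta>/2)"] \<delta> by auto
  have "min (1/2) (\<delta>/2) * Im w \<le> 1/2 * Im w" "min (1/2) (\<delta>/2) * Im w \<le> \<delta>/2 * Im w"
    using w(1) by (intro mult_right_mono; simp)+
  then have 1: "Im (N w) \<le> Im w / 2" "Im (N w) \<le> \<delta>/2 * Im w" using w(2) by auto
  define v where "v = w - N w"
  have v: "Im w / 2 \<le> Im v" using 1 by (simp add: v_def)
  have "\<omega> v = w" unfolding v_def
    by (rule subordination_left_inverse[OF pN \<omega>]) (use v w in \<open>auto simp: v_def\<close>)
  then have "Im (\<omega> v - v) = Im (N w)" by (simp add: v_def)
  also have "\<dots> \<le> \<delta> * (Im w / 2)" using 1 by simp
  also have "\<dots> \<le> \<delta> * Im v" using v \<delta> by (intro mult_left_mono) auto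
  finally show "\<exists>v. 0 < Im v \<and> Im (\<omega> v - v) \<le> \<delta> * Im v" using v w by (intro exI[of _ v]) auto
qed

section \<open>Cauchy transforms and Stieltjes inversion\<close>

lemma (in prob_space) norm_expectation_le:
  fixes f :: "'a \<Rightarrow> 'b::{banach, second_countable_topology}"
  assumes "integrable M f" "\<And>x. norm (f x) \<le> B"
  shows "norm (\<integral>x. f x \<partial>M) \<le> B"
proof -
  have "norm (\<integral>x. f x \<partial>M) \<le> (\<integral>x. norm (f x) \<partial>M)"
    by (rule integral_norm_bound)
  also have "\<dots> \<le> (\<integral>x. B \<partial>M)"
    using assms by (intro integral_mono) auto
  finally show ?thesis by (simp add: prob_space)
qed

lemma Im_le_norm_diff_real: "Im z \<le> cmod (z - complex_of_real t)"
  using Im_le_cmod[of "z - complex_of_real t"] by simp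

lemma diff_real_nonzero: "0 < Im z \<Longrightarrow> z - complex_of_real t \<noteq> 0"
  using Im_le_norm_diff_real[of z t] by auto

lemma norm_inverse_diff_real: "0 < Im z \<Longrightarrow> cmod (1 / (z - complex_of_real t)) \<le> 1 / Im z"
  using Im_le_norm_diff_real[of z t] by (simp add: norm_divide frac_le)

lemma Im_inverse_diff_real:
  "Im (1 / (z - complex_of_real t)) = - (Im z / ((Re z - t)^2 + (Im z)^2))"
  by (simp add: Im_divide power2_eq_square)

context real_distribution
begin

lemma prob_UNIV: "measure M UNIV = 1"
  using prob_space by simp

lemma integrable_inverse_diff_real:
  assumes "0 < Im z"
  shows "integrable M (\<lambda>t. 1 / (z - complex_of_real t))"
proof (rule integrable_const_bound)
  show "AE t in M. norm (1 / (z - complex_of_real t)) \<le> 1 / Im z"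
    using norm_inverse_diff_real[OF assms] by auto
qed simp

lemma norm_cauchy_transform_le:
  assumes "0 < Im z" shows "cmod (cauchy_transform M z) \<le> 1 / Im z"
  unfolding cauchy_transform_def
  by (rule norm_expectation_le[OF integrable_inverse_diff_real[OF assms] norm_inverse_diff_real[OF assms]])

text \<open>The error of the difference quotient is again an integral, with integrand (z - w) / ((z
  - t) (w - t)^2), so a uniform bound on this integrand proves differentiability.\<close>

lemma cauchy_transform_has_field_derivative:
  assumes w: "0 < Im w"
  shows "(cauchy_transform M has_field_derivative - (\<integral>t. 1 / (w - complex_of_real t)^2 \<partial>M)) (at w)"
  unfolding has_field_derivative_iff
proof (rule LIM_zero_cancel, rule Lim_null_comparison)
  let ?G = "cauchy_transform M"
  let ?D = "- (\<integral>t. 1 / (w - complex_of_real t)^2 \<partial>M)"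
  \<comment> \<open>Within distance \<open>Im w / 2\<close> of w the height of z exceeds
    \<open>Im w / 2\<close>, which bounds \<open>cmod (z - t)\<close> below;
    \<open>cmod (w - t)\<close> is at least \<open>Im w\<close>.\<close>
  define C where "C = 1 / (Im w / 2 * (Im w)^2)"
  have "norm ((?G z - ?G w) / (z - w) - ?D) \<le> cmod (z - w) * C"
    if z: "cmod (z - w) < Im w / 2" "z \<noteq> w" for z
  proof -
    have "Im w - Im z \<le> cmod (z - w)"
      using Im_le_cmod[of "w - z"] by (simp add: norm_minus_commute)
    then have Imz: "Im w / 2 < Im z" using z by simp
    then have z0: "0 < Im z" using w by simp
    have i2: "integrable M (\<lambda>t. 1 / (w - complex_of_real t)^2)"
    proof (rule integrable_const_bound)
      show "AE t in M. norm (1 / (w - complex_of_real t)^2) \<le> 1 / (Im w)^2"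
        using Im_le_norm_diff_real[of w] w
        by (auto simp: norm_divide norm_power intro!: frac_le power_mono)
    qed simp
    note i1 = integrable_inverse_diff_real[OF z0] integrable_inverse_diff_real[OF w]
    have eq: "(1 / (z - complex_of_real t) - 1 / (w - complex_of_real t)) / (z - w) + 1 / (w - complex_of_real t)^2
        = (z - w) / ((z - complex_of_real t) * (w - complex_of_real t)^2)" for t
    proof -
      have "a \<noteq> 0 \<Longrightarrow> b \<noteq> 0 \<Longrightarrow> a \<noteq> b \<Longrightarrow> (1 / a - 1 / b) / (a - b) + 1 / b^2 = (a - b) / (a * b^2)" for a b :: complex
        by (simp add: divide_simps) (simp add: power2_eq_square algebra_simps)
      from this[of "z - of_real t" "w - of_real t"] show ?thesis
        using diff_real_nonzero[OF z0] diff_real_nonzero[OF w] z(2) by simp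
    qed
    have "(?G z - ?G w) / (z - w) - ?D =
       (\<integral>t. (1 / (z - complex_of_real t) - 1 / (w - complex_of_real t)) / (z - w) + 1 / (w - complex_of_real t)^2 \<partial>M)"
      unfolding cauchy_transform_def using i1 i2 by simp
    also have "\<dots> = (\<integral>t. (z - w) / ((z - complex_of_real t) * (w - complex_of_real t)^2) \<partial>M)"
      unfolding eq ..
    finally have "norm ((?G z - ?G w) / (z - w) - ?D) =
       norm (\<integral>t. (z - w) / ((z - complex_of_real t) * (w - complex_of_real t)^2) \<partial>M)" by simp
    also have "\<dots> \<le> cmod (z - w) * C"
    proof (rule norm_expectation_le)
      show b: "norm ((z - w) / ((z - complex_of_real t) * (w - complex_of_real t)^2)) \<le> cmod (z - w) * C" for t
      proof -
        have "Im w / 2 * (Im w)^2 \<le> cmod (z - complex_of_real t) * cmod (w - complex_of_real t)^2"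
          using Im_le_norm_diff_real[of w t] Im_le_norm_diff_real[of z t] Imz w
          by (intro mult_mono power_mono) auto
        moreover have "0 < Im w / 2 * (Im w)^2" using w by simp
        ultimately show ?thesis
          using frac_le[OF norm_ge_zero order_refl, of "Im w / 2 * (Im w)^2" _ "z - w"]
          unfolding C_def norm_divide norm_mult norm_power by simp
      qed
      show "integrable M (\<lambda>t. (z - w) / ((z - complex_of_real t) * (w - complex_of_real t)^2))"
        by (rule integrable_const_bound[of _ "cmod (z - w) * C"]) (use b in auto)
    qed
    finally show ?thesis .
  qed
  then show "\<forall>\<^sub>F z in at w. norm ((?G z - ?G w) / (z - w) - ?D) \<le> cmod (z - w) * C"
    unfolding eventually_at by (intro exI[of _ "Im w / 2"]) (use w in \<open>auto simp: dist_norm\<close>)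
  have "((\<lambda>z. cmod (z - w) * C) \<longlongrightarrow> cmod (w - w) * C) (at w)"
    by (intro tendsto_intros)
  then show "((\<lambda>z. cmod (z - w) * C) \<longlongrightarrow> 0) (at w)" by simp
qed

lemma cauchy_transform_holomorphic: "cauchy_transform M holomorphic_on upper_half_plane"
  unfolding holomorphic_on_open[OF open_upper_half_plane]
  by (intro ballI exI) (rule cauchy_transform_has_field_derivative, simp)

lemma Im_cauchy_transform:
  assumes "0 < Im z"
  shows "Im (cauchy_transform M z) = - (\<integral>t. Im z / ((Re z - t)^2 + (Im z)^2) \<partial>M)"
    and "integrable M (\<lambda>t. Im z / ((Re z - t)^2 + (Im z)^2))"
proof -
  have "integrable M (\<lambda>t. - Im (1 / (z - complex_of_real t)))"
    using integrable_inverse_diff_real[OF assms] by (intro Bochner_Integration.integrable_minus integrable_Im)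
  then show "integrable M (\<lambda>t. Im z / ((Re z - t)^2 + (Im z)^2))"
    unfolding Im_inverse_diff_real by simp
  show "Im (cauchy_transform M z) = - (\<integral>t. Im z / ((Re z - t)^2 + (Im z)^2) \<partial>M)"
    unfolding cauchy_transform_def
    by (subst integral_Im[OF integrable_inverse_diff_real[OF assms], symmetric])
       (simp only: Im_inverse_diff_real integral_minus)
qed

lemma Im_cauchy_transform_neg:
  assumes z: "0 < Im z" shows "Im (cauchy_transform M z) < 0"
proof -
  let ?f = "\<lambda>t. Im z / ((Re z - t)^2 + (Im z)^2)"
  have pos: "?f t > 0" for t using z by (simp add: add_nonneg_pos)
  have "(\<integral>t. ?f t \<partial>M) \<noteq> 0"
  proof
    assume "(\<integral>t. ?f t \<partial>M) = 0"
    then have "AE t in M. ?f t = 0"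
      using integral_nonneg_eq_0_iff_AE[OF Im_cauchy_transform(2)[OF z]] pos by (simp add: less_imp_le)
    then have "AE t in M. False" using pos by (auto elim!: AE_mp simp: less_le)
    then show False by simp
  qed
  moreover have "(\<integral>t. ?f t \<partial>M) \<ge> 0" using pos by (intro integral_nonneg_AE) (auto intro: less_imp_le)
  ultimately show ?thesis using Im_cauchy_transform(1)[OF z] by linarith
qed

lemma cauchy_transform_asymptotics:
  "((\<lambda>y. complex_of_real y * cauchy_transform M (\<i> * complex_of_real y)) \<longlongrightarrow> - \<i>) at_top"
proof -
  have "((\<lambda>y. \<integral>t. complex_of_real y / (\<i> * complex_of_real y - complex_of_real t) \<partial>M) \<longlongrightarrow>
      (\<integral>t. - \<i> \<partial>M)) at_top"
  proof (rule integral_dominated_convergence_at_top[where w = "\<lambda>_. 1"])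
    show "AE t in M. ((\<lambda>y. complex_of_real y / (\<i> * complex_of_real y - complex_of_real t)) \<longlongrightarrow> - \<i>) at_top"
    proof (rule AE_I2)
      fix t
      have "((\<lambda>y. 1 / (\<i> - complex_of_real (t * inverse y))) \<longlongrightarrow> 1 / (\<i> - complex_of_real (t * 0))) at_top"
        by (intro tendsto_intros tendsto_inverse_0_at_top filterlim_ident) auto
      then have "((\<lambda>y. 1 / (\<i> - complex_of_real (t * inverse y))) \<longlongrightarrow> - \<i>) at_top"
        by (simp add: divide_inverse)
      then show "((\<lambda>y. complex_of_real y / (\<i> * complex_of_real y - complex_of_real t)) \<longlongrightarrow> - \<i>) at_top"
      proof (rule Lim_transform_eventually)
        show "\<forall>\<^sub>F y in at_top. 1 / (\<i> - complex_of_real (t * inverse y)) =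
            complex_of_real y / (\<i> * complex_of_real y - complex_of_real t)"
          using eventually_gt_at_top[of 0]
        proof eventually_elim
          case (elim y)
          have "\<i> * complex_of_real y - complex_of_real t = complex_of_real y * (\<i> - complex_of_real (t * inverse y))"
            using elim by (simp add: algebra_simps flip: of_real_mult)
          then show ?case using elim by simp
        qed
      qed
    qed
    show "\<forall>\<^sub>F y in at_top. AE t in M. norm (complex_of_real y / (\<i> * complex_of_real y - complex_of_real t)) \<le> 1"
      using eventually_gt_at_top[of 0]
    proof eventually_elim
      case (elim y)
      then show ?case
        using norm_inverse_diff_real[of "\<i> * complex_of_real y"] by (auto simp: norm_divide field_simps)
    qed
  qed simp_all
  moreover have "(\<integral>t. - \<i> \<partial>M) = - \<i>" by (simp add: prob_UNIV)
  moreover have "(\<integral>t. complex_of_real y / (\<i> * complex_of_real y - complex_of_real t) \<partial>M) =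
      complex_of_real y * cauchy_transform M (\<i> * complex_of_real y)" for y
    unfolding cauchy_transform_def by (simp flip: integral_mult_right_zero)
  ultimately show ?thesis by simp
qed

lemma cauchy_transform_nonzero: "0 < Im z \<Longrightarrow> cauchy_transform M z \<noteq> 0"
  using Im_cauchy_transform_neg[of z] by auto

lemma sublinear_pick_F_transform: "sublinear_pick (\<lambda>z. F_transform M z - z)"
proof (rule sublinear_pick_of_asymptotic_id)
  have "0 \<le> Im (F_transform M z)" if "0 < Im z" for z
    using Im_cauchy_transform_neg[OF that]
    by (simp add: F_transform_def Im_divide divide_nonpos_nonneg)
  then show "pick (F_transform M)"
    unfolding F_transform_def[abs_def] using cauchy_transform_nonzero
    by (intro pickI holomorphic_intros cauchy_transform_holomorphic) auto
  have "((\<lambda>y. 1 / (complex_of_real y * cauchy_transform M (\<i> * complex_of_real y))) \<longlongrightarrow> 1 / (- \<i>)) at_top"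
    by (intro tendsto_intros cauchy_transform_asymptotics) auto
  then show "((\<lambda>y. F_transform M (\<i> * complex_of_real y) / complex_of_real y) \<longlongrightarrow> \<i>) at_top"
    by (simp add: F_transform_def mult.commute)
qed

lemma F_transform_holomorphic: "F_transform M holomorphic_on upper_half_plane"
  unfolding F_transform_def[abs_def] using cauchy_transform_nonzero
  by (intro holomorphic_intros cauchy_transform_holomorphic) auto

lemma Im_F_transform_ge: "0 < Im z \<Longrightarrow> Im z \<le> Im (F_transform M z)"
  using pick_Im_nonneg[OF sublinear_pick_imp_pick[OF sublinear_pick_F_transform], of z] by simp

section \<open>Stieltjes inversion and uniqueness of the measure\<close>

lemma poisson_integral_eq_arctan:
  assumes ab: "a < b" and y: "0 < y"
  shows "(\<integral>x\<in>{a..b}. - Im (cauchy_transform M (Complex x y)) \<partial>lborel) =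
         (\<integral>t. arctan ((b - t) / y) - arctan ((a - t) / y) \<partial>M)"
proof -
  let ?k = "\<lambda>x t. y / ((x - t)^2 + y^2)"
  have pos: "(x - t)^2 + y^2 > 0" for x t using y by (simp add: add_nonneg_pos)
  have kb: "0 \<le> ?k x t" "?k x t \<le> 1 / y" for x t
  proof -
    have "y * y \<le> (x - t)^2 + y^2" by (simp add: power2_eq_square)
    then show "?k x t \<le> 1 / y" using y pos[of x t] by (simp add: divide_simps)
    show "0 \<le> ?k x t" using y pos[of x t] by simp
  qed
  interpret P: pair_sigma_finite lborel M
    by (intro pair_sigma_finite.intro sigma_finite_lborel sigma_finite_measure_axioms)
  have meas: "(\<lambda>(x, t). indicator {a..b} x * ?k x t) \<in> borel_measurable (lborel \<Otimes>\<^sub>M M)"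
    by measurable
  have "integrable (lborel \<Otimes>\<^sub>M M) (\<lambda>(x, t). indicator {a..b} x * ?k x t)"
  proof (rule integrableI_bounded_set_indicator[where A = "{a..b} \<times> UNIV" and B = "1/y", THEN Bochner_Integration.integrable_cong[THEN iffD1, rotated -1]])
    show "{a..b} \<times> UNIV \<in> sets (lborel \<Otimes>\<^sub>M M)" by (intro pair_measureI) auto
    show "(\<lambda>(x, t). indicator {a..b} x * ?k x t) \<in> borel_measurable (lborel \<Otimes>\<^sub>M M)" by (rule meas)
    show "emeasure (lborel \<Otimes>\<^sub>M M) ({a..b} \<times> UNIV) < \<infinity>"
      using ab emeasure_space_1 by (subst emeasure_pair_measure_Times) auto
    show "AE z in lborel \<Otimes>\<^sub>M M. z \<in> {a..b} \<times> UNIV \<longrightarrow>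
        norm (case z of (x, t) \<Rightarrow> indicator {a..b} x * ?k x t) \<le> 1 / y"
    proof (rule AE_I2, clarify)
      fix x t
      show "norm (indicator {a..b} x * ?k x t) \<le> 1 / y"
        using kb[of x t] y by (auto simp: indicator_def)
    qed
  qed (auto simp: indicator_def)
  then have "(\<integral>t. (\<integral>x. indicator {a..b} x * ?k x t \<partial>lborel) \<partial>M) = (\<integral>x. (\<integral>t. indicator {a..b} x * ?k x t \<partial>M) \<partial>lborel)"
    by (rule P.Fubini_integral)
  moreover have "(\<integral>t. indicator {a..b} x * ?k x t \<partial>M) = indicator {a..b} x * (- Im (cauchy_transform M (Complex x y)))" for x
    using Im_cauchy_transform[of "Complex x y"] y by (simp only: integral_mult_right_zero complex.sel minus_minus)
  moreover have "(\<integral>x. indicator {a..b} x * ?k x t \<partial>lborel) = arctan ((b - t) / y) - arctan ((a - t) / y)" for t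
  proof -
    have "(\<integral>x. ?k x t * indicator {a..b} x \<partial>lborel) = arctan ((b - t) / y) - arctan ((a - t) / y)"
    proof (rule integral_FTC_Icc_real)
      show "a \<le> b" using ab by simp
      show "((\<lambda>x. arctan ((x - t) / y)) has_real_derivative ?k x t) (at x)" for x
        using y pos[of x t]
        by (auto intro!: derivative_eq_intros simp: divide_simps power2_eq_square)
      show "isCont (\<lambda>x. ?k x t) x" for x
        using pos[of x t] by (intro continuous_intros) auto
    qed
    then show ?thesis by (simp add: mult.commute)
  qed
  ultimately show ?thesis by (simp add: set_lebesgue_integral_def)
qed

text \<open>Integrating the Poisson kernel over [a, b] gives a difference of arctangents in t. As
  the height tends to 0 it tends to pi inside the interval, to pi / 2 at its endpoints and to 0
  outside, so the endpoints count with half weight.\<close>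

theorem stieltjes_inversion:
  assumes ab: "a < b" and y: "\<And>n. 0 < y n" "y \<longlonglongrightarrow> 0"
  shows "(\<lambda>n. \<integral>x\<in>{a..b}. - Im (cauchy_transform M (Complex x (y n))) \<partial>lborel) \<longlonglongrightarrow>
         pi / 2 * (measure M {a<..<b} + measure M {a..b})"
proof -
  let ?L = "\<lambda>t. pi / 2 * indicator {a<..<b} t + pi / 2 * indicator {a..b} t :: real"
  have at: "(\<lambda>n. arctan (c / y n)) \<longlonglongrightarrow> sgn c * (pi/2)" for c
  proof -
    have "y n \<in> {0<..} \<and> y n \<noteq> 0" for n using y(1)[of n] by simp
    then have yr: "filterlim y (at_right 0) sequentially"
      unfolding filterlim_at by (intro conjI y(2) always_eventually allI) auto
    have *: "LIM n sequentially. inverse (y n) :> at_top"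
      using filterlim_compose[OF filterlim_inverse_at_top_right yr] .
    consider "c = 0" | "c > 0" | "c < 0" by linarith
    then show ?thesis
    proof cases
      case 2
      have "LIM n sequentially. c * inverse (y n) :> at_top"
        using filterlim_tendsto_pos_mult_at_top[OF tendsto_const 2 *] .
      from filterlim_compose[OF tendsto_arctan_at_top this] show ?thesis using 2 by (simp add: divide_inverse[of c])
    next
      case 3
      have "LIM n sequentially. c * inverse (y n) :> at_bot"
        using filterlim_tendsto_neg_mult_at_bot[OF tendsto_const 3 *] .
      from filterlim_compose[OF tendsto_arctan_at_bot this] show ?thesis using 3 by (simp add: divide_inverse[of c])
    qed simp
  qed
  have "(\<lambda>n. \<integral>t. arctan ((b - t) / y n) - arctan ((a - t) / y n) \<partial>M) \<longlonglongrightarrow> (\<integral>t. ?L t \<partial>M)"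
  proof (rule integral_dominated_convergence[where w = "\<lambda>_. pi"])
    show "AE t in M. (\<lambda>n. arctan ((b - t) / y n) - arctan ((a - t) / y n)) \<longlonglongrightarrow> ?L t"
    proof (rule AE_I2)
      fix t
      have "sgn (b - t) * (pi/2) - sgn (a - t) * (pi/2) = ?L t"
        using ab by (auto simp: indicator_def sgn_if)
      then show "(\<lambda>n. arctan ((b - t) / y n) - arctan ((a - t) / y n)) \<longlonglongrightarrow> ?L t"
        using tendsto_diff[OF at[of "b - t"] at[of "a - t"]] by simp
    qed
    show "AE t in M. norm (arctan ((b - t) / y n) - arctan ((a - t) / y n)) \<le> pi" for n
    proof (rule AE_I2)
      fix t
      show "norm (arctan ((b - t) / y n) - arctan ((a - t) / y n)) \<le> pi"
        using arctan_lbound[of "(b - t) / y n"] arctan_ubound[of "(b - t) / y n"]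
          arctan_lbound[of "(a - t) / y n"] arctan_ubound[of "(a - t) / y n"] by auto
    qed
  qed auto
  also have "(\<integral>t. ?L t \<partial>M) = pi / 2 * (measure M {a<..<b} + measure M {a..b})"
    by (simp add: algebra_simps less_top[symmetric])
  finally show ?thesis
    using poisson_integral_eq_arctan[OF ab y(1)] by simp
qed

text \<open>The integrand i y / (x - t + i y) is 1 at t = x, tends to 0 at every other t, and is
  bounded by 1.\<close>

lemma point_mass_limit:
  assumes y: "\<And>n. 0 < y n" "y \<longlonglongrightarrow> 0"
  shows "(\<lambda>n. \<i> * complex_of_real (y n) * cauchy_transform M (Complex x (y n))) \<longlonglongrightarrow> complex_of_real (measure M {x})"
proof -
  have "(\<lambda>n. \<integral>t. \<i> * complex_of_real (y n) / (Complex x (y n) - complex_of_real t) \<partial>M) \<longlonglongrightarrow>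
     (\<integral>t. complex_of_real (indicator {x} t) \<partial>M)"
  proof (rule integral_dominated_convergence[where w = "\<lambda>_. 1"])
    show "AE t in M. (\<lambda>n. \<i> * complex_of_real (y n) / (Complex x (y n) - complex_of_real t)) \<longlonglongrightarrow> complex_of_real (indicator {x} t)"
    proof (rule AE_I2)
      fix t
      have C: "Complex x (y n) - complex_of_real t = complex_of_real (x - t) + \<i> * complex_of_real (y n)" for n
        by (simp add: complex_eq_iff)
      show "(\<lambda>n. \<i> * complex_of_real (y n) / (Complex x (y n) - complex_of_real t)) \<longlonglongrightarrow> complex_of_real (indicator {x} t)"
      proof (cases "t = x")
        case True
        have "y n \<noteq> 0" for n using y(1)[of n] by simp
        then show ?thesis unfolding C by (simp add: True)
      next
        case False
        have "(\<lambda>n. \<i> * complex_of_real (y n) / (complex_of_real (x - t) + \<i> * complex_of_real (y n))) \<longlonglongrightarrow>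
          \<i> * complex_of_real 0 / (complex_of_real (x - t) + \<i> * complex_of_real 0)"
          using False by (intro tendsto_intros y(2)) (simp del: of_real_diff)
        then show ?thesis unfolding C using False by simp
      qed
    qed
    show "AE t in M. norm (\<i> * complex_of_real (y n) / (Complex x (y n) - complex_of_real t)) \<le> 1" for n
      using norm_inverse_diff_real[of "Complex x (y n)"] y(1)[of n]
      by (auto simp: norm_divide norm_mult field_simps)
  qed simp_all
  also have "(\<integral>t. complex_of_real (indicator {x} t) \<partial>M) = complex_of_real (measure M {x})"
    by simp
  finally show ?thesis unfolding cauchy_transform_def by (simp flip: integral_mult_right_zero)
qed

lemma half_open_limit:
  "(\<lambda>n. measure M {- real n<..<b} + measure M {- real n..b}) \<longlonglongrightarrow> measure M {..<b} + measure M {..b}"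
proof (intro tendsto_add)
  have "(\<lambda>n. measure M {- real n<..<b}) \<longlonglongrightarrow> measure M (\<Union>n. {- real n<..<b})"
    by (rule finite_Lim_measure_incseq) (auto simp: incseq_def)
  also have "(\<Union>n. {- real n<..<b}) = {..<b}"
    using reals_Archimedean2 by (auto simp: neg_less_iff_less minus_less_iff)
  finally show "(\<lambda>n. measure M {- real n<..<b}) \<longlonglongrightarrow> measure M {..<b}" .
  have "(\<lambda>n. measure M {- real n..b}) \<longlonglongrightarrow> measure M (\<Union>n. {- real n..b})"
    by (rule finite_Lim_measure_incseq) (auto simp: incseq_def)
  also have "(\<Union>n. {- real n..b}) = {..b}"
    using real_arch_simple by (auto simp: minus_le_iff)
  finally show "(\<lambda>n. measure M {- real n..b}) \<longlonglongrightarrow> measure M {..b}" .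
qed

end

text \<open>Inversion determines only averages of open and closed intervals. Comparing b with a
  larger c and then letting c decrease to b removes the ambiguity, by right continuity. The
  inequality is stated in one direction because the other follows by symmetry.\<close>

lemma cdf_le_of_cauchy_transform_eq:
  assumes M: "real_distribution M" and N: "real_distribution N"
    and eq: "\<And>z. 0 < Im z \<Longrightarrow> cauchy_transform M z = cauchy_transform N z"
  shows "cdf M b \<le> cdf N b"
proof -
  interpret M: real_distribution M by (rule M)
  interpret N: real_distribution N by (rule N)
  define y where "y n = inverse (real (Suc n))" for n
  have y: "0 < y n" "y \<longlonglongrightarrow> 0" for n
    unfolding y_def[abs_def] using LIMSEQ_inverse_real_of_nat by simp_all
  have 1: "measure M {a<..<c} + measure M {a..c} = measure N {a<..<c} + measure N {a..c}" if "a < c" for a c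
  proof -
    have e: "cauchy_transform M (Complex x (y n)) = cauchy_transform N (Complex x (y n))" for x n
      using eq[of "Complex x (y n)"] y(1)[of n] by simp
    show ?thesis
      using LIMSEQ_unique[OF M.stieltjes_inversion[OF that y] N.stieltjes_inversion[OF that y, folded e]] by simp
  qed
  have 2: "measure M {..<c} + measure M {..c} = measure N {..<c} + measure N {..c}" for c
  proof (rule LIMSEQ_unique[OF M.half_open_limit])
    have "\<forall>\<^sub>F n in sequentially. - real n < c"
      using filterlim_real_sequentially eventually_gt_at_top[of "- c"]
      by (simp add: filterlim_iff minus_less_iff)
    then show "(\<lambda>n. measure M {- real n<..<c} + measure M {- real n..c}) \<longlonglongrightarrow> measure N {..<c} + measure N {..c}"
      by (intro Lim_transform_eventually[OF N.half_open_limit]) (auto elim!: eventually_mono simp: 1)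
  qed
  \<comment> \<open>Twice the left side is at most the averaged mass of M up to c, which is that of
    N and hence at most twice the right side.\<close>
  have "cdf M b \<le> cdf N c" if "b < c" for c
  proof -
    have "measure M {..b} \<le> measure M {..<c}" "measure M {..b} \<le> measure M {..c}"
      using that by (auto intro!: M.finite_measure_mono)
    moreover have "measure N {..<c} \<le> measure N {..c}"
      by (auto intro!: N.finite_measure_mono)
    ultimately show ?thesis using 2[of c] by (simp add: cdf_def)
  qed
  moreover have "(cdf N \<longlongrightarrow> cdf N b) (at_right b)"
    using N.cdf_is_right_cont by (simp add: continuous_within)
  ultimately show ?thesis
    by (intro tendsto_lowerbound[of "cdf N" "cdf N b" "at_right b"])
       (auto intro: eventually_mono[OF eventually_at_right_less])
qed

lemma real_distribution_eqI:
  assumes M: "real_distribution M" and N: "real_distribution N"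
    and eq: "\<And>z. 0 < Im z \<Longrightarrow> F_transform M z = F_transform N z"
  shows "M = N"
proof (rule cdf_unique[OF M N])
  have e: "cauchy_transform M z = cauchy_transform N z" if "0 < Im z" for z
    using eq[OF that] by (simp add: F_transform_def)
  show "cdf M = cdf N"
    by (intro ext antisym cdf_le_of_cauchy_transform_eq M N) (auto simp: e)
qed

section \<open>Every sublinear Pick function comes from a probability measure\<close>

lemma integrable_poisson_kernel:
  assumes y: "0 < y"
  shows "integrable lborel (\<lambda>s::real. y / ((s - x)^2 + y^2))"
proof -
  have "integrable lborel (\<lambda>s::real. inverse (1 + s^2))"
    using integrable_inverse_1_plus_square by (simp add: set_integrable_def)
  from lborel_integrable_real_affine[OF this, of "1/y" "- x/y"] y
  have "integrable lborel (\<lambda>s::real. (1/y) * inverse (1 + ((- x/y) + 1/y * s)^2))"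
    by (intro integrable_mult_right) auto
  moreover have "(1/y) * inverse (1 + ((- x/y) + 1/y * s)^2) = y / ((s - x)^2 + y^2)" for s :: real
  proof -
    have "1 + ((- x/y) + 1/y * s)^2 = ((s - x)^2 + y^2) / y^2"
      using y by (simp add: field_simps power2_eq_square)
    then show ?thesis using y by (simp add: power2_eq_square)
  qed
  ultimately show ?thesis by simp
qed

lemma poisson_kernel_eq:
  assumes "0 < Im z"
  shows "1 / ((complex_of_real s - z) * (complex_of_real s - cnj z)) =
         complex_of_real (1 / ((s - Re z)^2 + (Im z)^2))"
proof -
  have "(complex_of_real s - z) * (complex_of_real s - cnj z) = complex_of_real ((s - Re z)^2 + (Im z)^2)"
    by (simp add: complex_eq_iff power2_eq_square algebra_simps)
  then show ?thesis by simp
qed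

text \<open>Apply Cauchy's formula to f / (w - cnj z) on growing rectangles that stand on the real
  axis. The extra factor turns the Cauchy kernel into the Poisson kernel and makes the integrand
  decay quadratically, so the other three sides vanish in the limit.\<close>

lemma poisson_formula:
  fixes f :: "complex \<Rightarrow> complex"
  assumes \<delta>: "0 < \<delta>" and holf: "f holomorphic_on {w. - \<delta> < Im w}"
    and bnd: "\<And>w. 0 \<le> Im w \<Longrightarrow> cmod (f w) \<le> K" and z: "0 < Im z"
  shows "integrable lborel (\<lambda>s. complex_of_real (Im z / ((s - Re z)^2 + (Im z)^2)) * f (complex_of_real s))"
    and "(\<integral>s. complex_of_real (Im z / ((s - Re z)^2 + (Im z)^2)) * f (complex_of_real s) \<partial>lborel) = pi * f z"
proof -
  let ?k = "\<lambda>s. Im z / ((s - Re z)^2 + (Im z)^2)"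
  let ?I = "\<lambda>s. complex_of_real (?k s) * f (complex_of_real s)"
  have contf: "continuous_on {w. - \<delta> < Im w} f" using holf by (rule holomorphic_on_imp_continuous_on)
  have contfr: "continuous_on UNIV (\<lambda>s. f (complex_of_real s))"
    by (rule continuous_on_compose2[OF contf]) (use \<delta> in \<open>auto intro!: continuous_intros\<close>)
  have meas: "?I \<in> borel_measurable borel"
    by (intro borel_measurable_times borel_measurable_continuous_onI[OF contfr]) simp
  have K: "0 \<le> K" using order_trans[OF norm_ge_zero bnd[of 0]] by simp
  have dom: "norm (?I s) \<le> K * ?k s" for s
  proof -
    have "0 \<le> ?k s" using z by simp
    then have "norm (?I s) = ?k s * cmod (f (complex_of_real s))"
      unfolding norm_mult norm_of_real by (simp only: abs_of_nonneg)
    also have "\<dots> \<le> ?k s * K"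
      using bnd[of "complex_of_real s"] \<open>0 \<le> ?k s\<close> by (intro mult_left_mono) auto
    finally show ?thesis by (simp add: mult.commute)
  qed
  have intK: "integrable lborel (\<lambda>s. K * ?k s)"
    using integrable_poisson_kernel[OF z] by (rule integrable_mult_right)
  show intI: "integrable lborel ?I"
    by (rule Bochner_Integration.integrable_bound[OF intK]) (use meas dom K z in \<open>auto intro: order_trans[OF dom]\<close>)
  \<comment> \<open>S reaches below the real axis, so the bottom side lies inside it, but excludes
    the second pole \<open>cnj z\<close>.\<close>
  define S where "S = {w. - min \<delta> (Im z) < Im w}"
  define g where "g = (\<lambda>w. f w / (w - cnj z) / (w - z))"
  \<comment> \<open>Points of modulus at least \<open>R n\<close> have distance at least n + 1 from
    both z and \<open>cnj z\<close>.\<close>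
  define R where "R n = real n + cmod z + 1" for n
  have Rz: "cmod z < R n" "0 < R n" "R n - cmod z = real n + 1" for n
    by (simp_all add: R_def add_nonneg_pos)
  have ncnj: "w - cnj z \<noteq> 0" if "w \<in> S" for w
    using that by (auto simp: S_def complex_eq_iff)
  have holh: "(\<lambda>w. f w / (w - cnj z)) holomorphic_on S"
    using ncnj by (intro holomorphic_intros holomorphic_on_subset[OF holf]) (auto simp: S_def)
  have contg: "continuous_on (S - {z}) g"
    unfolding g_def using ncnj
    by (intro continuous_intros continuous_on_subset[OF contf]) (auto simp: S_def)
  have main: "cmod (pi * f z - Im z * (\<integral>s\<in>{- R n..R n}. complex_of_real (1 / ((s - Re z)^2 + (Im z)^2)) * f (complex_of_real s) \<partial>lborel))
      \<le> Im z * (4 * K * (real n + 1 + cmod z) / (real n + 1)^2)" for n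
  proof -
    define a1 a2 a3 a4 where "a1 = Complex (- R n) 0" and "a2 = Complex (R n) 0"
      and "a3 = Complex (R n) (R n)" and "a4 = Complex (- R n) (R n)"
    note a = a1_def a2_def a3_def a4_def
    have zbox: "z \<in> box a1 a3"
      using Rz(1)[of n] abs_Re_le_cmod[of z] abs_Im_le_cmod[of z] z
      by (auto simp: in_box_complex_iff a)
    have rp: "rectpath a1 a3 = linepath a1 a2 +++ linepath a2 a3 +++ linepath a3 a4 +++ linepath a4 a1"
      by (simp add: rectpath_def Let_def a)
    have convS: "convex S" unfolding S_def by (rule convex_halfspace_Im_gt)
    have cb: "path_image (rectpath a1 a3) = cbox a1 a3 - box a1 a3"
      using Rz(2)[of n] by (intro path_image_rectpath_cbox_minus_box) (auto simp: a)
    have sub: "path_image (rectpath a1 a3) \<subseteq> S - {z}"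
      unfolding cb using zbox z \<delta> by (auto simp: in_cbox_complex_iff S_def a)
    have "open S" unfolding S_def by (rule open_halfspace_Im_gt)
    then have "z \<in> interior S" using z \<delta> by (simp add: interior_open S_def)
    then have "(g has_contour_integral (2*pi * \<i> * winding_number (rectpath a1 a3) z * (f z / (z - cnj z)))) (rectpath a1 a3)"
      unfolding g_def
      by (intro Cauchy_integral_formula_convex_simple[OF convS holh _ _ sub]) auto
    then have "contour_integral (rectpath a1 a3) g = 2*pi * \<i> * (f z / (z - cnj z))"
      using winding_number_rectpath[OF zbox] by (simp add: contour_integral_unique)
    also have "z - cnj z = 2 * \<i> * Im z" by (simp add: complex_diff_cnj)
    finally have ci: "contour_integral (rectpath a1 a3) g = pi * f z / Im z" by simp
    have segs: "closed_segment a1 a2 \<subseteq> S - {z}" "closed_segment a2 a3 \<subseteq> S - {z}"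
      "closed_segment a3 a4 \<subseteq> S - {z}" "closed_segment a4 a1 \<subseteq> S - {z}"
      using sub unfolding rp by (auto simp: path_image_join)
    have cint: "g contour_integrable_on linepath a1 a2" "g contour_integrable_on linepath a2 a3"
      "g contour_integrable_on linepath a3 a4" "g contour_integrable_on linepath a4 a1"
      by (intro contour_integrable_continuous_linepath continuous_on_subset[OF contg] segs)+
    have split: "contour_integral (rectpath a1 a3) g = contour_integral (linepath a1 a2) g +
        (contour_integral (linepath a2 a3) g + (contour_integral (linepath a3 a4) g + contour_integral (linepath a4 a1) g))"
      unfolding rp using cint by simp
    have bound: "cmod (g w) \<le> K / (real n + 1)^2" if "R n \<le> cmod w" "0 \<le> Im w" for w
    proof -
      have 1: "real n + 1 \<le> cmod (w - z)"
        using norm_triangle_ineq2[of w z] that(1) Rz(3)[of n] by simp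
      have 2: "real n + 1 \<le> cmod (w - cnj z)"
        using norm_triangle_ineq2[of w "cnj z"] that(1) Rz(3)[of n] by simp
      have "(real n + 1)^2 \<le> cmod (w - cnj z) * cmod (w - z)"
        unfolding power2_eq_square using 1 2 by (intro mult_mono) auto
      moreover have "0 < (real n + 1)^2" by simp
      ultimately have "cmod (f w) / (cmod (w - cnj z) * cmod (w - z)) \<le> K / (real n + 1)^2"
        using bnd[OF that(2)] K by (intro frac_le) auto
      then show ?thesis by (simp add: g_def norm_divide norm_mult)
    qed
    have far: "R n \<le> cmod w \<and> 0 \<le> Im w"
      if "w \<in> closed_segment a2 a3 \<or> w \<in> closed_segment a3 a4 \<or> w \<in> closed_segment a4 a1" for w
    proof -
      have "Re w = R n \<and> 0 \<le> Im w \<or> Im w = R n \<or> Re w = - R n \<and> 0 \<le> Im w"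
        using that Rz(2)[of n] unfolding a
        by (auto simp: closed_segment_same_Re closed_segment_same_Im closed_segment_eq_real_ivl)
      then show ?thesis
        using abs_Re_le_cmod[of w] abs_Im_le_cmod[of w] Rz(2)[of n] by auto
    qed
    have B0: "0 \<le> K / (real n + 1)^2" using K by simp
    have s1: "cmod (contour_integral (linepath a2 a3) g) \<le> K / (real n + 1)^2 * cmod (a3 - a2)"
      by (rule contour_integral_bound_linepath[OF cint(2) B0]) (use far bound in blast)
    have s2: "cmod (contour_integral (linepath a3 a4) g) \<le> K / (real n + 1)^2 * cmod (a4 - a3)"
      by (rule contour_integral_bound_linepath[OF cint(3) B0]) (use far bound in blast)
    have s3: "cmod (contour_integral (linepath a4 a1) g) \<le> K / (real n + 1)^2 * cmod (a1 - a4)"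
      by (rule contour_integral_bound_linepath[OF cint(4) B0]) (use far bound in blast)
    have lens: "cmod (a3 - a2) = R n" "cmod (a4 - a3) = 2 * R n" "cmod (a1 - a4) = R n"
      using Rz(2)[of n] by (simp_all add: a cmod_def real_sqrt_mult)
    have "cmod (contour_integral (linepath a2 a3) g + (contour_integral (linepath a3 a4) g + contour_integral (linepath a4 a1) g))
       \<le> K / (real n + 1)^2 * R n + (K / (real n + 1)^2 * (2 * R n) + K / (real n + 1)^2 * R n)"
      using s1 s2 s3 unfolding lens by (intro norm_triangle_le add_mono)
    also have "\<dots> \<le> K / (real n + 1)^2 * (4 * R n)"
      by (simp add: algebra_simps)
    also have "\<dots> = 4 * K * (real n + 1 + cmod z) / (real n + 1)^2"
      by (simp add: R_def mult_ac add_ac)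
    finally have rest: "cmod (contour_integral (rectpath a1 a3) g - contour_integral (linepath a1 a2) g)
        \<le> 4 * K * (real n + 1 + cmod z) / (real n + 1)^2"
      unfolding split add_diff_cancel_left' .
    have geq: "g (complex_of_real s) = complex_of_real (1 / ((s - Re z)^2 + (Im z)^2)) * f (complex_of_real s)" for s
      using poisson_kernel_eq[OF z, of s] unfolding g_def by (simp add: mult.commute)
    have "contour_integral (linepath a1 a2) g = integral {- R n..R n} (\<lambda>s. g (complex_of_real s))"
      using contour_integral_linepath_Reals_eq[of a1 a2 g] Rz(2)[of n] by (simp add: a complex_is_Real_iff)
    also have "\<dots> = (\<integral>s\<in>{- R n..R n}. g (complex_of_real s) \<partial>lborel)"
    proof (rule set_borel_integral_eq_integral(2)[symmetric], rule borel_integrable_atLeastAtMost')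
      show "continuous_on {- R n..R n} (\<lambda>s. g (complex_of_real s))"
        by (rule continuous_on_compose2[OF contg]) (use z \<delta> in \<open>auto simp: S_def intro!: continuous_intros\<close>)
    qed
    finally have bottom: "contour_integral (linepath a1 a2) g =
       (\<integral>s\<in>{- R n..R n}. complex_of_real (1 / ((s - Re z)^2 + (Im z)^2)) * f (complex_of_real s) \<partial>lborel)"
      unfolding geq .
    let ?J = "\<integral>s\<in>{- R n..R n}. complex_of_real (1 / ((s - Re z)^2 + (Im z)^2)) * f (complex_of_real s) \<partial>lborel"
    have "cmod (Im z * (pi * f z / Im z - ?J)) \<le> Im z * (4 * K * (real n + 1 + cmod z) / (real n + 1)^2)"
      using rest z unfolding ci bottom norm_mult by (intro mult_mono) auto
    moreover have "Im z * (pi * f z / Im z - ?J) = pi * f z - Im z * ?J"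
      using z by (simp add: right_diff_distrib)
    ultimately show ?thesis by simp
  qed
  have scale: "Im z * (\<integral>s\<in>{- R n..R n}. complex_of_real (1 / ((s - Re z)^2 + (Im z)^2)) * f (complex_of_real s) \<partial>lborel)
      = (\<integral>s. indicator {- R n..R n} s *\<^sub>R ?I s \<partial>lborel)" for n
    unfolding set_lebesgue_integral_def
    by (subst integral_mult_right_zero[symmetric]) (auto intro!: Bochner_Integration.integral_cong simp: indicator_def)
  have "(\<lambda>n. \<integral>s. indicator {- R n..R n} s *\<^sub>R ?I s \<partial>lborel) \<longlonglongrightarrow> (\<integral>s. ?I s \<partial>lborel)"
  proof (rule integral_dominated_convergence[where w = "\<lambda>s. K * ?k s"])
    show "AE s in lborel. (\<lambda>n. indicator {- R n..R n} s *\<^sub>R ?I s) \<longlonglongrightarrow> ?I s"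
    proof (rule AE_I2)
      fix s :: real
      obtain m where m: "\<bar>s\<bar> \<le> real m" using real_arch_simple by blast
      have ge: "\<bar>s\<bar> \<le> R n" if "n \<ge> m" for n
        using order_trans[OF m of_nat_mono[OF that]] norm_ge_zero[of z] unfolding R_def by linarith
      have "\<forall>\<^sub>F n in sequentially. ?I s = indicator {- R n..R n} s *\<^sub>R ?I s"
        using eventually_ge_at_top[of m]
      proof eventually_elim
        case (elim n)
        then have "s \<in> {- R n..R n}" using ge[OF elim] by auto
        then show ?case by simp
      qed
      then show "(\<lambda>n. indicator {- R n..R n} s *\<^sub>R ?I s) \<longlonglongrightarrow> ?I s"
        by (rule Lim_transform_eventually[OF tendsto_const])
    qed
    show "AE s in lborel. norm (indicator {- R n..R n} s *\<^sub>R ?I s) \<le> K * ?k s" for n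
    proof (rule AE_I2)
      fix s
      have "0 \<le> K * ?k s" using K z by simp
      then show "norm (indicator {- R n..R n} s *\<^sub>R ?I s) \<le> K * ?k s"
        using dom[of s] by (cases "s \<in> {- R n..R n}") (simp_all del: atLeastAtMost_iff)
    qed
    show "(\<lambda>s. indicator {- R n..R n} s *\<^sub>R ?I s) \<in> borel_measurable lborel" for n
      using meas by simp
  qed (use meas intK in auto)
  then have l1: "(\<lambda>n. pi * f z - Im z * (\<integral>s\<in>{- R n..R n}. complex_of_real (1 / ((s - Re z)^2 + (Im z)^2)) * f (complex_of_real s) \<partial>lborel))
     \<longlonglongrightarrow> pi * f z - (\<integral>s. ?I s \<partial>lborel)"
    unfolding scale by (intro tendsto_diff tendsto_const)
  have l2: "(\<lambda>n. Im z * (4 * K * (real n + 1 + cmod z) / (real n + 1)^2)) \<longlonglongrightarrow> 0"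
    by real_asymp
  have "(\<lambda>n. pi * f z - Im z * (\<integral>s\<in>{- R n..R n}. complex_of_real (1 / ((s - Re z)^2 + (Im z)^2)) * f (complex_of_real s) \<partial>lborel)) \<longlonglongrightarrow> 0"
    by (rule Lim_null_comparison[OF always_eventually l2]) (use main in blast)
  with l1 have "pi * f z - (\<integral>s. ?I s \<partial>lborel) = 0" by (rule LIMSEQ_unique)
  then show "(\<integral>s. ?I s \<partial>lborel) = pi * f z" by simp
qed

section \<open>The probability measure attached to a sublinear Pick function\<close>

lemma pick_real_const:
  assumes "pick N" "0 < Im z" "0 < Im w" "Im (N z) = 0"
  shows "N z = N w"
proof -
  have "cmod (N z - N w)^2 * (Im z * Im w) \<le> 0"
    using schwarz_pick[OF assms(1-3)] assms(4) by simp
  moreover have "Im z * Im w > 0" using assms by simp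
  ultimately have "cmod (N z - N w)^2 \<le> 0"
    by (metis mult_le_0_iff not_le)
  then show ?thesis by simp
qed

context
  fixes N assumes N: "sublinear_pick N"
begin

text \<open>The prospective Cauchy transform of the measure to be constructed.\<close>

private definition G where "G z = 1 / (z + N z)"

private lemma Im_F: "0 < Im z \<Longrightarrow> Im z \<le> Im (z + N z)"
  using pick_Im_nonneg[OF sublinear_pick_imp_pick[OF N]] by simp

private lemma F_nonzero: "0 < Im z \<Longrightarrow> z + N z \<noteq> 0"
  using Im_F[of z] by (metis leD zero_complex.sel(2))

private lemma norm_G_le: assumes "0 < Im z" shows "cmod (G z) \<le> 1 / Im z"
proof -
  have "Im z \<le> cmod (z + N z)" using Im_F[OF assms] Im_le_cmod[of "z + N z"] by simp
  then show ?thesis using assms by (simp add: G_def norm_divide frac_le)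
qed

private lemma Im_G_nonpos: "0 < Im z \<Longrightarrow> Im (G z) \<le> 0"
  using Im_F[of z] by (simp add: G_def Im_divide divide_nonpos_nonneg)

private lemma G_holomorphic: "G holomorphic_on upper_half_plane"
  unfolding G_def[abs_def] using F_nonzero
  by (intro holomorphic_intros pick_holomorphic sublinear_pick_imp_pick N) auto

private lemma G_shift_holomorphic: "(\<lambda>w. G (w + \<i> * complex_of_real e)) holomorphic_on {w. - e < Im w}"
proof -
  have "G \<circ> (\<lambda>w. w + \<i> * complex_of_real e) holomorphic_on {w. - e < Im w}"
    by (rule holomorphic_on_compose_gen[OF _ G_holomorphic]) (auto intro!: holomorphic_intros)
  then show ?thesis by (simp add: o_def)
qed

text \<open>The limit is the total mass of the measure to be constructed, so it controls both
  normalisation and tightness.\<close>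

private lemma G_asymptotics: "((\<lambda>y. y * - Im (G (\<i> * complex_of_real y))) \<longlongrightarrow> 1) at_top"
proof -
  have "((\<lambda>y. - Im (1 / (\<i> + N (\<i> * complex_of_real y) / complex_of_real y))) \<longlongrightarrow> - Im (1 / (\<i> + 0))) at_top"
    using N unfolding sublinear_pick_def by (intro tendsto_intros) auto
  then have "((\<lambda>y. - Im (1 / (\<i> + N (\<i> * complex_of_real y) / complex_of_real y))) \<longlongrightarrow> 1) at_top"
    by simp
  then show ?thesis
  proof (rule Lim_transform_eventually)
    show "\<forall>\<^sub>F y in at_top. - Im (1 / (\<i> + N (\<i> * complex_of_real y) / complex_of_real y)) =
        y * - Im (G (\<i> * complex_of_real y))"
      using eventually_gt_at_top[of 0]
    proof eventually_elim
      case (elim y)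
      have "1 / (\<i> + N (\<i> * complex_of_real y) / complex_of_real y) = complex_of_real y * G (\<i> * complex_of_real y)"
        using elim by (simp add: G_def field_simps)
      then show ?case by simp
    qed
  qed
qed

text \<open>Stieltjes inversion at height e. For positive e this will be the convolution of the
  measure sought with the Cauchy distribution of scale e.\<close>

private definition shifted where
  "shifted e = density lborel (\<lambda>s. ennreal (- Im (G (Complex s e)) / pi))"

text \<open>The shift by i e makes G bounded by 1 / e on the closed half-plane and holomorphic
  across the real line, as the Poisson formula demands.\<close>

private lemma poisson_shifted:
  assumes e: "0 < e" and z: "0 < Im z"
  shows "integrable lborel (\<lambda>s. Im z / ((s - Re z)^2 + (Im z)^2) * (- Im (G (Complex s e)) / pi))"
    and "(\<integral>s. Im z / ((s - Re z)^2 + (Im z)^2) * (- Im (G (Complex s e)) / pi) \<partial>lborel) = - Im (G (z + \<i> * e))"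
proof -
  let ?f = "\<lambda>w. G (w + \<i> * e)"
  note holf = G_shift_holomorphic[of e]
  have bnd: "cmod (?f w) \<le> 1 / e" if "0 \<le> Im w" for w
    using norm_G_le[of "w + \<i> * e"] that e by (auto intro: order_trans simp: frac_le)
  have C: "complex_of_real s + \<i> * e = Complex s e" for s by (simp add: complex_eq_iff)
  note p = poisson_formula[OF e holf bnd z, unfolded C]
  have eq: "Im z / ((s - Re z)^2 + (Im z)^2) * (- Im (G (Complex s e)) / pi)
     = (- 1 / pi) * Im (complex_of_real (Im z / ((s - Re z)^2 + (Im z)^2)) * G (Complex s e))" for s
    by simp
  show "integrable lborel (\<lambda>s. Im z / ((s - Re z)^2 + (Im z)^2) * (- Im (G (Complex s e)) / pi))"
    unfolding eq by (intro integrable_mult_right integrable_Im p(1))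
  have "(\<integral>s. Im z / ((s - Re z)^2 + (Im z)^2) * (- Im (G (Complex s e)) / pi) \<partial>lborel) =
      (- 1 / pi) * (\<integral>s. Im (complex_of_real (Im z / ((s - Re z)^2 + (Im z)^2)) * G (Complex s e)) \<partial>lborel)"
    unfolding eq by (rule integral_mult_right_zero)
  also have "\<dots> = (- 1 / pi) * Im (pi * ?f z)"
    by (simp only: integral_Im[OF p(1)] p(2))
  finally show "(\<integral>s. Im z / ((s - Re z)^2 + (Im z)^2) * (- Im (G (Complex s e)) / pi) \<partial>lborel) = - Im (G (z + \<i> * e))"
    by simp
qed

text \<open>For the total mass, take the Poisson integral at z = i y and multiply it by y. The
  kernel y^2 / (s^2 + y^2) increases to 1 with y, so monotone convergence identifies the mass with
  the limit in \<open>G_asymptotics\<close>.\<close>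

private lemma shifted_density:
  assumes e: "0 < e"
  shows "(\<lambda>s. - Im (G (Complex s e)) / pi) \<in> borel_measurable borel"
    and "0 \<le> - Im (G (Complex s e)) / pi"
    and "integrable lborel (\<lambda>s. - Im (G (Complex s e)) / pi)"
    and "(\<integral>s. - Im (G (Complex s e)) / pi \<partial>lborel) = 1"
proof -
  let ?p = "\<lambda>s. - Im (G (Complex s e)) / pi"
  have C: "Complex s e = complex_of_real s + \<i> * e" for s by (simp add: complex_eq_iff)
  have "continuous_on UNIV (\<lambda>s. G (complex_of_real s + \<i> * e))"
    by (rule continuous_on_compose2[OF holomorphic_on_imp_continuous_on[OF G_holomorphic]])
       (use e in \<open>auto intro!: continuous_intros\<close>)
  then have "continuous_on UNIV ?p" unfolding C by (intro continuous_intros) auto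
  then show meas: "?p \<in> borel_measurable borel" by (rule borel_measurable_continuous_onI)
  show pos: "0 \<le> ?p s" for s using Im_G_nonpos[of "Complex s e"] e by (simp add: divide_nonpos_pos)
  define u where "u n s = (real (Suc n))^2 / (s^2 + (real (Suc n))^2) * ?p s" for n s
  have ueq: "u n s = real (Suc n) * (Im (\<i> * real (Suc n)) / ((s - Re (\<i> * real (Suc n)))^2 + (Im (\<i> * real (Suc n)))^2) * ?p s)" for n s
    by (simp add: u_def power2_eq_square)
  have den: "s^2 + (real (Suc n))^2 > 0" for s n by (simp add: add_nonneg_pos)
  have ui: "integrable lborel (u n)" for n
    unfolding ueq[abs_def] by (intro integrable_mult_right poisson_shifted e) simp
  have uint: "(\<integral>s. u n s \<partial>lborel) = real (Suc n) * - Im (G (\<i> * complex_of_real (real (Suc n) + e)))" for n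
    unfolding ueq integral_mult_right_zero
    by (subst poisson_shifted(2)[OF e]) (simp_all add: algebra_simps)
  have lim: "(\<lambda>n. real (Suc n) * - Im (G (\<i> * complex_of_real (real (Suc n) + e)))) \<longlonglongrightarrow> 1"
  proof -
    have top: "LIM n sequentially. real (Suc n) + e :> at_top" by real_asymp
    have 1: "(\<lambda>n. (real (Suc n) + e) * - Im (G (\<i> * complex_of_real (real (Suc n) + e)))) \<longlonglongrightarrow> 1"
      by (rule filterlim_compose[OF G_asymptotics top])
    have 2: "(\<lambda>n. real (Suc n) / (real (Suc n) + e)) \<longlonglongrightarrow> 1" by real_asymp
    have 3: "real (Suc n) / (real (Suc n) + e) * ((real (Suc n) + e) * x) = real (Suc n) * x" for n x
    proof -
      have "real (Suc n) + e \<noteq> 0" using e by linarith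
      then show ?thesis by simp
    qed
    show ?thesis using tendsto_mult[OF 2 1] unfolding 3 by simp
  qed
  have mono: "mono (\<lambda>n. u n s)" for s
  proof (rule monoI)
    fix m n :: nat assume "m \<le> n"
    then have "(real (Suc m))^2 \<le> (real (Suc n))^2" by (intro power_mono) auto
    then have "s^2 * (real (Suc m))^2 \<le> s^2 * (real (Suc n))^2" by (intro mult_left_mono) auto
    then have "(real (Suc m))^2 / (s^2 + (real (Suc m))^2) \<le> (real (Suc n))^2 / (s^2 + (real (Suc n))^2)"
      using den[of s m] den[of s n] by (simp add: divide_le_eq le_divide_eq algebra_simps del: of_nat_Suc)
    then show "u m s \<le> u n s" unfolding u_def by (rule mult_right_mono) (rule pos)
  qed
  have ulim: "(\<lambda>n. u n s) \<longlonglongrightarrow> ?p s" for s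
  proof -
    have "(\<lambda>n. (real (Suc n))^2 / (s^2 + (real (Suc n))^2)) \<longlonglongrightarrow> 1" by real_asymp
    from tendsto_mult_right[OF this, of "?p s"] show ?thesis unfolding u_def by simp
  qed
  have upos: "0 \<le> u n s" for n s unfolding u_def using pos[of s] den[of s n] by (intro mult_nonneg_nonneg) auto
  show "integrable lborel ?p" "(\<integral>s. ?p s \<partial>lborel) = 1"
    by (rule integral_monotone_convergence_nonneg[where f = u]; use ui mono upos ulim uint lim meas in simp)+
qed

private lemma real_distribution_shifted:
  assumes e: "0 < e" shows "real_distribution (shifted e)"
proof -
  have "(\<integral>\<^sup>+ s. ennreal (- Im (G (Complex s e)) / pi) \<partial>lborel) = ennreal 1"
    using shifted_density[OF e] by (subst nn_integral_eq_integral) auto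
  then have "prob_space (shifted e)"
    using shifted_density(1)[OF e]
    by (intro prob_spaceI) (simp add: shifted_def emeasure_density)
  then show ?thesis
    by (simp add: real_distribution_def real_distribution_axioms_def shifted_def)
qed

text \<open>The imaginary parts agree by the Poisson formula, so the difference D is a real
  constant. Both functions are at most 1 / \<open>Im z\<close> in modulus, hence D tends to 0 along
  the imaginary axis.\<close>

private lemma cauchy_transform_shifted:
  assumes e: "0 < e" and z: "0 < Im z"
  shows "cauchy_transform (shifted e) z = G (z + \<i> * e)"
proof -
  interpret S: real_distribution "shifted e" by (rule real_distribution_shifted[OF e])
  define D where "D = (\<lambda>z. cauchy_transform (shifted e) z - G (z + \<i> * e))"
  have Im_D: "Im (D z) = 0" if z: "0 < Im z" for z
  proof -
    have "Im (cauchy_transform (shifted e) z) = - (\<integral>t. Im z / ((Re z - t)^2 + (Im z)^2) \<partial>shifted e)"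
      by (rule S.Im_cauchy_transform[OF z])
    also have "(\<integral>t. Im z / ((Re z - t)^2 + (Im z)^2) \<partial>shifted e) =
       (\<integral>t. (- Im (G (Complex t e)) / pi) * (Im z / ((Re z - t)^2 + (Im z)^2)) \<partial>lborel)"
      unfolding shifted_def by (rule integral_real_density) (use shifted_density[OF e] in auto)
    also have "\<dots> = (\<integral>t. Im z / ((t - Re z)^2 + (Im z)^2) * (- Im (G (Complex t e)) / pi) \<partial>lborel)"
      by (simp add: mult.commute power2_commute[of "Re z"])
    finally show ?thesis using poisson_shifted(2)[OF e z] by (simp add: D_def)
  qed
  have "(\<lambda>z. G (z + \<i> * e)) holomorphic_on upper_half_plane"
    by (rule holomorphic_on_subset[OF G_shift_holomorphic]) (use e in auto)
  then have "D holomorphic_on upper_half_plane"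
    unfolding D_def by (intro holomorphic_intros S.cauchy_transform_holomorphic)
  then have pD: "pick D" using Im_D by (intro pickI) auto
  have "cmod (D z) \<le> 2 * inverse (real (Suc n))" for n
  proof -
    let ?w = "\<i> * real (Suc n)"
    have "D z = D ?w" by (rule pick_real_const[OF pD z]) (use Im_D[OF z] in auto)
    also have "cmod \<dots> \<le> cmod (cauchy_transform (shifted e) ?w) + cmod (G (?w + \<i> * e))"
      unfolding D_def by (rule norm_triangle_ineq4)
    also have "\<dots> \<le> 1 / real (Suc n) + 1 / (real (Suc n) + e)"
      using S.norm_cauchy_transform_le[of ?w] norm_G_le[of "?w + \<i> * e"] e by (intro add_mono) auto
    also have "\<dots> \<le> 1 / real (Suc n) + 1 / real (Suc n)" using e by (intro add_left_mono divide_left_mono) auto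
    also have "\<dots> = 2 * inverse (real (Suc n))" by (simp add: inverse_eq_divide)
    finally show ?thesis .
  qed
  then have "(\<lambda>n. cmod (D z)) \<longlonglongrightarrow> 0"
    by (intro real_tendsto_sandwich[OF _ _ tendsto_const tendsto_mult_right_zero[OF LIMSEQ_inverse_real_of_nat, of 2]]) auto
  then have "cmod (D z) = 0" by (simp add: LIMSEQ_const_iff)
  then show ?thesis by (simp add: D_def)
qed

text \<open>The kernel y^2 / (t^2 + y^2) is at most 1, and at most 1/2 outside the interval. A
  Poisson integral close to 1 therefore leaves little mass outside. The term 1 / y pays for
  replacing the factor y by y + e.\<close>

private lemma shifted_interval_mass:
  assumes e: "0 < e" "e \<le> 1" and y: "0 < y"
  shows "2 * ((y + e) * - Im (G (\<i> * complex_of_real (y + e))) - 1 / y) - 1 \<le> measure (shifted e) {- y<..y}"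
proof -
  interpret S: real_distribution "shifted e" by (rule real_distribution_shifted[OF e(1)])
  let ?w = "\<i> * complex_of_real (y + e)"
  have G0: "0 \<le> - Im (G ?w)" using Im_G_nonpos[of ?w] y e by simp
  have "- Im (G ?w) \<le> 1 / (y + e)"
    using norm_G_le[of ?w] y e abs_Im_le_cmod[of "G ?w"] by simp
  also have "\<dots> \<le> 1 / y" using y e by (intro divide_left_mono) auto
  finally have "e * - Im (G ?w) \<le> 1 * (1 / y)" using e G0 by (intro mult_mono) auto
  moreover have "y * - Im (G ?w) = (y + e) * - Im (G ?w) - e * - Im (G ?w)" by (simp add: algebra_simps)
  ultimately have 1: "(y + e) * - Im (G ?w) - 1 / y \<le> y * - Im (G ?w)" by linarith
  have I: "integrable (shifted e) (\<lambda>t. y * (y / (t^2 + y^2)))"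
    using S.Im_cauchy_transform(2)[of "\<i> * y"] y by (intro integrable_mult_right) simp
  have "y * - Im (G ?w) = y * - Im (cauchy_transform (shifted e) (\<i> * y))"
    using cauchy_transform_shifted[OF e(1), of "\<i> * y"] y by (simp add: algebra_simps)
  also have "\<dots> = (\<integral>t. y * (y / (t^2 + y^2)) \<partial>shifted e)"
    using S.Im_cauchy_transform(1)[of "\<i> * y"] y by (subst integral_mult_right_zero) simp
  also have "\<dots> \<le> (\<integral>t. 1/2 + 1/2 * indicator {- y<..y} t \<partial>shifted e)"
  proof (rule integral_mono[OF I])
    show "integrable (shifted e) (\<lambda>t. 1/2 + 1/2 * indicator {- y<..y} t :: real)"
      by (intro Bochner_Integration.integrable_add integrable_mult_right) (auto simp: less_top[symmetric])
    fix t
    have den: "t^2 + y^2 > 0" using y by (simp add: add_nonneg_pos)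
    show "y * (y / (t^2 + y^2)) \<le> 1/2 + 1/2 * indicator {- y<..y} t"
    proof (cases "t \<in> {- y<..y}")
      case True then show ?thesis using den by (simp add: divide_le_eq power2_eq_square del: greaterThanAtMost_iff)
    next
      case False
      then have "y \<le> \<bar>t\<bar>" using y by auto
      then have "y^2 \<le> t^2" using y by (metis abs_of_pos abs_le_square_iff)
      then show ?thesis using False den by (simp add: divide_le_eq power2_eq_square del: greaterThanAtMost_iff)
    qed
  qed
  also have "\<dots> = 1/2 + 1/2 * measure (shifted e) {- y<..y}"
    by (subst Bochner_Integration.integral_add) (auto simp: S.prob_UNIV less_top[symmetric])
  finally have "(y + e) * - Im (G ?w) - 1 / y \<le> 1/2 + 1/2 * measure (shifted e) {- y<..y}"
    by (rule order_trans[OF 1])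
  moreover have "2 * a - 1 \<le> m" if "a \<le> 1/2 + 1/2 * m" for a m :: real
    using that by simp
  ultimately show ?thesis by blast
qed

text \<open>The measures \<open>shifted e\<close> are tight for small e, and 1 / (z - t) is a
  bounded continuous function of t, so a weak limit as e tends to 0 has Cauchy transform G.\<close>

theorem real_distribution_of_sublinear_pick:
  "\<exists>M. real_distribution M \<and> (\<forall>z. 0 < Im z \<longrightarrow> F_transform M z = z + N z)"
proof -
  define e where "e n = inverse (real (Suc n))" for n
  have e: "0 < e n" "e n \<le> 1" for n by (simp_all add: e_def field_simps)
  have elim: "e \<longlonglongrightarrow> 0" unfolding e_def[abs_def] by (rule LIMSEQ_inverse_real_of_nat)
  have "tight (\<lambda>n. shifted (e n))"
    unfolding tight_def
  proof (intro conjI allI impI real_distribution_shifted e)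
    fix \<eta> :: real assume \<eta>: "0 < \<eta>"
    have "\<forall>\<^sub>F y in at_top. 1 - \<eta>/4 < y * - Im (G (\<i> * complex_of_real y))"
      by (rule order_tendstoD(1)[OF G_asymptotics]) (use \<eta> in simp)
    then obtain Y where Y: "\<And>y. y \<ge> Y \<Longrightarrow> 1 - \<eta>/4 < y * - Im (G (\<i> * complex_of_real y))"
      unfolding eventually_at_top_linorder by blast
    \<comment> \<open>The interval then carries more than 2 (1 - \<eta>/4 - \<eta>/8) - 1 = 1 - 3
      \<eta>/4, which exceeds 1 - \<eta>.\<close>
    define y where "y = max (max Y 1) (8 / \<eta>)"
    have y: "0 < y" "Y \<le> y" "8 / \<eta> \<le> y" by (auto simp: y_def)
    have 1: "1 / y \<le> \<eta> / 8" using y \<eta> by (simp add: field_simps)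
    have 2: "1 - \<eta>/4 < (y + e n) * - Im (G (\<i> * complex_of_real (y + e n)))" for n
      by (rule Y) (use y(2) e(1)[of n] in linarith)
    have "measure (shifted (e n)) {- y<..y} > 1 - \<eta>" for n
      using shifted_interval_mass[OF e y(1), of n] \<eta> 1 2[of n] by argo
    then show "\<exists>a b. a < b \<and> (\<forall>n. 1 - \<eta> < measure (shifted (e n)) {a<..b})"
      using y(1) by (intro exI[of _ "- y"] exI[of _ y]) auto
  qed
  from tight_imp_convergent_subsubsequence[OF this strict_mono_id]
  obtain r M where r: "strict_mono (r :: nat \<Rightarrow> nat)" and M: "real_distribution M"
    and w: "weak_conv_m ((\<lambda>n. shifted (e n)) \<circ> id \<circ> r) M"
    by blast
  have "cauchy_transform M z = G z" if z: "0 < Im z" for z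
  proof (rule LIMSEQ_unique)
    have "(\<lambda>n. \<integral>t. 1 / (z - complex_of_real t) \<partial>(((\<lambda>n. shifted (e n)) \<circ> id \<circ> r) n)) \<longlonglongrightarrow> (\<integral>t. 1 / (z - complex_of_real t) \<partial>M)"
    proof (rule weak_conv_imp_integral_bdd_continuous_conv[OF _ M w])
      show "real_distribution (((\<lambda>n. shifted (e n)) \<circ> id \<circ> r) n)" for n
        using real_distribution_shifted e by simp
      show "isCont (\<lambda>t. 1 / (z - complex_of_real t)) t" for t
        using diff_real_nonzero[OF z] by (intro continuous_intros) auto
      show "norm (1 / (z - complex_of_real t)) \<le> 1 / Im z" for t
        by (rule norm_inverse_diff_real[OF z])
    qed
    then show "(\<lambda>n. G (z + \<i> * e (r n))) \<longlonglongrightarrow> cauchy_transform M z"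
      using cauchy_transform_shifted[OF e(1) z] unfolding cauchy_transform_def by simp
    have "(\<lambda>n. z + \<i> * e (r n)) \<longlonglongrightarrow> z + \<i> * complex_of_real 0"
      using LIMSEQ_subseq_LIMSEQ[OF elim r] by (intro tendsto_intros) (simp add: o_def)
    moreover have "isCont G z"
      using holomorphic_on_imp_continuous_on[OF G_holomorphic] z by (simp add: continuous_on_eq_continuous_at)
    ultimately show "(\<lambda>n. G (z + \<i> * e (r n))) \<longlonglongrightarrow> G z"
      by (intro isCont_tendsto_compose[of z G]) auto
  qed
  then show ?thesis using M by (intro exI[of _ M]) (simp add: F_transform_def G_def)
qed

end

section \<open>Free and Boolean convolution\<close>

text \<open>The quantitative form of the limit in \<open>voiculescu_transform_on\<close>. On a cone
  \<open>Im z\<close> and \<open>cmod z\<close> are comparable, so the bounds can be phrased in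
  \<open>Im z\<close> alone.\<close>

definition cone_small :: "(complex \<Rightarrow> complex) \<Rightarrow> bool" where
  "cone_small f \<longleftrightarrow> (\<forall>\<alpha>>0. \<forall>\<epsilon>>0. \<exists>B>0. \<forall>z. B < Im z \<and> \<bar>Re z\<bar> < \<alpha> * Im z \<longrightarrow> cmod (f z) \<le> \<epsilon> * Im z)"

lemma cone_smallD:
  assumes "cone_small f" "0 < \<alpha>" "0 < \<epsilon>"
  obtains B where "0 < B" "\<And>z. B < Im z \<Longrightarrow> \<bar>Re z\<bar> < \<alpha> * Im z \<Longrightarrow> cmod (f z) \<le> \<epsilon> * Im z"
  using assms(1)[unfolded cone_small_def, rule_format, OF assms(2,3)] by (elim exE conjE) (rule that, auto)

lemma sublinear_pick_cone_small: "sublinear_pick N \<Longrightarrow> cone_small N"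
  unfolding cone_small_def using sublinear_pick_cone by (meson less_imp_le)

lemma cone_small_scale:
  assumes "cone_small f" shows "cone_small (\<lambda>z. c * f z)"
  unfolding cone_small_def
proof (intro allI impI)
  fix \<alpha> \<epsilon> :: real assume *: "0 < \<alpha>" "0 < \<epsilon>"
  have pos: "0 < \<epsilon> / (cmod c + 1)" using *(2) by (simp add: add_nonneg_pos)
  obtain B where B: "0 < B" "\<And>z. B < Im z \<Longrightarrow> \<bar>Re z\<bar> < \<alpha> * Im z \<Longrightarrow> cmod (f z) \<le> \<epsilon> / (cmod c + 1) * Im z"
    by (rule cone_smallD[OF assms *(1) pos]) (rule that)
  have "cmod (c * f z) \<le> \<epsilon> * Im z" if z: "B < Im z" "\<bar>Re z\<bar> < \<alpha> * Im z" for z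
  proof -
    have "cmod (c * f z) \<le> (cmod c + 1) * (\<epsilon> / (cmod c + 1) * Im z)"
      unfolding norm_mult using B(2)[OF z] by (intro mult_mono) (auto intro: add_nonneg_nonneg)
    moreover have "cmod c + 1 \<noteq> 0" using norm_ge_zero[of c] by linarith
    ultimately show ?thesis by simp
  qed
  then show "\<exists>B>0. \<forall>z. B < Im z \<and> \<bar>Re z\<bar> < \<alpha> * Im z \<longrightarrow> cmod (c * f z) \<le> \<epsilon> * Im z"
    using B(1) by blast
qed

lemma cone_small_iff:
  "cone_small f \<longleftrightarrow>
    (\<forall>\<alpha>>0. ((\<lambda>z. (z + f z) / z) \<longlongrightarrow> 1) (inf at_infinity (principal {z. \<bar>Re z\<bar> < \<alpha> * Im z})))"
proof (intro iffI allI impI)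
  fix \<alpha> :: real assume f: "cone_small f" and \<alpha>: "0 < \<alpha>"
  show "((\<lambda>z. (z + f z) / z) \<longlongrightarrow> 1) (inf at_infinity (principal {z. \<bar>Re z\<bar> < \<alpha> * Im z}))"
  proof (rule tendstoI)
    fix e :: real assume e: "0 < e"
    have e2: "0 < e/2" using e by simp
    obtain B where B: "0 < B" "\<And>z. B < Im z \<Longrightarrow> \<bar>Re z\<bar> < \<alpha> * Im z \<Longrightarrow> cmod (f z) \<le> e/2 * Im z"
      by (rule cone_smallD[OF f \<alpha> e2]) (rule that)
    \<comment> \<open>On the cone \<open>cmod z\<close> is at most (\<alpha> + 1)
      \<open>Im z\<close>, so this threshold forces B < \<open>Im z\<close>.\<close>
    have "dist ((z + f z) / z) 1 < e" if z: "(\<alpha> + 1) * (B + 1) \<le> cmod z" "\<bar>Re z\<bar> < \<alpha> * Im z" for z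
    proof -
      have "0 < \<alpha> * Im z" using z(2) abs_ge_zero[of "Re z"] by linarith
      then have Im: "0 < Im z" using \<alpha> by (simp add: zero_less_mult_iff)
      then have z0: "z \<noteq> 0" by auto
      have "cmod z \<le> (\<alpha> + 1) * Im z" using cmod_le[of z] z(2) Im by (simp add: algebra_simps)
      with z(1) have "(\<alpha> + 1) * (B + 1) \<le> (\<alpha> + 1) * Im z" by (rule order_trans)
      then have "B < Im z" using \<alpha> by simp
      from B(2)[OF this z(2)] have "cmod (f z) \<le> e/2 * Im z" .
      also have "\<dots> \<le> e/2 * cmod z" using e Im_le_cmod by (intro mult_left_mono) auto
      also have "\<dots> < e * cmod z" using e z0 by simp
      finally have "cmod (f z) / cmod z < e" using z0 by (simp add: divide_less_eq)
      moreover have "(z + f z) / z - 1 = f z / z" using z0 by (simp add: add_divide_distrib)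
      ultimately show ?thesis by (simp add: dist_norm norm_divide)
    qed
    then show "\<forall>\<^sub>F z in inf at_infinity (principal {z. \<bar>Re z\<bar> < \<alpha> * Im z}). dist ((z + f z) / z) 1 < e"
      unfolding eventually_inf_principal eventually_at_infinity by auto
  qed
next
  assume lim: "\<forall>\<alpha>>0. ((\<lambda>z. (z + f z) / z) \<longlongrightarrow> 1) (inf at_infinity (principal {z. \<bar>Re z\<bar> < \<alpha> * Im z}))"
  show "cone_small f"
    unfolding cone_small_def
  proof (intro allI impI)
    fix \<alpha> \<epsilon> :: real assume \<alpha>: "0 < \<alpha>" and \<epsilon>: "0 < \<epsilon>"
    have "0 < \<epsilon> / (\<alpha> + 1)" using \<alpha> \<epsilon> by simp
    from tendstoD[OF lim[rule_format, OF \<alpha>] this]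
    have "\<forall>\<^sub>F z in inf at_infinity (principal {z. \<bar>Re z\<bar> < \<alpha> * Im z}). dist ((z + f z) / z) 1 < \<epsilon> / (\<alpha> + 1)" .
    then obtain b where b: "\<And>z. b \<le> cmod z \<Longrightarrow> \<bar>Re z\<bar> < \<alpha> * Im z \<Longrightarrow> dist ((z + f z) / z) 1 < \<epsilon> / (\<alpha> + 1)"
      unfolding eventually_inf_principal eventually_at_infinity by auto
    have "cmod (f z) \<le> \<epsilon> * Im z" if z: "max b 1 < Im z" "\<bar>Re z\<bar> < \<alpha> * Im z" for z
    proof -
      have z0: "z \<noteq> 0" using z by auto
      have "b \<le> cmod z" using z(1) Im_le_cmod[of z] by simp
      from b[OF this z(2)] have "cmod (f z / z) < \<epsilon> / (\<alpha> + 1)"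
        using z0 by (simp add: dist_norm add_divide_distrib)
      then have "cmod (f z) \<le> \<epsilon> / (\<alpha> + 1) * cmod z" using z0 by (simp add: norm_divide divide_less_eq)
      also have "\<dots> \<le> \<epsilon> / (\<alpha> + 1) * ((\<alpha> + 1) * Im z)"
        using cmod_le[of z] z \<alpha> \<epsilon> by (intro mult_left_mono) (auto simp: algebra_simps)
      finally show ?thesis using \<alpha> by simp
    qed
    then show "\<exists>B>0. \<forall>z. B < Im z \<and> \<bar>Re z\<bar> < \<alpha> * Im z \<longrightarrow> cmod (f z) \<le> \<epsilon> * Im z"
      by (intro exI[of _ "max b 1"]) auto
  qed
qed

lemma cone_domain_iff: "z \<in> cone_domain \<beta> \<longleftrightarrow> (\<exists>\<alpha>>0. \<beta> \<alpha> < Im z \<and> \<bar>Re z\<bar> < \<alpha> * Im z)"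
  by (auto simp: cone_domain_def)

lemma cone_domain_Im_pos:
  assumes "z \<in> cone_domain \<beta>" shows "0 < Im z"
proof -
  obtain \<alpha> where "0 < \<alpha>" "\<bar>Re z\<bar> < \<alpha> * Im z" using assms by (auto simp: cone_domain_iff)
  then have "0 < \<alpha> * Im z" using abs_ge_zero[of "Re z"] by linarith
  then show ?thesis using \<open>0 < \<alpha>\<close> by (simp add: zero_less_mult_iff)
qed

text \<open>A bound for each aperture separately is enough: choice collects the bounds into one
  function \<beta>.\<close>

lemma cone_domain_choose:
  assumes "\<And>\<alpha>. 0 < \<alpha> \<Longrightarrow> \<exists>B. \<forall>z. B < Im z \<and> \<bar>Re z\<bar> < \<alpha> * Im z \<longrightarrow> P z"
  shows "\<exists>\<beta>. \<forall>z\<in>cone_domain \<beta>. P z"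
proof -
  obtain \<beta> where "\<And>\<alpha>. 0 < \<alpha> \<Longrightarrow> \<forall>z. \<beta> \<alpha> < Im z \<and> \<bar>Re z\<bar> < \<alpha> * Im z \<longrightarrow> P z"
    using assms by metis
  then show ?thesis by (intro exI[of _ \<beta>]) (auto simp: cone_domain_iff)
qed

section \<open>Voiculescu transforms: uniqueness and existence\<close>

lemma voiculescu_transform_on_iff:
  "voiculescu_transform_on \<mu> \<beta> \<phi> \<longleftrightarrow>
     \<phi> holomorphic_on cone_domain \<beta> \<and>
     (\<forall>z\<in>cone_domain \<beta>. 0 < Im (z + \<phi> z) \<and> F_transform \<mu> (z + \<phi> z) = z) \<and> cone_small \<phi>"
  unfolding voiculescu_transform_on_def cone_small_iff by simp

text \<open>Two right inverses w and w' at z satisfy N w - N w' = w' - w, although far out both lie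
  where N contracts strictly. Agreement on a truncated cone of aperture 1 is an open condition
  strong enough for analytic continuation later.\<close>

lemma voiculescu_transform_unique:
  assumes "real_distribution \<mu>" "voiculescu_transform_on \<mu> \<beta> \<phi>" "voiculescu_transform_on \<mu> \<beta>' \<phi>'"
  shows "\<exists>B. \<forall>z. B < Im z \<and> \<bar>Re z\<bar> < Im z \<longrightarrow> \<phi> z = \<phi>' z"
proof -
  define N where "N = (\<lambda>z. F_transform \<mu> z - z)"
  have N: "sublinear_pick N"
    unfolding N_def by (rule real_distribution.sublinear_pick_F_transform[OF assms(1)])
  \<comment> \<open>With \<open>cmod (\<phi> z)\<close> at most \<open>Im z / 2\<close>, the point z
    + \<phi> z has height at least \<open>Im z / 2\<close> and real part below 3/2
    \<open>Im z\<close>, hence lies in the cone of aperture 3, inside that of aperture 4.\<close>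
  obtain B0 where B0: "0 < B0" "\<And>z. B0 < Im z \<Longrightarrow> \<bar>Re z\<bar> < 4 * Im z \<Longrightarrow> cmod (N z) \<le> 1/2 * Im z"
    by (rule cone_smallD[OF sublinear_pick_cone_small[OF N], of 4 "1/2"]) auto
  have key: "\<exists>B. \<forall>z. B < Im z \<and> \<bar>Re z\<bar> < Im z \<longrightarrow>
      0 < Im (z + \<phi> z) \<and> F_transform \<mu> (z + \<phi> z) = z \<and> Im (N (z + \<phi> z)) < Im (z + \<phi> z)"
    if V: "voiculescu_transform_on \<mu> \<beta> \<phi>" for \<beta> \<phi>
  proof -
    obtain B1 where B1: "0 < B1" "\<And>z. B1 < Im z \<Longrightarrow> \<bar>Re z\<bar> < 1 * Im z \<Longrightarrow> cmod (\<phi> z) \<le> 1/2 * Im z"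
      by (rule cone_smallD[of \<phi> 1 "1/2"]) (use V in \<open>auto simp: voiculescu_transform_on_iff\<close>)
    have "0 < Im (z + \<phi> z) \<and> F_transform \<mu> (z + \<phi> z) = z \<and> Im (N (z + \<phi> z)) < Im (z + \<phi> z)"
      if z: "max (\<beta> 1) (max B1 (2 * B0)) < Im z" "\<bar>Re z\<bar> < Im z" for z
    proof -
      have "z \<in> cone_domain \<beta>" unfolding cone_domain_iff using z by (intro exI[of _ 1]) auto
      then have 1: "0 < Im (z + \<phi> z)" "F_transform \<mu> (z + \<phi> z) = z"
        using V by (auto simp: voiculescu_transform_on_iff)
      have 2: "cmod (\<phi> z) \<le> 1/2 * Im z" using B1(2)[of z] z by simp
      then have 3: "Im z / 2 \<le> Im (z + \<phi> z)" "\<bar>Re (z + \<phi> z)\<bar> < Im z + Im z / 2"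
        using abs_Im_le_cmod[of "\<phi> z"] abs_Re_le_cmod[of "\<phi> z"] z(2) unfolding plus_complex.sel by linarith+
      then have "cmod (N (z + \<phi> z)) \<le> 1/2 * Im (z + \<phi> z)"
        using z(1) by (intro B0(2)) linarith+
      then show ?thesis using 1 Im_le_cmod[of "N (z + \<phi> z)"] by linarith
    qed
    then show ?thesis by blast
  qed
  obtain B where B: "\<And>z. B < Im z \<Longrightarrow> \<bar>Re z\<bar> < Im z \<Longrightarrow>
      0 < Im (z + \<phi> z) \<and> F_transform \<mu> (z + \<phi> z) = z \<and> Im (N (z + \<phi> z)) < Im (z + \<phi> z)"
    using key[OF assms(2)] by blast
  obtain B' where B': "\<And>z. B' < Im z \<Longrightarrow> \<bar>Re z\<bar> < Im z \<Longrightarrow>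
      0 < Im (z + \<phi>' z) \<and> F_transform \<mu> (z + \<phi>' z) = z \<and> Im (N (z + \<phi>' z)) < Im (z + \<phi>' z)"
    using key[OF assms(3)] by blast
  have "\<phi> z = \<phi>' z" if z: "max B B' < Im z" "\<bar>Re z\<bar> < Im z" for z
  proof (rule ccontr)
    let ?w = "z + \<phi> z" and ?w' = "z + \<phi>' z"
    assume ne: "\<phi> z \<noteq> \<phi>' z"
    have w: "0 < Im ?w \<and> F_transform \<mu> ?w = z \<and> Im (N ?w) < Im ?w" using B[of z] z by simp
    have w': "0 < Im ?w' \<and> F_transform \<mu> ?w' = z \<and> Im (N ?w') < Im ?w'" using B'[of z] z by simp
    have "cmod (N ?w - N ?w') < cmod (?w - ?w')"
      using w w' ne by (intro pick_strict_contraction[OF sublinear_pick_imp_pick[OF N]]) auto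
    moreover have "N ?w - N ?w' = ?w' - ?w" using w w' by (simp add: N_def)
    ultimately show False by (simp add: norm_minus_commute)
  qed
  then show ?thesis by blast
qed

text \<open>The map z + \<phi> z is injective, so it sends a truncated cone to an open set on which
  both F transforms are its inverse. The identity theorem extends their equality to the
  half-plane.\<close>

lemma real_distribution_eq_of_voiculescu:
  assumes "real_distribution \<rho>" "real_distribution \<rho>'"
    and V: "voiculescu_transform_on \<rho> \<beta> \<phi>" and V': "voiculescu_transform_on \<rho>' \<beta>' \<phi>'"
    and eq: "\<And>z. B < Im z \<Longrightarrow> \<bar>Re z\<bar> < Im z \<Longrightarrow> \<phi> z = \<phi>' z"
  shows "\<rho> = \<rho>'"
proof (rule real_distribution_eqI[OF assms(1,2)])
  define M where "M = max B (max (\<beta> 1) (\<beta>' 1))"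
  define T where "T = {z. M < Im z \<and> \<bar>Re z\<bar> < Im z}"
  define \<psi> where "\<psi> = (\<lambda>z. z + \<phi> z)"
  have T: "z \<in> cone_domain \<beta>" "z \<in> cone_domain \<beta>'" "\<phi> z = \<phi>' z" if "z \<in> T" for z
    using that eq[of z] unfolding T_def M_def cone_domain_iff by (auto intro!: exI[of _ 1])
  have "open T" unfolding T_def by (intro open_Collect_conj open_Collect_less continuous_intros)
  have F: "F_transform \<rho> (\<psi> z) = z" "F_transform \<rho>' (\<psi> z) = z" "0 < Im (\<psi> z)" if "z \<in> T" for z
    using V V' T[OF that] unfolding voiculescu_transform_on_iff \<psi>_def by auto
  have hol: "\<psi> holomorphic_on T"
    using V T(1) unfolding \<psi>_def voiculescu_transform_on_iff
    by (intro holomorphic_intros) (auto intro: holomorphic_on_subset)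
  have "inj_on \<psi> T" by (rule inj_on_inverseI) (rule F(1))
  then have op: "open (\<psi> ` T)" by (rule open_mapping_thm3[OF hol \<open>open T\<close>])
  have "\<i> * complex_of_real (\<bar>M\<bar> + 1) \<in> T" unfolding T_def by auto
  then have ne: "\<psi> ` T \<noteq> {}" by blast
  fix z assume z: "0 < Im z"
  show "F_transform \<rho> z = F_transform \<rho>' z"
    by (rule analytic_continuation_open[OF op open_upper_half_plane ne connected_upper_half_plane _
        real_distribution.F_transform_holomorphic[OF assms(1)]
        real_distribution.F_transform_holomorphic[OF assms(2)]]) (use z in \<open>auto simp: F\<close>)
qed

text \<open>This discharges the definite description. A competitor comes with its own domains and
  transforms, but these agree with the given ones on a truncated cone of aperture 1, which
  determines the measure.\<close>

lemma free_conv_eqI: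
  assumes \<mu>: "real_distribution \<mu>" and \<nu>: "real_distribution \<nu>" and \<rho>: "real_distribution \<rho>"
    and V: "voiculescu_transform_on \<mu> \<beta>1 \<phi>1" "voiculescu_transform_on \<nu> \<beta>2 \<phi>2"
      "voiculescu_transform_on \<rho> \<beta>3 \<phi>3"
    and sum: "\<And>z. z \<in> cone_domain \<beta>1 \<Longrightarrow> z \<in> cone_domain \<beta>2 \<Longrightarrow> z \<in> cone_domain \<beta>3 \<Longrightarrow> \<phi>3 z = \<phi>1 z + \<phi>2 z"
  shows "\<mu> \<boxplus> \<nu> = \<rho>"
  unfolding free_conv_def
proof (rule the_equality)
  show "real_distribution \<rho> \<and>
     (\<exists>\<beta>\<^sub>1 \<beta>\<^sub>2 \<beta>\<^sub>3 \<phi>\<^sub>1 \<phi>\<^sub>2 \<phi>\<^sub>3.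
        voiculescu_transform_on \<mu> \<beta>\<^sub>1 \<phi>\<^sub>1 \<and> voiculescu_transform_on \<nu> \<beta>\<^sub>2 \<phi>\<^sub>2 \<and>
        voiculescu_transform_on \<rho> \<beta>\<^sub>3 \<phi>\<^sub>3 \<and>
        (\<forall>z \<in> cone_domain \<beta>\<^sub>1 \<inter> cone_domain \<beta>\<^sub>2 \<inter> cone_domain \<beta>\<^sub>3. \<phi>\<^sub>3 z = \<phi>\<^sub>1 z + \<phi>\<^sub>2 z))"
    using \<rho> V sum
    by (intro conjI exI[of _ \<beta>1] exI[of _ \<beta>2] exI[of _ \<beta>3] exI[of _ \<phi>1] exI[of _ \<phi>2] exI[of _ \<phi>3]) auto
  fix \<rho>'
  assume "real_distribution \<rho>' \<and>
     (\<exists>\<beta>\<^sub>1 \<beta>\<^sub>2 \<beta>\<^sub>3 \<phi>\<^sub>1 \<phi>\<^sub>2 \<phi>\<^sub>3.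
        voiculescu_transform_on \<mu> \<beta>\<^sub>1 \<phi>\<^sub>1 \<and> voiculescu_transform_on \<nu> \<beta>\<^sub>2 \<phi>\<^sub>2 \<and>
        voiculescu_transform_on \<rho>' \<beta>\<^sub>3 \<phi>\<^sub>3 \<and>
        (\<forall>z \<in> cone_domain \<beta>\<^sub>1 \<inter> cone_domain \<beta>\<^sub>2 \<inter> cone_domain \<beta>\<^sub>3. \<phi>\<^sub>3 z = \<phi>\<^sub>1 z + \<phi>\<^sub>2 z))"
  then obtain \<gamma>1 \<gamma>2 \<gamma>3 \<psi>1 \<psi>2 \<psi>3 where \<rho>': "real_distribution \<rho>'"
    and V': "voiculescu_transform_on \<mu> \<gamma>1 \<psi>1" "voiculescu_transform_on \<nu> \<gamma>2 \<psi>2" "voiculescu_transform_on \<rho>' \<gamma>3 \<psi>3"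
    and sum': "\<And>z. z \<in> cone_domain \<gamma>1 \<Longrightarrow> z \<in> cone_domain \<gamma>2 \<Longrightarrow> z \<in> cone_domain \<gamma>3 \<Longrightarrow> \<psi>3 z = \<psi>1 z + \<psi>2 z"
    by auto
  obtain B1 where B1: "\<And>z. B1 < Im z \<Longrightarrow> \<bar>Re z\<bar> < Im z \<Longrightarrow> \<phi>1 z = \<psi>1 z"
    using voiculescu_transform_unique[OF \<mu> V(1) V'(1)] by blast
  obtain B2 where B2: "\<And>z. B2 < Im z \<Longrightarrow> \<bar>Re z\<bar> < Im z \<Longrightarrow> \<phi>2 z = \<psi>2 z"
    using voiculescu_transform_unique[OF \<nu> V(2) V'(2)] by blast
  define B where "B = max (max (max B1 B2) (max (\<beta>1 1) (\<beta>2 1))) (max (max (\<beta>3 1) (\<gamma>1 1)) (max (\<gamma>2 1) (\<gamma>3 1)))"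
  show "\<rho>' = \<rho>"
  proof (rule real_distribution_eq_of_voiculescu[OF \<rho>' \<rho> V'(3) V(3)])
    fix z assume z: "B < Im z" "\<bar>Re z\<bar> < Im z"
    have cone: "z \<in> cone_domain \<beta>" if "\<beta> 1 < Im z" for \<beta>
      unfolding cone_domain_iff using that z(2) by (intro exI[of _ 1]) auto
    have b: "B1 < Im z" "B2 < Im z" "\<beta>1 1 < Im z" "\<beta>2 1 < Im z" "\<beta>3 1 < Im z"
      "\<gamma>1 1 < Im z" "\<gamma>2 1 < Im z" "\<gamma>3 1 < Im z"
      using z(1) unfolding B_def by simp_all
    have "\<phi>3 z = \<phi>1 z + \<phi>2 z" by (rule sum) (rule cone, rule b)+
    moreover have "\<psi>3 z = \<psi>1 z + \<psi>2 z" by (rule sum') (rule cone, rule b)+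
    moreover have "\<phi>1 z = \<psi>1 z" "\<phi>2 z = \<psi>2 z" by (rule B1[OF b(1) z(2)], rule B2[OF b(2) z(2)])
    ultimately show "\<psi>3 z = \<phi>3 z" by simp
  qed
qed

text \<open>On the ball of radius \<open>\<epsilon> Im z\<close> around \<open>z\<close> the map \<open>w \<mapsto> z - N w\<close> has a fixed point by Brouwer's
  theorem; the Schwarz-Pick inequality makes it unique.\<close>

lemma voiculescu_transform_exists:
  assumes "real_distribution \<mu>"
  shows "\<exists>\<beta> \<phi>. voiculescu_transform_on \<mu> \<beta> \<phi>"
proof -
  define N where "N = (\<lambda>z. F_transform \<mu> z - z)"
  have N: "sublinear_pick N"
    unfolding N_def by (rule real_distribution.sublinear_pick_F_transform[OF assms])
  note pN = sublinear_pick_imp_pick[OF N]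
  have F: "F_transform \<mu> w = w + N w" for w by (simp add: N_def)
  \<comment> \<open>On U the ratio is below 1, so F w = F w' with w different from w' would
    contradict strict contraction.\<close>
  define U where "U = {w \<in> upper_half_plane. Im (N w) < Im w}"
  have "continuous_on upper_half_plane (\<lambda>w. Im w - Im (N w))"
    by (intro continuous_intros pick_continuous_on pN)
  from continuous_open_preimage[OF this _ open_greaterThan[of 0]]
  have "open (upper_half_plane \<inter> (\<lambda>w. Im w - Im (N w)) -` {0<..})" by simp
  moreover have "upper_half_plane \<inter> (\<lambda>w. Im w - Im (N w)) -` {0<..} = U" by (auto simp: U_def)
  ultimately have opU: "open U" by simp
  have inj: "inj_on (F_transform \<mu>) U"
  proof (rule inj_onI, rule ccontr)
    fix w w' assume w: "w \<in> U" "w' \<in> U" "F_transform \<mu> w = F_transform \<mu> w'" "w \<noteq> w'"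
    have "cmod (N w - N w') < cmod (w - w')"
      using w by (intro pick_strict_contraction[OF pN]) (auto simp: U_def)
    moreover have "N w - N w' = w' - w" using w(3) by (simp add: N_def)
    ultimately show False by (simp add: norm_minus_commute)
  qed
  have holF: "F_transform \<mu> holomorphic_on U"
    by (rule holomorphic_on_subset[OF real_distribution.F_transform_holomorphic[OF assms]]) (auto simp: U_def)
  obtain g where g: "g holomorphic_on (F_transform \<mu> ` U)" "\<And>w. w \<in> U \<Longrightarrow> g (F_transform \<mu> w) = w"
    by (rule holomorphic_has_inverse[OF holF opU inj]) simp
  have surj: "\<exists>B>0. \<forall>z. B < Im z \<and> \<bar>Re z\<bar> < \<alpha> * Im z \<longrightarrow>
      z \<in> F_transform \<mu> ` U \<and> cmod (g z - z) \<le> \<epsilon> * Im z" if \<alpha>: "0 < \<alpha>" and \<epsilon>: "0 < \<epsilon>" "\<epsilon> \<le> 1/2" for \<alpha> \<epsilon>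
  proof -
    \<comment> \<open>Points w of the ball satisfy
      \<open>\<bar>Re w\<bar> < (\<alpha> + 1) * Im z\<close> and
      \<open>Im z \<le> 2 * Im w\<close>. This explains the aperture, and why z is taken above 2
      B.\<close>
    obtain B where B: "0 < B" "\<And>w. B < Im w \<Longrightarrow> \<bar>Re w\<bar> < (2 * \<alpha> + 2) * Im w \<Longrightarrow> cmod (N w) \<le> \<epsilon>/2 * Im w"
      by (rule cone_smallD[OF sublinear_pick_cone_small[OF N], of "2 * \<alpha> + 2" "\<epsilon>/2"]) (use \<alpha> \<epsilon> in auto)
    have "z \<in> F_transform \<mu> ` U \<and> cmod (g z - z) \<le> \<epsilon> * Im z"
      if z: "2 * B < Im z" "\<bar>Re z\<bar> < \<alpha> * Im z" for z
    proof -
      have z0: "0 < Im z" using z(1) B(1) by simp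
      define r where "r = \<epsilon> * Im z"
      have r: "0 < r" "r \<le> Im z / 2" using \<epsilon> z0 by (auto simp: r_def)
      have ball: "Im z / 2 \<le> Im w \<and> Im w \<le> 3/2 * Im z \<and> cmod (N w) \<le> \<epsilon>/2 * Im w" if w: "w \<in> cball z r" for w
      proof -
        have d: "cmod (w - z) \<le> r" using w by (simp add: dist_norm norm_minus_commute)
        have 1: "Im z / 2 \<le> Im w" "Im w \<le> 3/2 * Im z"
          using d r abs_Im_le_cmod[of "w - z"] by auto
        have "\<bar>Re w\<bar> < \<alpha> * Im z + Im z"
          using d r abs_Re_le_cmod[of "w - z"] z(2) z0 by auto
        also have "\<alpha> * Im z + Im z \<le> (2 * \<alpha> + 2) * Im w"
          using mult_left_mono[OF 1(1), of "2 * \<alpha> + 2"] \<alpha> by (simp add: algebra_simps)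
        finally show ?thesis using 1 B(2)[of w] z(1) by auto
      qed
      have "continuous_on (cball z r) (\<lambda>w. z - N w)"
        using ball z0 by (intro continuous_intros continuous_on_subset[OF pick_continuous_on[OF pN]]) force
      moreover have "(\<lambda>w. z - N w) \<in> cball z r \<rightarrow> cball z r"
      proof
        fix w assume w: "w \<in> cball z r"
        have "cmod (N w) \<le> \<epsilon>/2 * Im w" using ball[OF w] by blast
        also have "\<dots> \<le> \<epsilon>/2 * (2 * Im z)" using ball[OF w] \<epsilon> z0 by (intro mult_left_mono) auto
        finally show "z - N w \<in> cball z r" by (simp add: dist_norm r_def)
      qed
      ultimately obtain w where w: "w \<in> cball z r" "z - N w = w"
        using r by (elim brouwer[rotated 3]) auto
      have Fw: "F_transform \<mu> w = z" unfolding F using w(2) by (metis diff_add_cancel)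
      have Imw: "0 < Im w" using ball[OF w(1)] z0 by simp
      have "Im (N w) \<le> \<epsilon>/2 * Im w" using ball[OF w(1)] Im_le_cmod[of "N w"] by linarith
      also have "\<dots> < 1 * Im w" using Imw \<epsilon> by (intro mult_strict_right_mono) auto
      finally have wU: "w \<in> U" using Imw by (simp add: U_def)
      have "g z = w" using g(2)[OF wU] Fw by simp
      moreover have "z \<in> F_transform \<mu> ` U" using wU Fw by blast
      ultimately show ?thesis using w(1) by (auto simp: dist_norm norm_minus_commute r_def)
    qed
    then show ?thesis using B(1) by (intro exI[of _ "2 * B"]) auto
  qed
  have "\<exists>B. \<forall>z. B < Im z \<and> \<bar>Re z\<bar> < \<alpha> * Im z \<longrightarrow> z \<in> F_transform \<mu> ` U" if "0 < \<alpha>" for \<alpha>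
    using surj[OF that, of "1/2"] by auto
  from cone_domain_choose[OF this]
  obtain \<beta> where \<beta>: "\<And>z. z \<in> cone_domain \<beta> \<Longrightarrow> z \<in> F_transform \<mu> ` U" by blast
  have "voiculescu_transform_on \<mu> \<beta> (\<lambda>z. g z - z)"
    unfolding voiculescu_transform_on_iff
  proof (intro conjI ballI)
    show "(\<lambda>z. g z - z) holomorphic_on cone_domain \<beta>"
      using \<beta> by (intro holomorphic_intros holomorphic_on_subset[OF g(1)]) auto
    show "0 < Im (z + (g z - z))" "F_transform \<mu> (z + (g z - z)) = z" if "z \<in> cone_domain \<beta>" for z
    proof -
      obtain w where w: "w \<in> U" "z = F_transform \<mu> w" using \<beta> \<open>z \<in> cone_domain \<beta>\<close> by blast
      then have "g z = w" using g(2) by simp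
      then show "0 < Im (z + (g z - z))" "F_transform \<mu> (z + (g z - z)) = z"
        using w by (auto simp: U_def)
    qed
    show "cone_small (\<lambda>z. g z - z)"
      unfolding cone_small_def
    proof (intro allI impI)
      fix \<alpha> \<epsilon> :: real assume *: "0 < \<alpha>" "0 < \<epsilon>"
      obtain B where B: "B > 0" "\<And>z. B < Im z \<Longrightarrow> \<bar>Re z\<bar> < \<alpha> * Im z \<Longrightarrow> cmod (g z - z) \<le> min \<epsilon> (1/2) * Im z"
      proof -
        have "0 < min \<epsilon> (1/2)" "min \<epsilon> (1/2) \<le> 1/2" using *(2) by auto
        from surj[OF *(1) this] show ?thesis using that by blast
      qed
      have "cmod (g z - z) \<le> \<epsilon> * Im z" if z: "B < Im z" "\<bar>Re z\<bar> < \<alpha> * Im z" for z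
      proof -
        have "min \<epsilon> (1/2) * Im z \<le> \<epsilon> * Im z" using z B(1) by (intro mult_right_mono) auto
        then show ?thesis using B(2)[OF z] by linarith
      qed
      then show "\<exists>B>0. \<forall>z. B < Im z \<and> \<bar>Re z\<bar> < \<alpha> * Im z \<longrightarrow> cmod (g z - z) \<le> \<epsilon> * Im z"
        using B(1) by blast
    qed
  qed
  then show ?thesis by blast
qed

section \<open>Boolean convolution, and convolution powers through subordination\<close>

lemma boolean_conv_F_transform:
  assumes \<mu>: "real_distribution \<mu>" and \<nu>: "real_distribution \<nu>"
  shows "real_distribution (\<mu> \<uplus> \<nu>)"
    and "0 < Im z \<Longrightarrow> F_transform (\<mu> \<uplus> \<nu>) z = F_transform \<mu> z + F_transform \<nu> z - z"
proof -
  have "sublinear_pick (\<lambda>z. (F_transform \<mu> z - z) + (F_transform \<nu> z - z))"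
    by (intro sublinear_pick_add real_distribution.sublinear_pick_F_transform \<mu> \<nu>)
  from real_distribution_of_sublinear_pick[OF this]
  obtain \<rho> where \<rho>: "real_distribution \<rho>"
    "\<And>z. 0 < Im z \<Longrightarrow> F_transform \<rho> z = F_transform \<mu> z + F_transform \<nu> z - z" by force
  have "\<mu> \<uplus> \<nu> = \<rho>"
    unfolding boolean_conv_def
    by (rule the_equality) (use \<rho> in \<open>auto intro: real_distribution_eqI\<close>)
  then show "real_distribution (\<mu> \<uplus> \<nu>)"
    "0 < Im z \<Longrightarrow> F_transform (\<mu> \<uplus> \<nu>) z = F_transform \<mu> z + F_transform \<nu> z - z"
    using \<rho> by auto
qed

lemma voiculescu_transform_of_subordination:
  assumes N: "sublinear_pick N" and \<omega>: "subordination N \<omega>"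
    and F: "\<And>z. 0 < Im z \<Longrightarrow> F_transform \<rho> z = \<omega> z"
  shows "\<exists>\<beta>. voiculescu_transform_on \<rho> \<beta> (\<lambda>z. - N z)"
proof -
  note pN = sublinear_pick_imp_pick[OF N]
  \<comment> \<open>The identity \<omega> (z - N z) = z requires z - N z to lie in the half-plane,
    which smallness of N in cones ensures far out.\<close>
  have "\<exists>B. \<forall>z. B < Im z \<and> \<bar>Re z\<bar> < \<alpha> * Im z \<longrightarrow> 0 < Im (z - N z)" if \<alpha>: "0 < \<alpha>" for \<alpha>
  proof -
    obtain B where B: "0 < B" "\<And>z. B < Im z \<Longrightarrow> \<bar>Re z\<bar> < \<alpha> * Im z \<Longrightarrow> cmod (N z) \<le> 1/2 * Im z"
      by (rule cone_smallD[OF sublinear_pick_cone_small[OF N] \<alpha>, of "1/2"]) auto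
    have "0 < Im (z - N z)" if z: "B < Im z" "\<bar>Re z\<bar> < \<alpha> * Im z" for z
      using B(1) B(2)[OF z] z(1) Im_le_cmod[of "N z"] unfolding minus_complex.sel by linarith
    then show ?thesis by blast
  qed
  from cone_domain_choose[OF this]
  obtain \<beta> where \<beta>: "\<And>z. z \<in> cone_domain \<beta> \<Longrightarrow> 0 < Im (z - N z)" by blast
  have "voiculescu_transform_on \<rho> \<beta> (\<lambda>z. - N z)"
    unfolding voiculescu_transform_on_iff
  proof (intro conjI ballI)
    show "(\<lambda>z. - N z) holomorphic_on cone_domain \<beta>"
      using cone_domain_Im_pos by (intro holomorphic_intros holomorphic_on_subset[OF pick_holomorphic[OF pN]]) auto
    show "0 < Im (z + - N z)" if "z \<in> cone_domain \<beta>" for z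
      using \<beta>[OF that] by simp
    show "F_transform \<rho> (z + - N z) = z" if "z \<in> cone_domain \<beta>" for z
      using F \<beta>[OF that] subordination_left_inverse[OF pN \<omega> cone_domain_Im_pos[OF that]] by simp
    show "cone_small (\<lambda>z. - N z)"
      using cone_small_scale[OF sublinear_pick_cone_small[OF N], of "-1"] by simp
  qed
  then show ?thesis by blast
qed

text \<open>\<open>\<rho>\<close> is the free convolution power of \<open>\<nu>\<close> of exponent \<open>c + 1\<close>, obtained by subordination.\<close>

lemma voiculescu_transform_of_power:
  assumes \<nu>: "real_distribution \<nu>" and c: "0 \<le> c"
    and \<omega>: "subordination (\<lambda>z. complex_of_real c * (F_transform \<nu> z - z)) \<omega>"
    and F: "\<And>z. 0 < Im z \<Longrightarrow> F_transform \<rho> z = F_transform \<nu> (\<omega> z)"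
    and V: "voiculescu_transform_on \<nu> \<beta> \<phi>"
  shows "\<exists>\<beta>'. voiculescu_transform_on \<rho> \<beta>' (\<lambda>z. complex_of_real (c + 1) * \<phi> z)"
proof -
  let ?N = "\<lambda>z. complex_of_real c * (F_transform \<nu> z - z)"
  let ?\<phi> = "\<lambda>z. complex_of_real (c + 1) * \<phi> z"
  have pN: "pick ?N"
    by (rule sublinear_pick_imp_pick[OF sublinear_pick_scale[OF real_distribution.sublinear_pick_F_transform[OF \<nu>] c]])
  have small: "cone_small ?\<phi>"
    using V by (intro cone_small_scale) (simp add: voiculescu_transform_on_iff)
  have "\<exists>B. \<forall>z. B < Im z \<and> \<bar>Re z\<bar> < \<alpha> * Im z \<longrightarrow> z \<in> cone_domain \<beta> \<and> 0 < Im (z + ?\<phi> z)" if \<alpha>: "0 < \<alpha>" for \<alpha>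
  proof -
    obtain B where B: "0 < B" "\<And>z. B < Im z \<Longrightarrow> \<bar>Re z\<bar> < \<alpha> * Im z \<Longrightarrow> cmod (?\<phi> z) \<le> 1/2 * Im z"
      by (rule cone_smallD[OF small \<alpha>, of "1/2"]) auto
    have "z \<in> cone_domain \<beta> \<and> 0 < Im (z + ?\<phi> z)" if z: "max B (\<beta> \<alpha>) < Im z" "\<bar>Re z\<bar> < \<alpha> * Im z" for z
    proof
      show "z \<in> cone_domain \<beta>" unfolding cone_domain_iff using z \<alpha> by auto
      have "cmod (?\<phi> z) \<le> 1/2 * Im z" using B(2)[OF _ z(2)] z(1) by simp
      then show "0 < Im (z + ?\<phi> z)"
        using B(1) z(1) abs_Im_le_cmod[of "?\<phi> z"] unfolding plus_complex.sel by linarith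
    qed
    then show ?thesis by blast
  qed
  from cone_domain_choose[OF this]
  obtain \<beta>' where \<beta>': "\<And>z. z \<in> cone_domain \<beta>' \<Longrightarrow> z \<in> cone_domain \<beta> \<and> 0 < Im (z + ?\<phi> z)" by blast
  have "voiculescu_transform_on \<rho> \<beta>' ?\<phi>"
    unfolding voiculescu_transform_on_iff
  proof (intro conjI ballI small)
    show "?\<phi> holomorphic_on cone_domain \<beta>'"
      using V \<beta>' unfolding voiculescu_transform_on_iff
      by (intro holomorphic_intros) (auto intro: holomorphic_on_subset)
    fix z assume z: "z \<in> cone_domain \<beta>'"
    show pos: "0 < Im (z + ?\<phi> z)" using \<beta>'[OF z] by simp
    have w: "0 < Im (z + \<phi> z)" "F_transform \<nu> (z + \<phi> z) = z"
      using V \<beta>'[OF z] by (auto simp: voiculescu_transform_on_iff)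
    \<comment> \<open>At z + \<phi> z the F transform of \<nu> equals z, so \<open>?N\<close> is - c
      \<phi> z there. This is the source of the exponent c + 1.\<close>
    have eq: "z + \<phi> z - ?N (z + \<phi> z) = z + ?\<phi> z" by (simp add: w(2) algebra_simps)
    have "\<omega> (z + \<phi> z - ?N (z + \<phi> z)) = z + \<phi> z"
      by (rule subordination_left_inverse[OF pN \<omega> w(1)]) (unfold eq, rule pos)
    then have "\<omega> (z + ?\<phi> z) = z + \<phi> z" unfolding eq .
    then show "F_transform \<rho> (z + ?\<phi> z) = z" using F[OF pos] w(2) by simp
  qed
  then show ?thesis by blast
qed

text \<open>With k convolutions there are k + 1 factors, so the exponent c + 1 of the preceding
  lemma is reached with c = k. The induction builds the next power from its subordination function
  and identifies it by its Voiculescu transform.\<close>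

lemma free_conv_power:
  assumes \<nu>: "real_distribution \<nu>"
  shows "real_distribution (((\<boxplus>) \<nu> ^^ k) \<nu>) \<and>
    (\<exists>\<omega>. subordination (\<lambda>z. complex_of_real (real k) * (F_transform \<nu> z - z)) \<omega> \<and>
      (\<forall>z. 0 < Im z \<longrightarrow> F_transform (((\<boxplus>) \<nu> ^^ k) \<nu>) z = F_transform \<nu> (\<omega> z)))"
proof (induction k)
  case 0
  have "subordination (\<lambda>z. complex_of_real (real 0) * (F_transform \<nu> z - z)) (\<lambda>z. z)"
    by (simp add: subordination_def)
  then show ?case using \<nu> by auto
next
  case (Suc k)
  define \<rho> where "\<rho> = ((\<boxplus>) \<nu> ^^ k) \<nu>"
  obtain \<omega> where \<rho>: "real_distribution \<rho>"
    and \<omega>: "subordination (\<lambda>z. complex_of_real (real k) * (F_transform \<nu> z - z)) \<omega>"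
    "\<And>z. 0 < Im z \<Longrightarrow> F_transform \<rho> z = F_transform \<nu> (\<omega> z)"
    using Suc.IH unfolding \<rho>_def by blast
  let ?N = "\<lambda>z. complex_of_real (real (Suc k)) * (F_transform \<nu> z - z)"
  have N: "sublinear_pick ?N"
    by (intro sublinear_pick_scale real_distribution.sublinear_pick_F_transform \<nu>) simp
  obtain \<omega>' where \<omega>': "subordination ?N \<omega>'" using subordination_exists[OF N] by blast
  \<comment> \<open>From k + 1 times (F - id) at \<omega>' being \<omega>' - z, one gets that F of
    \<nu> at \<omega>' z is z + (1 + 1 / (k + 1)) (\<omega>' z - z). In this form it is visibly the
    F transform of a probability measure.\<close>
  let ?M = "\<lambda>z. complex_of_real (1 + 1 / real (Suc k)) * (\<omega>' z - z)"
  have "sublinear_pick ?M"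
    by (intro sublinear_pick_scale sublinear_pick_subordination[OF N \<omega>']) simp
  from real_distribution_of_sublinear_pick[OF this]
  obtain \<rho>' where \<rho>': "real_distribution \<rho>'" "\<And>z. 0 < Im z \<Longrightarrow> F_transform \<rho>' z = z + ?M z" by blast
  have F': "F_transform \<rho>' z = F_transform \<nu> (\<omega>' z)" if z: "0 < Im z" for z
  proof -
    have "complex_of_real (1 / real (Suc k)) * ?N (\<omega>' z) = F_transform \<nu> (\<omega>' z) - \<omega>' z"
      by (simp del: of_nat_Suc)
    then have "F_transform \<nu> (\<omega>' z) - \<omega>' z = complex_of_real (1 / real (Suc k)) * (\<omega>' z - z)"
      unfolding subordination_eq[OF \<omega>' z] by (rule sym)
    then show ?thesis unfolding \<rho>'(2)[OF z] by (simp add: algebra_simps del: of_nat_Suc)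
  qed
  obtain \<beta> \<phi> where V: "voiculescu_transform_on \<nu> \<beta> \<phi>" using voiculescu_transform_exists[OF \<nu>] by blast
  obtain \<beta>2 where V2: "voiculescu_transform_on \<rho> \<beta>2 (\<lambda>z. complex_of_real (real k + 1) * \<phi> z)"
    using voiculescu_transform_of_power[OF \<nu> _ \<omega> V] by auto
  obtain \<beta>3 where V3: "voiculescu_transform_on \<rho>' \<beta>3 (\<lambda>z. complex_of_real (real (Suc k) + 1) * \<phi> z)"
    using voiculescu_transform_of_power[OF \<nu> _ \<omega>' F' V] by auto
  have "\<nu> \<boxplus> \<rho> = \<rho>'"
    by (rule free_conv_eqI[OF \<nu> \<rho> \<rho>'(1) V V2 V3]) (simp add: algebra_simps)
  then have eq: "((\<boxplus>) \<nu> ^^ Suc k) \<nu> = \<rho>'" by (simp add: \<rho>_def)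
  show ?case unfolding eq using \<rho>'(1) \<omega>' F' by blast
qed

lemma boolean_conv_power:
  assumes \<nu>: "real_distribution \<nu>"
  shows "real_distribution (((\<uplus>) \<nu> ^^ k) \<nu>) \<and>
    (\<forall>z. 0 < Im z \<longrightarrow> F_transform (((\<uplus>) \<nu> ^^ k) \<nu>) z = z + complex_of_real (real (Suc k)) * (F_transform \<nu> z - z))"
proof (induction k)
  case (Suc k)
  define \<rho> where "\<rho> = ((\<uplus>) \<nu> ^^ k) \<nu>"
  have \<rho>: "real_distribution \<rho>"
    "\<And>z. 0 < Im z \<Longrightarrow> F_transform \<rho> z = z + complex_of_real (real (Suc k)) * (F_transform \<nu> z - z)"
    using Suc.IH unfolding \<rho>_def by blast+
  have eq: "((\<uplus>) \<nu> ^^ Suc k) \<nu> = \<nu> \<uplus> \<rho>" by (simp add: \<rho>_def)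
  have "F_transform (\<nu> \<uplus> \<rho>) z = z + complex_of_real (real (Suc (Suc k))) * (F_transform \<nu> z - z)" if z: "0 < Im z" for z
    unfolding boolean_conv_F_transform(2)[OF \<nu> \<rho>(1) z] \<rho>(2)[OF z] by (simp add: algebra_simps)
  then show ?case unfolding eq using boolean_conv_F_transform(1)[OF \<nu> \<rho>(1)] by blast
qed (simp add: \<nu>)

lemma boolean_root:
  assumes \<mu>: "real_distribution \<mu>" and n: "1 \<le> n"
  shows "\<exists>\<nu>. real_distribution \<nu> \<and> \<mu> = ((\<uplus>) \<nu> ^^ (n - 1)) \<nu>"
proof -
  have "sublinear_pick (\<lambda>z. complex_of_real (1 / real n) * (F_transform \<mu> z - z))"
    by (intro sublinear_pick_scale real_distribution.sublinear_pick_F_transform \<mu>) simp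
  from real_distribution_of_sublinear_pick[OF this]
  obtain \<nu> where \<nu>: "real_distribution \<nu>"
    "\<And>z. 0 < Im z \<Longrightarrow> F_transform \<nu> z = z + complex_of_real (1 / real n) * (F_transform \<mu> z - z)" by blast
  have n': "real (Suc (n - 1)) = real n" using n by simp
  have "\<mu> = ((\<uplus>) \<nu> ^^ (n - 1)) \<nu>"
  proof (rule real_distribution_eqI[OF \<mu>])
    show "real_distribution (((\<uplus>) \<nu> ^^ (n - 1)) \<nu>)" using boolean_conv_power[OF \<nu>(1)] by blast
    fix z :: complex assume z: "0 < Im z"
    show "F_transform \<mu> z = F_transform (((\<uplus>) \<nu> ^^ (n - 1)) \<nu>) z"
      using boolean_conv_power[OF \<nu>(1), of "n - 1"] z \<nu>(2)[OF z] n unfolding n' by simp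
  qed
  then show ?thesis using \<nu>(1) by blast
qed

lemma inf_divisible_boolean: "inf_divisible (\<uplus>) = {\<mu>. real_distribution \<mu>}"
  using boolean_root by (auto simp: inf_divisible_def)

section \<open>The map \<open>Psi\<close>\<close>

context
  fixes t :: real assumes t: "1 < t"
begin

text \<open>Since t w + (1 - t) F w = w - (t - 1) (F w - w), the map H is an instance of w - N w,
  and t > 1 makes N a Pick function.\<close>

lemma is_right_inverse_H_iff:
  "is_right_inverse_H t \<mu> \<omega> \<longleftrightarrow> subordination (\<lambda>z. complex_of_real (t - 1) * (F_transform \<mu> z - z)) \<omega>"
proof -
  have "H_map t \<mu> w = w - complex_of_real (t - 1) * (F_transform \<mu> w - w)" for w
    by (simp add: H_map_def algebra_simps)
  then show ?thesis by (auto simp: is_right_inverse_H_def subordination_def)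
qed

lemma sublinear_pick_H:
  "real_distribution \<mu> \<Longrightarrow> sublinear_pick (\<lambda>z. complex_of_real (t - 1) * (F_transform \<mu> z - z))"
  using t by (intro sublinear_pick_scale real_distribution.sublinear_pick_F_transform) auto

lemma omega_map_subordination:
  assumes "real_distribution \<mu>"
  shows "subordination (\<lambda>z. complex_of_real (t - 1) * (F_transform \<mu> z - z)) (omega_map t \<mu>)"
proof -
  have "\<exists>\<omega>. is_right_inverse_H t \<mu> \<omega>"
    unfolding is_right_inverse_H_iff by (rule subordination_exists[OF sublinear_pick_H[OF assms]])
  from someI_ex[OF this] show ?thesis unfolding omega_map_def is_right_inverse_H_iff .
qed

lemma Psi_F_transform:
  assumes \<mu>: "real_distribution \<mu>"
  shows "real_distribution (Psi t \<mu>)"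
    and "0 < Im z \<Longrightarrow> F_transform (Psi t \<mu>) z = omega_map t \<mu> z"
proof -
  from real_distribution_of_sublinear_pick[OF sublinear_pick_subordination[OF sublinear_pick_H[OF \<mu>] omega_map_subordination[OF \<mu>]]]
  obtain \<rho> where \<rho>: "real_distribution \<rho>" "\<And>z. 0 < Im z \<Longrightarrow> F_transform \<rho> z = omega_map t \<mu> z" by auto
  have "Psi t \<mu> = \<rho>"
    unfolding Psi_def by (rule the_equality) (use \<rho> in \<open>auto intro: real_distribution_eqI\<close>)
  then show "real_distribution (Psi t \<mu>)" "0 < Im z \<Longrightarrow> F_transform (Psi t \<mu>) z = omega_map t \<mu> z"
    using \<rho> by auto
qed

lemma Psi_eqI:
  assumes \<mu>: "real_distribution \<mu>" and \<rho>: "real_distribution \<rho>"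
    and inv: "\<And>z. 0 < Im z \<Longrightarrow> F_transform \<rho> z - complex_of_real (t - 1) * (F_transform \<mu> (F_transform \<rho> z) - F_transform \<rho> z) = z"
  shows "Psi t \<mu> = \<rho>"
proof (rule real_distribution_eqI[OF Psi_F_transform(1)[OF \<mu>] \<rho>])
  fix z :: complex assume z: "0 < Im z"
  have "0 < Im (F_transform \<rho> z)" using real_distribution.Im_F_transform_ge[OF \<rho> z] z by simp
  with subordination_left_inverse[OF sublinear_pick_imp_pick[OF sublinear_pick_H[OF \<mu>]] omega_map_subordination[OF \<mu>] this]
  show "F_transform (Psi t \<mu>) z = F_transform \<rho> z"
    using z unfolding Psi_F_transform(2)[OF \<mu> z] inv[OF z] by simp
qed

lemma Psi_voiculescu_transform:
  assumes "real_distribution \<mu>"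
  shows "\<exists>\<beta>. voiculescu_transform_on (Psi t \<mu>) \<beta> (\<lambda>z. - (complex_of_real (t - 1) * (F_transform \<mu> z - z)))"
  by (rule voiculescu_transform_of_subordination[OF sublinear_pick_H[OF assms] omega_map_subordination[OF assms]])
     (rule Psi_F_transform(2)[OF assms])

lemma Psi_boolean_conv:
  assumes \<mu>: "real_distribution \<mu>" and \<nu>: "real_distribution \<nu>"
  shows "Psi t (\<mu> \<uplus> \<nu>) = Psi t \<mu> \<boxplus> Psi t \<nu>"
proof (rule sym)
  note b = boolean_conv_F_transform[OF \<mu> \<nu>]
  obtain \<beta>1 where V1: "voiculescu_transform_on (Psi t \<mu>) \<beta>1 (\<lambda>z. - (complex_of_real (t - 1) * (F_transform \<mu> z - z)))"
    using Psi_voiculescu_transform[OF \<mu>] by blast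
  obtain \<beta>2 where V2: "voiculescu_transform_on (Psi t \<nu>) \<beta>2 (\<lambda>z. - (complex_of_real (t - 1) * (F_transform \<nu> z - z)))"
    using Psi_voiculescu_transform[OF \<nu>] by blast
  obtain \<beta>3 where V3: "voiculescu_transform_on (Psi t (\<mu> \<uplus> \<nu>)) \<beta>3 (\<lambda>z. - (complex_of_real (t - 1) * (F_transform (\<mu> \<uplus> \<nu>) z - z)))"
    using Psi_voiculescu_transform[OF b(1)] by blast
  have sum: "- (complex_of_real (t - 1) * (F_transform (\<mu> \<uplus> \<nu>) z - z)) =
      - (complex_of_real (t - 1) * (F_transform \<mu> z - z)) + - (complex_of_real (t - 1) * (F_transform \<nu> z - z))"
    if "0 < Im z" for z
    unfolding b(2)[OF that] by (simp add: algebra_simps)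
  show "Psi t \<mu> \<boxplus> Psi t \<nu> = Psi t (\<mu> \<uplus> \<nu>)"
    by (rule free_conv_eqI[OF Psi_F_transform(1)[OF \<mu>] Psi_F_transform(1)[OF \<nu>] Psi_F_transform(1)[OF b(1)] V1 V2 V3])
       (rule sum, rule cone_domain_Im_pos)
qed

lemma Psi_boolean_power:
  assumes \<nu>: "real_distribution \<nu>"
  shows "Psi t (((\<uplus>) \<nu> ^^ k) \<nu>) = ((\<boxplus>) (Psi t \<nu>) ^^ k) (Psi t \<nu>)"
proof (induction k)
  case (Suc k)
  then show ?case
    using Psi_boolean_conv[OF \<nu>, of "((\<uplus>) \<nu> ^^ k) \<nu>"] boolean_conv_power[OF \<nu>, of k] by simp
qed simp

text \<open>\<open>Psi t\<close> carries the Boolean n-th root, which always exists, to a free n-th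
  root.\<close>

lemma Psi_inf_divisible:
  assumes \<mu>: "real_distribution \<mu>" shows "Psi t \<mu> \<in> inf_divisible (\<boxplus>)"
  unfolding inf_divisible_def
proof (intro CollectI conjI allI impI Psi_F_transform(1) \<mu>)
  fix n :: nat assume "1 \<le> n"
  from boolean_root[OF \<mu> this]
  obtain \<nu> where \<nu>: "real_distribution \<nu>" "\<mu> = ((\<uplus>) \<nu> ^^ (n - 1)) \<nu>" by blast
  have "Psi t \<mu> = ((\<boxplus>) (Psi t \<nu>) ^^ (n - 1)) (Psi t \<nu>)"
    unfolding \<nu>(2) by (rule Psi_boolean_power[OF \<nu>(1)])
  then show "\<exists>\<nu>. real_distribution \<nu> \<and> Psi t \<mu> = ((\<boxplus>) \<nu> ^^ (n - 1)) \<nu>"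
    using Psi_F_transform(1)[OF \<nu>(1)] by blast
qed

text \<open>The equation for \<omega> recovers F on the image of \<omega>. That image is open, as
  \<omega> has a left inverse, so the identity theorem applies.\<close>

lemma Psi_inj:
  assumes \<mu>: "real_distribution \<mu>" and \<nu>: "real_distribution \<nu>" and eq: "Psi t \<mu> = Psi t \<nu>"
  shows "\<mu> = \<nu>"
proof (rule real_distribution_eqI[OF \<mu> \<nu>])
  define \<omega> where "\<omega> = omega_map t \<mu>"
  have \<omega>\<mu>: "subordination (\<lambda>z. complex_of_real (t - 1) * (F_transform \<mu> z - z)) \<omega>"
    unfolding \<omega>_def by (rule omega_map_subordination[OF \<mu>])
  have same: "omega_map t \<nu> z = \<omega> z" if "0 < Im z" for z
    using Psi_F_transform(2)[OF \<mu> that] Psi_F_transform(2)[OF \<nu> that] eq by (simp add: \<omega>_def)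
  have F: "F_transform \<mu> (\<omega> z) = F_transform \<nu> (\<omega> z)" if z: "0 < Im z" for z
    using subordination_eq[OF \<omega>\<mu> z] subordination_eq[OF omega_map_subordination[OF \<nu>] z] t
    unfolding same[OF z] by (metis (no_types, lifting) diff_add_cancel eq_iff_diff_eq_0 mult_cancel_left of_real_eq_0_iff less_irrefl)
  have "inj_on \<omega> upper_half_plane"
    using subordination_right_inverse[OF \<omega>\<mu>] by (metis inj_onI mem_upper_half_plane)
  then have op: "open (\<omega> ` upper_half_plane)"
    using \<omega>\<mu> by (intro open_mapping_thm3) (auto simp: subordination_def)
  have "\<i> \<in> upper_half_plane" by simp
  then have ne: "\<omega> ` upper_half_plane \<noteq> {}" by blast
  fix z :: complex assume z: "0 < Im z"
  show "F_transform \<mu> z = F_transform \<nu> z"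
    by (rule analytic_continuation_open[OF op open_upper_half_plane ne connected_upper_half_plane _
        real_distribution.F_transform_holomorphic[OF \<mu>] real_distribution.F_transform_holomorphic[OF \<nu>]])
       (use z F subordination_Im_pos[OF \<omega>\<mu>] in auto)
qed

end

section \<open>Free infinite divisibility\<close>

text \<open>A Harnack-type estimate: one controlled value at height at least 1 bounds a Pick
  function at all points of height at least m. When A exceeds C it occurs on both sides of
  Schwarz-Pick, and one factor cancels.\<close>

lemma pick_local_bound:
  assumes N: "pick N" and z: "0 < m" "m \<le> Im z" and w: "1 \<le> Im w"
    and L: "cmod (z - w) \<le> L" and C: "cmod (N w) \<le> C"
  shows "cmod (N z) \<le> 2 * C + 2 * L^2 * C / m"
proof -
  define A where "A = cmod (N z - N w)"
  have C0: "0 \<le> C" using C norm_ge_zero[of "N w"] by linarith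
  have L0: "0 \<le> L" using L norm_ge_zero[of "z - w"] by linarith
  have tri: "cmod (N z) \<le> C + A"
    using norm_triangle_ineq2[of "N z" "N w"] C by (simp add: A_def)
  have imz: "0 \<le> Im (N z)" "0 \<le> Im (N w)" using pick_Im_nonneg[OF N] z w by auto
  have imz': "Im (N z) \<le> C + A" "Im (N w) \<le> C"
    using tri C Im_le_cmod[of "N z"] Im_le_cmod[of "N w"] by auto
  have "A \<le> C + 2 * L^2 * C / m"
  proof (cases "A \<le> C")
    case True
    moreover have "0 \<le> 2 * L^2 * C / m" using C0 z by simp
    ultimately show ?thesis by linarith
  next
    case False
    then have A0: "0 < A" using C0 by linarith
    have "A^2 * m \<le> A^2 * (Im z * Im w)"
      using mult_mono[of m "Im z" 1 "Im w"] z w by (intro mult_left_mono) auto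
    also have "\<dots> \<le> cmod (z - w)^2 * (Im (N z) * Im (N w))"
      unfolding A_def by (rule schwarz_pick[OF N]) (use z w in auto)
    also have "\<dots> \<le> L^2 * ((2 * A) * C)"
      using imz imz' L False by (intro mult_mono power_mono) auto
    finally have "A * (A * m) \<le> A * (2 * L^2 * C)" by (simp add: power2_eq_square mult_ac)
    then have "A * m \<le> 2 * L^2 * C" using A0 by (simp only: mult_le_cancel_left_pos)
    then have "A \<le> 2 * L^2 * C / m" using z by (simp add: le_divide_eq)
    then show ?thesis using C0 by linarith
  qed
  then show ?thesis using tri by linarith
qed

text \<open>Local boundedness for Montel's theorem. The point of control may depend on h, because in
  the application it is the value at i of a varying subordination function.\<close>

lemma pick_family_bounded:
  assumes H: "\<And>h. h \<in> \<H> \<Longrightarrow> pick h"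
    and w: "\<And>h. h \<in> \<H> \<Longrightarrow> \<exists>w. 1 \<le> Im w \<and> cmod w \<le> R \<and> cmod (h w) \<le> C"
    and K: "compact K" "K \<subseteq> upper_half_plane"
  shows "\<exists>B. \<forall>h\<in>\<H>. \<forall>z\<in>K. cmod (h z) \<le> B"
proof (cases "K = {}")
  case False
  obtain z0 where z0: "z0 \<in> K" "\<And>z. z \<in> K \<Longrightarrow> Im z0 \<le> Im z"
    using continuous_attains_inf[OF K(1) False continuous_on_Im[OF continuous_on_id]] by auto
  have m: "0 < Im z0" using z0(1) K(2) by auto
  obtain b where b: "\<And>z. z \<in> K \<Longrightarrow> cmod z \<le> b"
    using compact_imp_bounded[OF K(1)] by (auto simp: bounded_iff)
  have "cmod (h z) \<le> 2 * C + 2 * (b + R)^2 * C / Im z0" if h: "h \<in> \<H>" and z: "z \<in> K" for h z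
  proof -
    obtain w where w: "1 \<le> Im w" "cmod w \<le> R" "cmod (h w) \<le> C" using w[OF h] by blast
    have "cmod (z - w) \<le> b + R" using norm_triangle_ineq4[of z w] b[OF z] w(2) by linarith
    then show ?thesis by (rule pick_local_bound[OF H[OF h] m z0(2)[OF z] w(1) _ w(3)])
  qed
  then show ?thesis by blast
qed simp

text \<open>If \<open>\<mu>\<close> is the \<open>n\<close>-th free power of \<open>\<nu>\<^sub>n\<close>, then \<open>F\<^sub>\<mu>\<close> is nearly inverted by
  \<open>w - N\<^sub>n w\<close> with \<open>N\<^sub>n = (n - 1) (F\<^sub>\<nu> - id)\<close>. These Pick functions form a normal family and the limit
  inverts \<open>F\<^sub>\<mu>\<close> exactly.\<close>

theorem inf_divisible_free_subordination:
  assumes \<mu>: "\<mu> \<in> inf_divisible (\<boxplus>)"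
  shows "\<exists>N. sublinear_pick N \<and> subordination N (F_transform \<mu>)"
proof -
  have r\<mu>: "real_distribution \<mu>" using \<mu> by (simp add: inf_divisible_def)
  interpret \<mu>: real_distribution \<mu> by (rule r\<mu>)
  let ?F = "F_transform \<mu>"
  \<comment> \<open>Eliminating the root from \<open>h (\<omega> z) = \<omega> z - z\<close> and
    from F of \<mu> being F of \<nu> at \<omega> shows that \<omega> z is the convex combination of
    F z and z with weights k / (k + 1) and 1 / (k + 1).\<close>
  have ex: "\<exists>h \<omega>. pick h \<and> (\<forall>z. 0 < Im z \<longrightarrow> h (\<omega> z) = \<omega> z - z \<and>
      \<omega> z = ?F z + complex_of_real (inverse (real (Suc k))) * (z - ?F z))" for k
  proof -
    obtain \<nu> where \<nu>: "real_distribution \<nu>" "\<mu> = ((\<boxplus>) \<nu> ^^ k) \<nu>"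
      using \<mu> unfolding inf_divisible_def by (auto dest!: spec[of _ "Suc k"])
    let ?h = "\<lambda>z. complex_of_real (real k) * (F_transform \<nu> z - z)"
    obtain \<omega> where \<omega>: "subordination ?h \<omega>" "\<And>z. 0 < Im z \<Longrightarrow> ?F z = F_transform \<nu> (\<omega> z)"
      using free_conv_power[OF \<nu>(1), of k] unfolding \<nu>(2)[symmetric] by blast
    have "pick ?h"
      by (intro sublinear_pick_imp_pick sublinear_pick_scale real_distribution.sublinear_pick_F_transform \<nu>(1)) simp
    moreover have "?h (\<omega> z) = \<omega> z - z \<and> \<omega> z = ?F z + complex_of_real (inverse (real (Suc k))) * (z - ?F z)"
      if z: "0 < Im z" for z
    proof
      show eq: "?h (\<omega> z) = \<omega> z - z" by (rule subordination_eq[OF \<omega>(1) z])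
      then have "complex_of_real (real k) * (?F z - \<omega> z) = \<omega> z - z" using \<omega>(2)[OF z] by simp
      then have "complex_of_real (real (Suc k)) * (\<omega> z - ?F z) = z - ?F z" by (simp add: algebra_simps)
      moreover have "complex_of_real (inverse (real (Suc k))) * (complex_of_real (real (Suc k)) * x) = x" for x
        by (simp del: of_nat_Suc)
      ultimately have "complex_of_real (inverse (real (Suc k))) * (z - ?F z) = \<omega> z - ?F z" by metis
      then show "\<omega> z = ?F z + complex_of_real (inverse (real (Suc k))) * (z - ?F z)" by simp
    qed
    ultimately show ?thesis by blast
  qed
  then obtain h \<omega> where h: "\<And>k. pick (h k)"
    and h\<omega>: "\<And>k z. 0 < Im z \<Longrightarrow> h k (\<omega> k z) = \<omega> k z - z"
    and \<omega>: "\<And>k z. 0 < Im z \<Longrightarrow> \<omega> k z = ?F z + complex_of_real (inverse (real (Suc k))) * (z - ?F z)"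
    by metis
  \<comment> \<open>The points \<omega> k i serve as points of control for the normal family: they
    have height at least 1, and they and the values of h there are bounded uniformly in k.\<close>
  have near: "1 \<le> Im (\<omega> k \<i>) \<and> cmod (\<omega> k \<i>) \<le> 2 * cmod (?F \<i>) + 1 \<and> cmod (h k (\<omega> k \<i>)) \<le> 2 * cmod (?F \<i>) + 2" for k
  proof -
    define e where "e = inverse (real (Suc k))"
    have e: "0 < e" "e \<le> 1" by (simp_all add: e_def field_simps)
    have F1: "1 \<le> Im (?F \<i>)" using \<mu>.Im_F_transform_ge[of \<i>] by simp
    have w: "\<omega> k \<i> = ?F \<i> + complex_of_real e * (\<i> - ?F \<i>)" unfolding e_def by (rule \<omega>) simp
    have "(1 - e) * 1 \<le> (1 - e) * Im (?F \<i>)" using e F1 by (intro mult_left_mono) auto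
    then have 1: "1 \<le> Im (\<omega> k \<i>)" unfolding w by (simp add: algebra_simps)
    have "cmod (complex_of_real e * (\<i> - ?F \<i>)) \<le> 1 * (cmod \<i> + cmod (?F \<i>))"
      unfolding norm_mult using e by (intro mult_mono norm_triangle_ineq4) auto
    then have 2: "cmod (\<omega> k \<i>) \<le> 2 * cmod (?F \<i>) + 1"
      unfolding w using norm_triangle_ineq[of "?F \<i>" "complex_of_real e * (\<i> - ?F \<i>)"] by simp
    have "h k (\<omega> k \<i>) = \<omega> k \<i> - \<i>" by (rule h\<omega>) simp
    then have "cmod (h k (\<omega> k \<i>)) \<le> cmod (\<omega> k \<i>) + 1" using norm_triangle_ineq4[of "\<omega> k \<i>" \<i>] by simp
    then show ?thesis using 1 2 by simp
  qed
  have bdd: "\<exists>B. \<forall>f\<in>range h. \<forall>z\<in>K. cmod (f z) \<le> B" if "compact K" "K \<subseteq> upper_half_plane" for K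
    by (rule pick_family_bounded[OF _ _ that]) (use h near in auto)
  have hol: "f holomorphic_on upper_half_plane" if "f \<in> range h" for f
    using that h pick_holomorphic by auto
  obtain N r where holN: "N holomorphic_on upper_half_plane" and r: "strict_mono (r :: nat \<Rightarrow> nat)"
    and pt: "\<And>z. z \<in> upper_half_plane \<Longrightarrow> (\<lambda>n. h (r n) z) \<longlonglongrightarrow> N z"
    and unif: "\<And>K. compact K \<Longrightarrow> K \<subseteq> upper_half_plane \<Longrightarrow> uniform_limit K (h \<circ> r) N sequentially"
    by (rule Montel[OF open_upper_half_plane hol bdd subset_refl]) (assumption | rule that)+
  have pN: "pick N"
  proof (rule pickI[OF holN])
    fix z :: complex assume z: "0 < Im z"
    have "(\<lambda>n. Im (h (r n) z)) \<longlonglongrightarrow> Im (N z)" using pt z by (intro tendsto_Im) auto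
    then show "0 \<le> Im (N z)"
      by (rule LIMSEQ_le_const) (use pick_Im_nonneg[OF h z] in blast)
  qed
  have inv: "N (?F z) = ?F z - z" if z: "0 < Im z" for z
  proof (rule LIMSEQ_unique)
    have Fz: "0 < Im (?F z)" using \<mu>.Im_F_transform_ge[OF z] z by simp
    have "(\<lambda>n. inverse (real (Suc (r n)))) \<longlonglongrightarrow> 0"
      using LIMSEQ_subseq_LIMSEQ[OF LIMSEQ_inverse_real_of_nat r] by (simp add: o_def)
    then have "(\<lambda>n. ?F z + complex_of_real (inverse (real (Suc (r n)))) * (z - ?F z)) \<longlonglongrightarrow>
        ?F z + complex_of_real 0 * (z - ?F z)" by (intro tendsto_intros)
    then have lim: "(\<lambda>n. \<omega> (r n) z) \<longlonglongrightarrow> ?F z" using \<omega>[OF z] by simp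
    then have "(\<lambda>n. \<omega> (r n) z - z) \<longlonglongrightarrow> ?F z - z" by (intro tendsto_intros)
    then show "(\<lambda>n. h (r n) (\<omega> (r n) z)) \<longlonglongrightarrow> ?F z - z" using h\<omega>[OF z] by simp
    \<comment> \<open>The argument \<omega> (r n) z moves with n, so uniform convergence on a ball
      around its limit F z is required.\<close>
    obtain \<rho> where \<rho>: "\<rho> > 0" "cball (?F z) \<rho> \<subseteq> upper_half_plane"
      using open_upper_half_plane Fz unfolding open_contains_cball by (metis mem_upper_half_plane)
    show "(\<lambda>n. h (r n) (\<omega> (r n) z)) \<longlonglongrightarrow> N (?F z)"
    proof (rule tendstoI)
      fix e :: real assume e: "0 < e"
      have "\<forall>\<^sub>F n in sequentially. \<forall>x\<in>cball (?F z) \<rho>. dist ((h \<circ> r) n x) (N x) < e/2"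
        using uniform_limitD[OF unif[OF compact_cball \<rho>(2)], of "e/2"] e by simp
      moreover have "\<forall>\<^sub>F n in sequentially. dist (\<omega> (r n) z) (?F z) < \<rho>"
        by (rule tendstoD[OF lim \<rho>(1)])
      moreover have "\<forall>\<^sub>F n in sequentially. dist (N (\<omega> (r n) z)) (N (?F z)) < e/2"
        by (rule tendstoD[OF isCont_tendsto_compose[OF pick_isCont[OF pN Fz] lim]]) (use e in simp)
      ultimately show "\<forall>\<^sub>F n in sequentially. dist (h (r n) (\<omega> (r n) z)) (N (?F z)) < e"
      proof eventually_elim
        case (elim n)
        have "dist (h (r n) (\<omega> (r n) z)) (N (\<omega> (r n) z)) < e/2"
          using elim(1,2) by (simp add: dist_commute)
        then show ?case using elim(3) by (metis dist_triangle_half_r dist_commute)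
      qed
    qed
  qed
  have sub: "subordination N ?F"
    unfolding subordination_def
  proof (intro conjI ballI \<mu>.F_transform_holomorphic)
    fix z assume "z \<in> upper_half_plane"
    then have z: "0 < Im z" by simp
    show "?F z \<in> upper_half_plane" using \<mu>.Im_F_transform_ge[OF z] z by simp
    show "?F z - N (?F z) = z" using inv[OF z] by simp
  qed
  moreover have "sublinear_pick N"
  \<comment> \<open>Smallness is tested at w = F v, where N (F v) = F v - v is small by sublinearity
    of F - id.\<close>
  proof (rule sublinear_pickI[OF pN])
    fix \<delta> :: real assume \<delta>: "0 < \<delta>"
    obtain v where v: "0 < Im v" "Im (?F v - v) \<le> \<delta> * Im v"
      using sublinear_pick_small'[OF \<mu>.sublinear_pick_F_transform \<delta>] by blast
    have "\<delta> * Im v \<le> \<delta> * Im (?F v)" using \<mu>.Im_F_transform_ge[OF v(1)] \<delta> by simp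
    then show "\<exists>w. 0 < Im w \<and> Im (N w) \<le> \<delta> * Im w"
      using v \<mu>.Im_F_transform_ge[OF v(1)] inv[OF v(1)] by (intro exI[of _ "?F v"]) auto
  qed
  ultimately show ?thesis by blast
qed

lemma bij_betw_Psi:
  assumes t: "1 < t"
  shows "bij_betw (Psi t) (inf_divisible (\<uplus>)) (inf_divisible (\<boxplus>))"
  unfolding bij_betw_def
proof
  show "inj_on (Psi t) (inf_divisible (\<uplus>))"
    unfolding inf_divisible_boolean using Psi_inj[OF t] by (auto intro: inj_onI)
  show "Psi t ` inf_divisible (\<uplus>) = inf_divisible (\<boxplus>)"
  proof
    show "Psi t ` inf_divisible (\<uplus>) \<subseteq> inf_divisible (\<boxplus>)"
      unfolding inf_divisible_boolean using Psi_inf_divisible[OF t] by auto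
    show "inf_divisible (\<boxplus>) \<subseteq> Psi t ` inf_divisible (\<uplus>)"
    proof
      fix \<rho> assume \<rho>: "\<rho> \<in> inf_divisible (\<boxplus>)"
      then have r\<rho>: "real_distribution \<rho>" by (simp add: inf_divisible_def)
      obtain N where N: "sublinear_pick N" "subordination N (F_transform \<rho>)"
        using inf_divisible_free_subordination[OF \<rho>] by blast
      \<comment> \<open>H subtracts (t - 1) (F - id), so the preimage must have F - id equal to N /
        (t - 1).\<close>
      have "sublinear_pick (\<lambda>z. complex_of_real (1 / (t - 1)) * N z)"
        using t by (intro sublinear_pick_scale N) auto
      from real_distribution_of_sublinear_pick[OF this]
      obtain \<mu> where \<mu>: "real_distribution \<mu>"
        "\<And>z. 0 < Im z \<Longrightarrow> F_transform \<mu> z = z + complex_of_real (1 / (t - 1)) * N z" by blast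
      have "Psi t \<mu> = \<rho>"
      proof (rule Psi_eqI[OF t \<mu>(1) r\<rho>])
        fix z :: complex assume z: "0 < Im z"
        have c: "complex_of_real (t - 1) * (complex_of_real (1 / (t - 1)) * x) = x" for x
        proof -
          have "complex_of_real (t - 1) \<noteq> 0" using t by (simp del: of_real_diff)
          then show ?thesis by (simp add: field_simps)
        qed
        show "F_transform \<rho> z - complex_of_real (t - 1) * (F_transform \<mu> (F_transform \<rho> z) - F_transform \<rho> z) = z"
          unfolding \<mu>(2)[OF subordination_Im_pos[OF N(2) z]] add_diff_cancel_left' c
          by (rule subordination_right_inverse[OF N(2) z])
      qed
      then show "\<rho> \<in> Psi t ` inf_divisible (\<uplus>)" unfolding inf_divisible_boolean using \<mu>(1) by blast
    qed
  qed
qed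

section \<open>Boundary behaviour of subordination functions\<close>

text \<open>Along a vertical line the ratio cannot climb above 1. With ratios a at most 1 at y and b
  above 1 at y', Schwarz-Pick would bound b y' - a y strictly by b (y' - y), although it is at least
  that. This carries the contraction property upwards from points near the real line.\<close>

lemma pick_ratio_antimono:
  assumes N: "pick N" and y: "0 < y" "y < y'" and le: "Im (N (Complex u y)) \<le> y"
  shows "Im (N (Complex u y')) \<le> y'"
proof (rule ccontr)
  assume "\<not> Im (N (Complex u y')) \<le> y'"
  define a where "a = Im (N (Complex u y)) / y"
  define b where "b = Im (N (Complex u y')) / y'"
  have a: "0 \<le> a" "a \<le> 1" "Im (N (Complex u y)) = a * y"
    using pick_Im_nonneg[OF N, of "Complex u y"] y le by (auto simp: a_def)
  have b: "1 < b" "Im (N (Complex u y')) = b * y'"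
    using \<open>\<not> _\<close> y by (auto simp: b_def)
  have "\<bar>b * y' - a * y\<bar> \<le> cmod (N (Complex u y') - N (Complex u y))"
    using abs_Im_le_cmod[of "N (Complex u y') - N (Complex u y)"] a(3) b(2) by simp
  then have "(b * y' - a * y)^2 \<le> cmod (N (Complex u y') - N (Complex u y))^2"
    using abs_le_square_iff[of "b * y' - a * y" "cmod (N (Complex u y') - N (Complex u y))"] by simp
  also have "\<dots> \<le> b * a * cmod (Complex u y' - Complex u y)^2"
    by (rule schwarz_pick_ratio[OF N]) (use a b y in auto)
  also have "cmod (Complex u y' - Complex u y)^2 = (y' - y)^2"
    by (simp add: cmod_power2)
  also have "b * a * (y' - y)^2 \<le> b * 1 * (y' - y)^2"
    using a b by (intro mult_right_mono mult_left_mono) auto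
  also have "\<dots> < b * b * (y' - y)^2" using b y by simp
  also have "\<dots> = (b * y' - b * y)^2" by (simp add: power2_eq_square algebra_simps)
  finally have "(b * y' - a * y)^2 < (b * y' - b * y)^2" .
  moreover have "b * y' - b * y \<le> b * y' - a * y" using a b y by (simp add: mult_right_mono)
  moreover have "0 \<le> b * y' - b * y" using b y by simp
  ultimately show False by (meson not_le power_mono)
qed

lemma upper_half_plane_islimpt:
  assumes "0 \<le> Im x" shows "x islimpt upper_half_plane"
proof -
  have "(\<lambda>n. x + \<i> * complex_of_real (inverse (real (Suc n)))) \<longlonglongrightarrow> x + \<i> * complex_of_real 0"
    by (intro tendsto_intros LIMSEQ_inverse_real_of_nat)
  moreover have "x + \<i> * complex_of_real (inverse (real (Suc n))) \<in> upper_half_plane - {x}" for n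
    using assms by (simp add: add_nonneg_pos complex_eq_iff)
  ultimately show ?thesis unfolding islimpt_sequential
    by (intro exI[of _ "\<lambda>n. x + \<i> * complex_of_real (inverse (real (Suc n)))"]) simp
qed

context
  fixes N F :: "complex \<Rightarrow> complex"
  assumes N: "sublinear_pick N" and F: "subordination N F"
begin

private lemma pN: "pick N" by (rule sublinear_pick_imp_pick[OF N])

private lemma F_pos: "0 < Im z \<Longrightarrow> 0 < Im (F z)" by (rule subordination_Im_pos[OF F])

private lemma F_inverse: "0 < Im z \<Longrightarrow> F z - N (F z) = z" by (rule subordination_right_inverse[OF F])

private lemma F_holomorphic: "F holomorphic_on upper_half_plane"
  using F by (simp add: subordination_def)

private lemma Im_N_F: assumes "0 < Im z" shows "Im (N (F z)) = Im (F z) - Im z"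
  using arg_cong[OF F_inverse[OF assms], of Im] by simp

text \<open>Differentiating F - N o F = id gives p (1 - u) = 1, where |u| < 1 because the ratio of N
  at F z is 1 - \<open>Im z\<close> / \<open>Im (F z)\<close>. Then |p - 1| < |p|, which says that p
  is closer to 1 than to 0.\<close>

lemma subordination_deriv:
  assumes z: "0 < Im z" shows "1/2 < Re (deriv F z)"
proof -
  define p where "p = deriv F z"
  define u where "u = deriv N (F z)"
  have dF: "(F has_field_derivative p) (at z)"
    unfolding p_def using F_holomorphic z by (intro holomorphic_derivI[where S = upper_half_plane]) auto
  have dN: "(N has_field_derivative u) (at (F z))"
    unfolding u_def using pick_holomorphic[OF pN] F_pos[OF z]
    by (intro holomorphic_derivI[where S = upper_half_plane]) auto
  have "((\<lambda>w. F w - (N \<circ> F) w) has_field_derivative p - u * p) (at z)"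
    by (intro DERIV_diff dF DERIV_chain[OF dN dF])
  then have "((\<lambda>w. w) has_field_derivative p - u * p) (at z)"
    by (rule has_field_derivative_transform_within_open[where S = upper_half_plane]) (use z F_inverse in auto)
  then have eq: "p - u * p = 1" using DERIV_unique[OF _ DERIV_ident] by blast
  have "cmod u * Im (F z) \<le> Im (F z) - Im z"
    using pick_deriv_bound[OF pN F_pos[OF z]] Im_N_F[OF z] by (simp add: u_def)
  also have "\<dots> < 1 * Im (F z)" using z by simp
  finally have "cmod u < 1" using F_pos[OF z] by (simp only: mult_less_cancel_right_pos)
  have "p \<noteq> 0" using eq by auto
  have "p - 1 = u * p" using eq by (simp add: algebra_simps)
  then have "cmod (p - 1) = cmod u * cmod p" by (simp only: norm_mult)
  also have "\<dots> < 1 * cmod p" using \<open>cmod u < 1\<close> \<open>p \<noteq> 0\<close> by (intro mult_strict_right_mono) auto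
  finally have "cmod (p - 1) < cmod p" by simp
  then have "cmod (p - 1)^2 < cmod p^2" by (intro power_strict_mono) auto
  then show ?thesis unfolding p_def[symmetric] cmod_power2 by (simp add: power2_eq_square algebra_simps)
qed

text \<open>On the image of F the ratio is at most 1, so \<open>w - N w\<close>, which inverts F,
  has Lipschitz constant 2 there.\<close>

lemma subordination_expanding:
  assumes z: "0 < Im z" and w: "0 < Im w"
  shows "cmod (z - w) \<le> 2 * cmod (F z - F w)"
proof -
  have "cmod (N (F z) - N (F w)) \<le> 1 * cmod (F z - F w)"
    using Im_N_F z w by (intro pick_lipschitz[OF pN] F_pos) auto
  moreover have "cmod (z - w) \<le> cmod (F z - F w) + cmod (N (F z) - N (F w))"
  proof -
    have "(F z - F w) - (N (F z) - N (F w)) = (F z - N (F z)) - (F w - N (F w))" by simp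
    then have "(F z - F w) - (N (F z) - N (F w)) = z - w" unfolding F_inverse[OF z] F_inverse[OF w] .
    then show ?thesis by (metis norm_triangle_ineq4)
  qed
  ultimately show ?thesis by linarith
qed

section \<open>Cluster sets of the subordination function at real points\<close>

private lemma F_bound: "\<exists>C. \<forall>z. 0 < Im z \<longrightarrow> cmod (F z) \<le> C + 2 * cmod z"
proof -
  obtain v where v: "0 < Im v" "Im (N v) \<le> (1/4) * Im v" using sublinear_pick_small'[OF N, of "1/4"] by auto
  have "cmod (F z) \<le> (cmod v + 2 * cmod (N v - v)) + 2 * cmod z" if z: "0 < Im z" for z
  proof -
    have "cmod (F z - v) \<le> 2 * cmod (F z - N (F z) + N v - v)"
      using v Im_N_F[OF z] z by (intro pick_resolvent_bound[OF pN F_pos[OF z]]) auto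
    also have "F z - N (F z) + N v - v = z + (N v - v)" using F_inverse[OF z] by simp
    also have "cmod \<dots> \<le> cmod z + cmod (N v - v)" by (rule norm_triangle_ineq)
    finally show ?thesis using norm_triangle_sub[of "F z" v] by simp
  qed
  then show ?thesis by blast
qed

private definition cluster where
  "cluster x w \<longleftrightarrow> (\<exists>z. (\<forall>n. 0 < Im (z n)) \<and> z \<longlonglongrightarrow> x \<and> (\<lambda>n. F (z n)) \<longlonglongrightarrow> w)"

private lemma cluster_subseq:
  assumes z: "\<And>n. 0 < Im (z n)" "z \<longlonglongrightarrow> x"
  obtains l r where "strict_mono (r :: nat \<Rightarrow> nat)" "(\<lambda>n. F (z (r n))) \<longlonglongrightarrow> l" "cluster x l"
proof -
  obtain C where C: "\<And>z. 0 < Im z \<Longrightarrow> cmod (F z) \<le> C + 2 * cmod z" using F_bound by blast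
  obtain b where b: "\<And>n. cmod (z n) \<le> b"
    using convergent_imp_bounded[OF z(2)] by (auto simp: bounded_iff)
  have "cmod (F (z n)) \<le> C + 2 * b" for n using C[OF z(1)[of n]] b[of n] by linarith
  then have "bounded (range (\<lambda>n. F (z n)))" by (auto simp: bounded_iff)
  then obtain l r where r: "strict_mono (r :: nat \<Rightarrow> nat)" "((\<lambda>n. F (z n)) \<circ> r) \<longlonglongrightarrow> l"
    using bounded_imp_convergent_subsequence by blast
  have "(\<lambda>n. z (r n)) \<longlonglongrightarrow> x" using LIMSEQ_subseq_LIMSEQ[OF z(2) r(1)] by (simp add: o_def)
  then have "cluster x l" unfolding cluster_def using z(1) r(2)
    by (intro exI[of _ "\<lambda>n. z (r n)"]) (simp add: o_def)
  with r show ?thesis by (intro that[of r l]) (simp_all add: o_def)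
qed

private lemma cluster_Im_nonneg: "cluster x w \<Longrightarrow> 0 \<le> Im w"
  unfolding cluster_def by (blast intro: LIMSEQ_le_const[OF tendsto_Im] less_imp_le F_pos)

private lemma cluster_inverse:
  assumes "cluster x w" "0 < Im w" shows "w - N w = x"
proof -
  obtain z where z: "\<And>n. 0 < Im (z n)" "z \<longlonglongrightarrow> x" "(\<lambda>n. F (z n)) \<longlonglongrightarrow> w"
    using assms(1) by (auto simp: cluster_def)
  have "(\<lambda>n. F (z n) - N (F (z n))) \<longlonglongrightarrow> w - N w"
    by (intro tendsto_diff z(3) isCont_tendsto_compose[OF pick_isCont[OF pN assms(2)] z(3)])
  then show ?thesis using z(1,2) F_inverse LIMSEQ_unique by simp
qed

text \<open>The cluster set is the intersection of the closures of the images of half-discs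
  shrinking to x, a nested sequence of compact connected sets.\<close>

private lemma connected_cluster: "connected {w. cluster x w}"
proof -
  define B where "B n = ball x (inverse (real (Suc n))) \<inter> upper_half_plane" for n
  define S where "S n = closure (F ` B n)" for n
  obtain C where C: "\<And>z. 0 < Im z \<Longrightarrow> cmod (F z) \<le> C + 2 * cmod z" using F_bound by blast
  have "connected (\<Inter> (range S))"
  proof (rule connected_nest)
    fix n
    have "cmod (F z) \<le> C + 2 * (cmod x + 1)" if "z \<in> B n" for z
    proof -
      have "inverse (real (Suc n)) \<le> 1" by (simp add: field_simps)
      then have "cmod (z - x) \<le> 1" using that by (simp add: B_def dist_norm norm_minus_commute)
      then have "cmod z \<le> cmod x + 1" using norm_triangle_sub[of z x] by linarith
      then show ?thesis using C[of z] that by (auto simp: B_def intro: order_trans)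
    qed
    then have "bounded (F ` B n)" by (auto simp: bounded_iff)
    then show "compact (S n)" unfolding S_def by (simp add: compact_closure)
    have "connected (B n)" unfolding B_def by (intro convex_connected convex_Int) auto
    moreover have "continuous_on (B n) F"
      by (rule continuous_on_subset[OF holomorphic_on_imp_continuous_on[OF F_holomorphic]]) (auto simp: B_def)
    ultimately show "connected (S n)"
      unfolding S_def by (intro connected_imp_connected_closure connected_continuous_image)
  next
    fix m n :: nat assume "m \<le> n"
    then have "inverse (real (Suc n)) \<le> inverse (real (Suc m))" by (intro le_imp_inverse_le) auto
    then have "B n \<subseteq> B m" unfolding B_def by (intro Int_mono subset_ball subset_refl)
    then show "S n \<subseteq> S m" unfolding S_def by (intro closure_mono image_mono)
  qed
  moreover have "\<Inter> (range S) = {w. cluster x w}"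
  proof (intro equalityI subsetI)
    fix w assume "w \<in> \<Inter> (range S)"
    then have "\<exists>z\<in>B n. dist (F z) w < inverse (real (Suc n))" for n
      by (auto simp: S_def closure_approachable)
    then obtain z where z: "\<And>n. z n \<in> B n" "\<And>n. dist (F (z n)) w < inverse (real (Suc n))" by metis
    have "z \<longlonglongrightarrow> x"
      by (rule metric_tendsto_imp_tendsto[OF LIMSEQ_inverse_real_of_nat])
         (use z(1) in \<open>auto intro!: always_eventually simp: B_def dist_commute less_imp_le simp del: of_nat_Suc\<close>)
    moreover have "(\<lambda>n. F (z n)) \<longlonglongrightarrow> w"
      by (rule metric_tendsto_imp_tendsto[OF LIMSEQ_inverse_real_of_nat])
         (use z(2) in \<open>auto intro!: always_eventually simp: less_imp_le simp del: of_nat_Suc\<close>)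
    moreover have "0 < Im (z n)" for n using z(1)[of n] by (simp add: B_def)
    ultimately show "w \<in> {w. cluster x w}" by (auto simp: cluster_def)
  next
    fix w assume "w \<in> {w. cluster x w}"
    then obtain z where z: "\<And>n. 0 < Im (z n)" "z \<longlonglongrightarrow> x" "(\<lambda>n. F (z n)) \<longlonglongrightarrow> w"
      by (auto simp: cluster_def)
    have "w \<in> S n" for n
    proof -
      have "\<forall>\<^sub>F k in sequentially. dist (z k) x < inverse (real (Suc n))"
        by (rule tendstoD[OF z(2)]) simp
      then have "\<forall>\<^sub>F k in sequentially. F (z k) \<in> S n"
      proof eventually_elim
        case (elim k)
        then have "z k \<in> B n" using z(1)[of k] by (simp add: B_def dist_commute)
        then show ?case unfolding S_def by (intro subsetD[OF closure_subset] imageI)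
      qed
      then show ?thesis
        by (rule Lim_in_closed_set[rotated, OF _ _ z(3)]) (auto simp: S_def)
    qed
    then show "w \<in> \<Inter> (range S)" by blast
  qed
  ultimately show ?thesis by simp
qed

text \<open>The identity theorem would make \<open>w - N w\<close> equal to x everywhere, but at F i
  its value is i, which is not real. Both cases of the uniqueness of cluster values end
  here.\<close>

private lemma not_constant:
  assumes x: "Im x = 0" and U: "U \<subseteq> upper_half_plane" "\<xi> \<in> upper_half_plane" "\<xi> islimpt U"
    and eq: "\<And>w. w \<in> U \<Longrightarrow> w - N w = x"
  shows False
proof -
  have "(\<lambda>w. w - N w - x) holomorphic_on upper_half_plane"
    by (intro holomorphic_intros pick_holomorphic pN)
  then have "F \<i> - N (F \<i>) - x = 0"
    by (rule analytic_continuation[OF _ open_upper_half_plane connected_upper_half_plane U])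
       (use eq F_pos[of \<i>] in auto)
  then have "\<i> = x" using F_inverse[of \<i>] by simp
  then show False using x by auto
qed

text \<open>The hard case. If two real cluster values differ, then over every u strictly between
  them F takes values with real part u, arbitrarily low, at points tending to x. Descending along
  verticals to these values shows that \<open>w - N w - x\<close> is O(Im w) on the strip Q, so it
  extends by 0 below the axis to a holomorphic function and vanishes.\<close>

private lemma real_cluster_unique:
  assumes x: "Im x = 0" and real: "\<And>w. cluster x w \<Longrightarrow> Im w = 0"
    and p: "cluster x p" and q: "cluster x q"
  shows "Re q \<le> Re p"
proof (rule ccontr)
  assume "\<not> Re q \<le> Re p"
  then have lt: "Re p < Re q" by simp
  define Q where "Q = {w. 0 < Im w \<and> Re p < Re w \<and> Re w < Re q}"
  \<comment> \<open>On each half-disc around x the continuous function Re F takes values below and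
    above u, hence also u. Every limit of F along the resulting points is a cluster value and
    therefore real.\<close>
  have cross: "\<exists>\<zeta>. (\<forall>n. 0 < Im (\<zeta> n) \<and> Re (F (\<zeta> n)) = u) \<and> \<zeta> \<longlonglongrightarrow> x \<and> (\<lambda>n. Im (F (\<zeta> n))) \<longlonglongrightarrow> 0"
    if u: "Re p < u" "u < Re q" for u
  proof -
    obtain z where z: "\<And>n. 0 < Im (z n)" "z \<longlonglongrightarrow> x" "(\<lambda>n. F (z n)) \<longlonglongrightarrow> p"
      using p by (auto simp: cluster_def)
    obtain z' where z': "\<And>n. 0 < Im (z' n)" "z' \<longlonglongrightarrow> x" "(\<lambda>n. F (z' n)) \<longlonglongrightarrow> q"
      using q by (auto simp: cluster_def)
    have ex: "\<exists>\<zeta>. 0 < Im \<zeta> \<and> Re (F \<zeta>) = u \<and> dist \<zeta> x < inverse (real (Suc n))" for n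
    proof -
      let ?d = "inverse (real (Suc n))"
      have "\<forall>\<^sub>F k in sequentially. dist (z k) x < ?d" by (rule tendstoD[OF z(2)]) simp
      moreover have "\<forall>\<^sub>F k in sequentially. dist (z' k) x < ?d" by (rule tendstoD[OF z'(2)]) simp
      moreover have "\<forall>\<^sub>F k in sequentially. Re (F (z k)) < u"
        by (rule order_tendstoD(2)[OF tendsto_Re[OF z(3)] u(1)])
      moreover have "\<forall>\<^sub>F k in sequentially. u < Re (F (z' k))"
        by (rule order_tendstoD(1)[OF tendsto_Re[OF z'(3)] u(2)])
      ultimately have "\<forall>\<^sub>F k in sequentially. dist (z k) x < ?d \<and> dist (z' k) x < ?d \<and> Re (F (z k)) < u \<and> u < Re (F (z' k))"
        by eventually_elim auto
      then obtain k where k: "dist (z k) x < ?d" "dist (z' k) x < ?d" "Re (F (z k)) < u" "u < Re (F (z' k))"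
        using eventually_happens by fastforce
      define B where "B = ball x ?d \<inter> upper_half_plane"
      have B: "z k \<in> B" "z' k \<in> B" using k z(1) z'(1) by (auto simp: B_def dist_commute)
      have "connected B" unfolding B_def by (intro convex_connected convex_Int) auto
      moreover have "continuous_on B (\<lambda>w. Re (F w))"
        by (intro continuous_intros continuous_on_subset[OF holomorphic_on_imp_continuous_on[OF F_holomorphic]]) (auto simp: B_def)
      ultimately have "connected ((\<lambda>w. Re (F w)) ` B)" by (intro connected_continuous_image)
      then have "u \<in> (\<lambda>w. Re (F w)) ` B"
        by (rule connectedD_interval[OF _ imageI[OF B(1)] imageI[OF B(2)]]) (use k in auto)
      then show ?thesis by (auto simp: B_def dist_commute)
    qed
    then obtain \<zeta> where \<zeta>: "\<And>n. 0 < Im (\<zeta> n)" "\<And>n. Re (F (\<zeta> n)) = u" "\<And>n. dist (\<zeta> n) x < inverse (real (Suc n))"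
      by metis
    have lim: "\<zeta> \<longlonglongrightarrow> x"
      by (rule metric_tendsto_imp_tendsto[OF LIMSEQ_inverse_real_of_nat])
         (use \<zeta>(3) in \<open>auto intro!: always_eventually simp: less_imp_le\<close>)
    obtain l r where r: "strict_mono (r :: nat \<Rightarrow> nat)" "(\<lambda>n. F (\<zeta> (r n))) \<longlonglongrightarrow> l" "cluster x l"
      by (rule cluster_subseq[OF \<zeta>(1) lim])
    have "(\<lambda>n. Im (F (\<zeta> (r n)))) \<longlonglongrightarrow> 0" using tendsto_Im[OF r(2)] real[OF r(3)] by simp
    moreover have "(\<lambda>n. \<zeta> (r n)) \<longlonglongrightarrow> x" using LIMSEQ_subseq_LIMSEQ[OF lim r(1)] by (simp add: o_def)
    ultimately show ?thesis using \<zeta> by (intro exI[of _ "\<lambda>n. \<zeta> (r n)"]) auto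
  qed
  \<comment> \<open>Below w on its vertical line lies some F (\<zeta> n), where the ratio is less
    than 1.\<close>
  have ImN: "Im (N w) \<le> Im w" if w: "w \<in> Q" for w
  proof -
    obtain \<zeta> where \<zeta>: "\<And>n. 0 < Im (\<zeta> n)" "\<And>n. Re (F (\<zeta> n)) = Re w" "(\<lambda>n. Im (F (\<zeta> n))) \<longlonglongrightarrow> 0"
      using cross[of "Re w"] w by (auto simp: Q_def)
    have "\<forall>\<^sub>F n in sequentially. Im (F (\<zeta> n)) < Im w"
      by (rule order_tendstoD(2)[OF \<zeta>(3)]) (use w in \<open>simp add: Q_def\<close>)
    then obtain n where n: "Im (F (\<zeta> n)) < Im w" using eventually_happens by fastforce
    have C: "Complex (Re w) (Im (F (\<zeta> n))) = F (\<zeta> n)" using \<zeta>(2)[of n] by (simp add: complex_eq_iff)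
    have "Im (N (Complex (Re w) (Im w))) \<le> Im w"
      by (rule pick_ratio_antimono[OF pN F_pos[OF \<zeta>(1)] n])
         (use Im_N_F[OF \<zeta>(1)[of n]] \<zeta>(1)[of n] C in simp)
    then show ?thesis by simp
  qed
  \<comment> \<open>Descend vertically from w to F (\<zeta> n). Both w and N w move by at most the
    difference in height, and at the lower point \<open>w - N w\<close> is \<zeta> n, which is close
    to x.\<close>
  have near: "cmod (w - N w - x) \<le> 2 * Im w" if w: "w \<in> Q" for w
  proof -
    obtain \<zeta> where \<zeta>: "\<And>n. 0 < Im (\<zeta> n)" "\<And>n. Re (F (\<zeta> n)) = Re w" "\<zeta> \<longlonglongrightarrow> x" "(\<lambda>n. Im (F (\<zeta> n))) \<longlonglongrightarrow> 0"
      using cross[of "Re w"] w by (auto simp: Q_def)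
    have "cmod (w - N w - x) \<le> 2 * \<bar>Im w - Im (F (\<zeta> n))\<bar> + cmod (\<zeta> n - x)" for n
    proof -
      let ?v = "F (\<zeta> n)"
      have vQ: "?v \<in> Q" using w \<zeta>(2)[of n] F_pos[OF \<zeta>(1)] by (simp add: Q_def)
      have lip: "cmod (N w - N ?v) \<le> 1 * cmod (w - ?v)"
        using ImN[OF w] ImN[OF vQ] w vQ by (intro pick_lipschitz[OF pN]) (auto simp: Q_def)
      have "w - ?v = \<i> * complex_of_real (Im w - Im ?v)"
        using \<zeta>(2)[of n] by (simp add: complex_eq_iff)
      then have d: "cmod (w - ?v) = \<bar>Im w - Im ?v\<bar>" by (simp only: norm_mult norm_ii norm_of_real mult_1)
      have "cmod (w - N w - x) \<le> cmod (w - ?v) + cmod (N w - N ?v) + cmod (\<zeta> n - x)"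
      proof -
        have "w - N w - x = (w - ?v) - (N w - N ?v) + ((?v - N ?v) - x)" by simp
        then have "w - N w - x = (w - ?v) - (N w - N ?v) + (\<zeta> n - x)"
          unfolding F_inverse[OF \<zeta>(1)] .
        then show ?thesis
          by (rule ssubst) (rule order_trans[OF norm_triangle_ineq add_right_mono[OF norm_triangle_ineq4]])
      qed
      also have "\<dots> \<le> cmod (w - ?v) + 1 * cmod (w - ?v) + cmod (\<zeta> n - x)"
        by (intro add_mono order_refl lip)
      finally show ?thesis unfolding d by simp
    qed
    moreover have "(\<lambda>n. 2 * \<bar>Im w - Im (F (\<zeta> n))\<bar> + cmod (\<zeta> n - x)) \<longlonglongrightarrow> 2 * \<bar>Im w - 0\<bar> + cmod (x - x)"
      by (intro tendsto_intros \<zeta>)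
    ultimately have "cmod (w - N w - x) \<le> 2 * \<bar>Im w - 0\<bar> + cmod (x - x)"
      by (intro LIMSEQ_le_const) auto
    then show ?thesis using w by (simp add: Q_def)
  qed
  define S where "S = {w. Re p < Re w \<and> Re w < Re q}"
  \<comment> \<open>The bound \<open>near\<close> gives continuity across the axis, and the pasting
    theorem then gives holomorphy; vanishing below the axis forces g to vanish on the whole
    strip.\<close>
  define g where "g = (\<lambda>w. if 0 < Im w then w - N w - x else 0)"
  have openS: "open S" unfolding S_def by (intro open_Collect_conj open_Collect_less continuous_intros)
  have hol_H: "(\<lambda>w. w - N w - x) holomorphic_on upper_half_plane"
    by (intro holomorphic_intros pick_holomorphic pN)
  have g_le: "cmod (g w) \<le> 2 * \<bar>Im w\<bar>" if "w \<in> S" for w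
    using near[of w] that by (auto simp: g_def S_def Q_def)
  have holg: "g holomorphic_on S"
  proof (rule holomorphic_on_paste_across_line[where d = \<i> and k = 0, OF openS])
    show "g holomorphic_on S \<inter> {z. \<i> \<bullet> z < 0}"
      by (rule holomorphic_transform[where f = "\<lambda>_. 0"]) (auto simp: g_def inner_complex_def)
    show "g holomorphic_on S \<inter> {z. 0 < \<i> \<bullet> z}"
      by (rule holomorphic_transform[OF holomorphic_on_subset[OF hol_H]]) (auto simp: g_def inner_complex_def)
    show "continuous_on S g"
      unfolding continuous_on_eq_continuous_at[OF openS]
    proof
      fix w assume w: "w \<in> S"
      consider "0 < Im w" | "Im w < 0" | "Im w = 0" by linarith
      then show "isCont g w"
      proof cases
        case 1
        have "isCont (\<lambda>w. w - N w - x) w" using pick_isCont[OF pN 1] by (intro continuous_intros)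
        moreover have "\<forall>\<^sub>F v in nhds w. v \<in> upper_half_plane"
          by (rule eventually_nhds_in_open[OF open_upper_half_plane]) (use 1 in simp)
        then have "\<forall>\<^sub>F v in nhds w. g v = v - N v - x" by eventually_elim (simp add: g_def)
        ultimately show ?thesis using isCont_cong by metis
      next
        case 2
        have "\<forall>\<^sub>F v in nhds w. v \<in> {v. Im v < 0}"
          using 2 open_halfspace_Im_lt by (intro eventually_nhds_in_open) auto
        then have "\<forall>\<^sub>F v in nhds w. g v = 0" by eventually_elim (simp add: g_def)
        then show ?thesis using isCont_cong[of g "\<lambda>_. 0"] by simp
      next
        case 3
        have "((\<lambda>v. 2 * \<bar>Im v\<bar>) \<longlongrightarrow> 2 * \<bar>Im w\<bar>) (at w)" by (intro tendsto_intros)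
        then have lim0: "((\<lambda>v. 2 * \<bar>Im v\<bar>) \<longlongrightarrow> 0) (at w)" using 3 by simp
        have "\<forall>\<^sub>F v in at w. norm (g v) \<le> 2 * \<bar>Im v\<bar>"
          using eventually_at_in_open'[OF openS w] by eventually_elim (rule g_le)
        then have "(g \<longlongrightarrow> 0) (at w)" using lim0 by (rule Lim_null_comparison)
        then show ?thesis using 3 by (simp add: isCont_def g_def)
      qed
    qed
  qed simp
  have "S = {w. Re w > Re p} \<inter> {w. Re w < Re q}" by (auto simp: S_def)
  then have connS: "connected S"
    by (simp add: convex_connected convex_Int convex_halfspace_Re_gt convex_halfspace_Re_lt)
  have g0: "g w = 0" if "w \<in> S" for w
  proof (rule analytic_continuation_open[where f = g and g = "\<lambda>_. 0" and s = "S \<inter> {w. Im w < 0}" and s' = S])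
    have "Complex ((Re p + Re q) / 2) (-1) \<in> S \<inter> {w. Im w < 0}" using lt by (auto simp: S_def field_simps)
    then show "S \<inter> {w. Im w < 0} \<noteq> {}" by blast
    show "open (S \<inter> {w. Im w < 0})" using openS open_halfspace_Im_lt by (intro open_Int)
  qed (use openS connS holg that in \<open>auto simp: g_def\<close>)
  define \<xi> where "\<xi> = Complex ((Re p + Re q) / 2) 1"
  have openQ: "open Q" unfolding Q_def by (intro open_Collect_conj open_Collect_less continuous_intros)
  have "\<xi> \<in> Q" using lt by (auto simp: Q_def \<xi>_def field_simps)
  then have "\<xi> islimpt Q" using openQ by (intro interior_limit_point) (simp add: interior_open)
  moreover have "w - N w = x" if "w \<in> Q" for w
    using g0[of w] that by (simp add: Q_def S_def g_def)
  ultimately show False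
    by (intro not_constant[OF x, of Q \<xi>]) (auto simp: Q_def \<xi>_def)
qed

text \<open>If some cluster value lies in the open half-plane and another value exists,
  connectedness makes it a limit point of interior cluster values. All of these solve w - N w = x,
  against \<open>not_constant\<close>. Otherwise every cluster value is real.\<close>

private lemma cluster_unique:
  assumes x: "Im x = 0" and p: "cluster x p" and q: "cluster x q"
  shows "p = q"
proof (cases "\<exists>w. cluster x w \<and> 0 < Im w")
  case True
  then obtain w where w: "cluster x w" "0 < Im w" by blast
  show ?thesis
  proof (rule ccontr)
    assume "p \<noteq> q"
    then have "{w. cluster x w} \<noteq> {v}" for v using p q by (metis (mono_tags) mem_Collect_eq singletonD)
    with connected_cluster w(1) have "w islimpt {w. cluster x w}"
      by (intro connected_imp_perfect) auto
    then have "w islimpt {w. cluster x w} \<inter> upper_half_plane"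
      using eventually_at_in_open'[OF open_upper_half_plane, of w] w(2)
      by (intro islimpt_Int_eventually) simp_all
    then show False
      by (rule not_constant[OF x, rotated 2]) (use w(2) cluster_inverse in auto)
  qed
next
  case False
  then have real: "Im w = 0" if "cluster x w" for w
    using cluster_Im_nonneg[OF that] that by force
  have "Re p = Re q"
    using real_cluster_unique[OF x real p q] real_cluster_unique[OF x real q p] by simp
  then show ?thesis using real[OF p] real[OF q] by (simp add: complex_eq_iff)
qed

section \<open>The continuous extension to the closed half-plane\<close>

private lemma boundary_limit:
  assumes x: "Im x = 0"
  shows "\<exists>l. (F \<longlongrightarrow> l) (at x within upper_half_plane)"
proof -
  define z where "z n = x + \<i> * complex_of_real (inverse (real (Suc n)))" for n
  have "z \<longlonglongrightarrow> x + \<i> * complex_of_real 0"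
    unfolding z_def[abs_def] by (intro tendsto_intros LIMSEQ_inverse_real_of_nat)
  moreover have "0 < Im (z n)" for n using x by (simp add: z_def)
  ultimately obtain l where l: "cluster x l" using cluster_subseq[of z x] by auto
  have "(F \<circ> X) \<longlonglongrightarrow> l" if X: "\<forall>i. X i \<in> upper_half_plane - {x}" "X \<longlonglongrightarrow> x" for X
  proof (rule ccontr)
    assume "\<not> (F \<circ> X) \<longlonglongrightarrow> l"
    then obtain e where e: "e > 0" "\<not> (\<forall>\<^sub>F n in sequentially. dist (F (X n)) l < e)"
      unfolding tendsto_iff by auto
    then have "\<exists>\<^sub>\<infinity>n. \<not> dist (F (X n)) l < e" by (simp add: not_eventually frequently_cofinite cofinite_eq_sequentially)
    then obtain s where s: "strict_mono (s :: nat \<Rightarrow> nat)" "\<And>n. \<not> dist (F (X (s n))) l < e"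
      using infinite_enumerate[of "{n. \<not> dist (F (X n)) l < e}"] by (auto simp: INFM_iff_infinite)
    have Xs: "(\<lambda>n. X (s n)) \<longlonglongrightarrow> x" using LIMSEQ_subseq_LIMSEQ[OF X(2) s(1)] by (simp add: o_def)
    have pos: "0 < Im (X (s n))" for n using X(1) by auto
    obtain l' r where r: "strict_mono (r :: nat \<Rightarrow> nat)" "(\<lambda>n. F (X (s (r n)))) \<longlonglongrightarrow> l'" "cluster x l'"
      by (rule cluster_subseq[OF pos Xs])
    have "l' = l" by (rule cluster_unique[OF x r(3) l])
    with r(2) have "\<forall>\<^sub>F n in sequentially. dist (F (X (s (r n)))) l < e" using e(1) by (auto intro: tendstoD)
    then show False using s(2) eventually_happens by fastforce
  qed
  then show ?thesis unfolding tendsto_at_iff_sequentially by blast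
qed

text \<open>At real points this is the limit from the half-plane; at points with negative imaginary
  part the filter is trivial and the value is arbitrary.\<close>

definition boundary_extension :: "complex \<Rightarrow> complex" where
  "boundary_extension z = (if 0 < Im z then F z else Lim (at z within upper_half_plane) F)"

lemma boundary_extension_eq: "0 < Im z \<Longrightarrow> boundary_extension z = F z"
  by (simp add: boundary_extension_def)

private lemma not_trivial: "0 \<le> Im x \<Longrightarrow> at x within upper_half_plane \<noteq> bot"
  using upper_half_plane_islimpt by (simp add: trivial_limit_within)

lemma boundary_extension_tendsto:
  assumes x: "0 \<le> Im x"
  shows "(F \<longlongrightarrow> boundary_extension x) (at x within upper_half_plane)"
proof (cases "0 < Im x")
  case True
  then show ?thesis
    using holomorphic_on_imp_continuous_on[OF F_holomorphic]
    by (simp add: boundary_extension_eq continuous_on_def)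
next
  case False
  then obtain l where l: "(F \<longlongrightarrow> l) (at x within upper_half_plane)"
    using boundary_limit[of x] x by auto
  then have "Lim (at x within upper_half_plane) F = l"
    by (intro tendsto_Lim not_trivial x)
  then show ?thesis using l False by (simp add: boundary_extension_def)
qed

text \<open>The value at a boundary point y near x is a limit of values of F at half-plane points
  near x, so the estimate defining the limit at x passes to y.\<close>

lemma continuous_boundary_extension: "continuous_on {z. 0 \<le> Im z} boundary_extension"
  unfolding continuous_on_iff
proof (intro ballI allI impI)
  fix x :: complex and e :: real assume "x \<in> {z. 0 \<le> Im z}" and e: "0 < e"
  then have x: "0 \<le> Im x" by simp
  have "\<forall>\<^sub>F w in at x within upper_half_plane. dist (F w) (boundary_extension x) < e/2"
    using boundary_extension_tendsto[OF x] e by (intro tendstoD) auto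
  then obtain d where d: "d > 0" "\<And>w. w \<in> upper_half_plane \<Longrightarrow> w \<noteq> x \<Longrightarrow> dist w x < d \<Longrightarrow>
      dist (F w) (boundary_extension x) < e/2"
    unfolding eventually_at by auto
  have "dist (boundary_extension y) (boundary_extension x) < e" if y: "0 \<le> Im y" "dist y x < d" for y
  proof -
    have "\<forall>\<^sub>F w in at y within upper_half_plane. w \<in> ball x d \<and> w \<in> upper_half_plane"
      using y(2) eventually_at_in_open'[of "ball x d" y]
      by (auto simp: eventually_at_filter dist_commute elim: eventually_mono)
    moreover have "dist (F w) (boundary_extension x) \<le> e/2" if "w \<in> ball x d \<and> w \<in> upper_half_plane" for w
      using d(2)[of w] that e by (cases "w = x") (auto simp: boundary_extension_eq dist_commute less_imp_le)
    ultimately have "\<forall>\<^sub>F w in at y within upper_half_plane. dist (F w) (boundary_extension x) \<le> e/2"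
      by (auto elim: eventually_mono)
    then have "dist (boundary_extension y) (boundary_extension x) \<le> e/2"
      by (rule tendsto_upperbound[OF tendsto_dist[OF boundary_extension_tendsto[OF y(1)] tendsto_const] _ not_trivial[OF y(1)]])
    then show ?thesis using e by linarith
  qed
  then show "\<exists>d>0. \<forall>x'\<in>{z. 0 \<le> Im z}. dist x' x < d \<longrightarrow> dist (boundary_extension x') (boundary_extension x) < e"
    using d(1) by auto
qed

private lemma boundary_seq:
  assumes "0 \<le> Im x"
  shows "(\<lambda>n. F (x + \<i> * complex_of_real (inverse (real (Suc n))))) \<longlonglongrightarrow> boundary_extension x"
proof -
  have "(\<lambda>n. x + \<i> * complex_of_real (inverse (real (Suc n)))) \<longlonglongrightarrow> x + \<i> * complex_of_real 0"
    by (intro tendsto_intros LIMSEQ_inverse_real_of_nat)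
  moreover have "x + \<i> * complex_of_real (inverse (real (Suc n))) \<in> upper_half_plane - {x}" for n
    using assms by (simp add: add_nonneg_pos complex_eq_iff)
  ultimately show ?thesis
    using boundary_extension_tendsto[OF assms] unfolding tendsto_at_iff_sequentially by (simp add: o_def)
qed

lemma boundary_extension_Im_nonneg:
  assumes "0 \<le> Im x" shows "0 \<le> Im (boundary_extension x)"
proof (rule LIMSEQ_le_const[OF tendsto_Im[OF boundary_seq[OF assms]]], intro exI allI impI)
  fix n :: nat
  show "0 \<le> Im (F (x + \<i> * complex_of_real (inverse (real (Suc n)))))"
    using assms by (intro less_imp_le F_pos) (simp add: add_nonneg_pos)
qed

lemma boundary_extension_expanding:
  assumes x: "0 \<le> Im x" and y: "0 \<le> Im y"
  shows "cmod (x - y) \<le> 2 * cmod (boundary_extension x - boundary_extension y)"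
proof (rule LIMSEQ_le_const[OF tendsto_mult_left[OF tendsto_norm[OF tendsto_diff[OF boundary_seq[OF x] boundary_seq[OF y]]]]], intro exI allI impI)
  fix n :: nat
  let ?h = "\<i> * complex_of_real (inverse (real (Suc n)))"
  have "cmod ((x + ?h) - (y + ?h)) \<le> 2 * cmod (F (x + ?h) - F (y + ?h))"
    by (rule subordination_expanding) (use x y in \<open>simp_all add: add_nonneg_pos\<close>)
  then show "cmod (x - y) \<le> 2 * cmod (F (x + ?h) - F (y + ?h))" by simp
qed

lemma boundary_extension_inverse:
  assumes x: "0 \<le> Im x" and pos: "0 < Im (boundary_extension x)"
  shows "boundary_extension x - N (boundary_extension x) = x"
proof -
  let ?h = "\<lambda>n. x + \<i> * complex_of_real (inverse (real (Suc n)))"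
  have "(\<lambda>n. F (?h n) - N (F (?h n))) \<longlonglongrightarrow> boundary_extension x - N (boundary_extension x)"
    by (intro tendsto_diff boundary_seq[OF x] isCont_tendsto_compose[OF pick_isCont[OF pN pos] boundary_seq[OF x]])
  moreover have "F (?h n) - N (F (?h n)) = ?h n" for n
    by (rule F_inverse) (use x in \<open>simp add: add_nonneg_pos\<close>)
  moreover have "?h \<longlonglongrightarrow> x + \<i> * complex_of_real 0" by (intro tendsto_intros LIMSEQ_inverse_real_of_nat)
  ultimately show ?thesis using LIMSEQ_unique by fastforce
qed

text \<open>Where \<open>F x\<close> lies in the open half-plane, \<open>w \<mapsto> w - N w\<close> has nonzero derivative at \<open>F x\<close> by the
  equality case of the Schwarz-Pick inequality, so its local inverse continues \<open>F\<close> across \<open>x\<close>.\<close>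

lemma boundary_extension_analytic:
  assumes x: "Im x = 0" and pos: "0 < Im (boundary_extension x)"
  obtains r g where "0 < r" "g holomorphic_on ball x r" "\<And>z. z \<in> ball x r \<Longrightarrow> 0 < Im (g z)"
    "\<And>z. z \<in> ball x r \<Longrightarrow> 0 \<le> Im z \<Longrightarrow> boundary_extension z = g z"
proof -
  define w where "w = boundary_extension x"
  define H where "H = (\<lambda>w. w - N w)"
  have w: "0 < Im w" "H w = x" using pos boundary_extension_inverse[of x] x by (simp_all add: w_def H_def)
  have holH: "H holomorphic_on upper_half_plane"
    unfolding H_def by (intro holomorphic_intros pick_holomorphic pN)
  \<comment> \<open>A critical point would give N derivative 1 at w, and
    \<open>Im (N w) = Im w\<close> because x is real. That is the equality case, so N would be a
    translation and H the constant x.\<close>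
  have "deriv H w \<noteq> 0"
  proof
    assume 0: "deriv H w = 0"
    have "N field_differentiable at w"
      using pick_holomorphic[OF pN] w by (auto intro: holomorphic_on_imp_differentiable_at)
    then have "deriv H w = 1 - deriv N w" unfolding H_def by (simp add: deriv_diff)
    then have "deriv N w = 1" using 0 by simp
    moreover have "Im (N w) = Im w" using w(2) x by (auto simp: H_def)
    ultimately have "N z - N w = z - w" if "0 < Im z" for z
      using pick_translation[OF pN w(1)] that by blast
    then have "(z - w) - (N z - N w) + (w - N w) = x" if "z \<in> upper_half_plane" for z
      using that w(2) by (simp add: H_def)
    then have eq: "z - N z = x" if "z \<in> upper_half_plane" for z
      using that by (simp add: algebra_simps)
    show False
      by (rule not_constant[OF x subset_refl, of \<i>]) (use eq upper_half_plane_islimpt[of \<i>] in auto)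
  qed
  then obtain r0 where r0: "r0 > 0" "ball w r0 \<subseteq> upper_half_plane" "inj_on H (ball w r0)"
    using has_complex_derivative_locally_injective[OF holH _ open_upper_half_plane] w(1) by auto
  have holB: "H holomorphic_on ball w r0" by (rule holomorphic_on_subset[OF holH r0(2)])
  obtain g where g: "g holomorphic_on (H ` ball w r0)" "\<And>z. z \<in> ball w r0 \<Longrightarrow> g (H z) = z"
    by (rule holomorphic_has_inverse[OF holB open_ball r0(3)]) simp
  have "open (H ` ball w r0)" by (rule open_mapping_thm3[OF holB open_ball r0(3)])
  moreover have "x \<in> H ` ball w r0" using w(2) r0(1) by force
  ultimately obtain r1 where r1: "r1 > 0" "ball x r1 \<subseteq> H ` ball w r0"
    by (auto simp: open_contains_ball)
  \<comment> \<open>Continuity keeps \<open>boundary_extension z\<close> inside the ball where H is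
    injective, so that the local inverse g recovers it.\<close>
  obtain d where d: "d > 0" "\<And>z. 0 \<le> Im z \<Longrightarrow> dist z x < d \<Longrightarrow> dist (boundary_extension z) w < r0"
    using continuous_boundary_extension r0(1) x unfolding continuous_on_iff w_def by fastforce
  show ?thesis
  proof (rule that[of "min r1 d" g])
    show "0 < min r1 d" using r1 d by simp
    show "g holomorphic_on ball x (min r1 d)"
      by (rule holomorphic_on_subset[OF g(1)]) (use r1 in auto)
    show "0 < Im (g z)" if "z \<in> ball x (min r1 d)" for z
    proof -
      have "z \<in> H ` ball w r0" using that r1(2) by auto
      then obtain v where "v \<in> ball w r0" "z = H v" by blast
      then show ?thesis using g(2) r0(2) by auto
    qed
    show "boundary_extension z = g z" if "z \<in> ball x (min r1 d)" "0 \<le> Im z" for z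
    proof -
      have b: "boundary_extension z \<in> ball w r0"
        using d(2)[OF that(2)] that(1) by (simp add: dist_commute)
      then have "H (boundary_extension z) = z"
        unfolding H_def using r0(2) that(2) by (intro boundary_extension_inverse) auto
      then show ?thesis using g(2)[OF b] by simp
    qed
  qed
qed

end

section \<open>Lebesgue decomposition\<close>

text \<open>Intervals whose closure avoids x0 exhaust both sides of x0, and the mass at x0 completes
  all half-open intervals, which generate the Borel sets. The exceptional point will be the zero of
  F on the real line, where inversion gives no density.\<close>

lemma measure_eqI_off_point:
  fixes x0 :: real
  assumes sets: "sets M = sets borel" "sets N = sets borel"
    and fin: "\<And>a b. emeasure M {a<..b} \<noteq> \<infinity>"
    and eq: "\<And>a b. a < b \<Longrightarrow> x0 \<notin> {a..b} \<Longrightarrow> emeasure M {a<..b} = emeasure N {a<..b}"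
    and pt: "emeasure M {x0} = emeasure N {x0}"
  shows "M = N"
proof (rule measure_eqI_generator_eq[where \<Omega> = UNIV])
  note [measurable_cong] = sets
  let ?e = "\<lambda>n. inverse (real (Suc n))"
  have e: "0 < ?e n" for n by simp
  have left: "emeasure M {a<..<x0} = emeasure N {a<..<x0}" for a
  proof -
    have U: "(\<Union>n. {a<..x0 - ?e n}) = {a<..<x0}"
    proof (intro equalityI subsetI)
      fix t assume "t \<in> {a<..<x0}"
      then obtain n where "?e n < x0 - t" using reals_Archimedean[of "x0 - t"] by auto
      then show "t \<in> (\<Union>n. {a<..x0 - ?e n})" using \<open>t \<in> _\<close> by (intro UN_I[of n]) (auto simp del: of_nat_Suc)
    next
      fix t assume "t \<in> (\<Union>n. {a<..x0 - ?e n})"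
      then obtain n where "a < t" "t \<le> x0 - ?e n" by auto
      moreover from this(2) e[of n] have "t < x0" by linarith
      ultimately show "t \<in> {a<..<x0}" by simp
    qed
    have inc: "incseq (\<lambda>n. {a<..x0 - ?e n})"
    proof (rule monoI)
      fix m n :: nat assume "m \<le> n"
      then have "?e n \<le> ?e m" by (intro le_imp_inverse_le) auto
      then have "x0 - ?e m \<le> x0 - ?e n" by linarith
      then show "{a<..x0 - ?e m} \<subseteq> {a<..x0 - ?e n}"
        by (simp only: subset_iff greaterThanAtMost_iff) (blast intro: order_trans)
    qed
    have "emeasure M {a<..x0 - ?e n} = emeasure N {a<..x0 - ?e n}" for n
      using eq[of a "x0 - ?e n"] e[of n] by (cases "a < x0 - ?e n") (auto simp del: of_nat_Suc)
    then show ?thesis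
      using SUP_emeasure_incseq[OF _ inc, of M] SUP_emeasure_incseq[OF _ inc, of N] unfolding U
      by (simp add: sets image_subset_iff del: of_nat_Suc)
  qed
  have right: "emeasure M {x0<..b} = emeasure N {x0<..b}" for b
  proof -
    have U: "(\<Union>n. {x0 + ?e n<..b}) = {x0<..b}"
    proof (intro equalityI subsetI)
      fix t assume "t \<in> {x0<..b}"
      then obtain n where "?e n < t - x0" using reals_Archimedean[of "t - x0"] by auto
      then show "t \<in> (\<Union>n. {x0 + ?e n<..b})" using \<open>t \<in> _\<close> by (intro UN_I[of n]) (auto simp del: of_nat_Suc)
    next
      fix t assume "t \<in> (\<Union>n. {x0 + ?e n<..b})"
      then obtain n where "x0 + ?e n < t" "t \<le> b" by auto
      moreover from this(1) e[of n] have "x0 < t" by linarith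
      ultimately show "t \<in> {x0<..b}" by simp
    qed
    have inc: "incseq (\<lambda>n. {x0 + ?e n<..b})"
    proof (rule monoI)
      fix m n :: nat assume "m \<le> n"
      then have "?e n \<le> ?e m" by (intro le_imp_inverse_le) auto
      then have "x0 + ?e n \<le> x0 + ?e m" by linarith
      then show "{x0 + ?e m<..b} \<subseteq> {x0 + ?e n<..b}"
        by (simp only: subset_iff greaterThanAtMost_iff) (blast intro: order_le_less_trans)
    qed
    have "emeasure M {x0 + ?e n<..b} = emeasure N {x0 + ?e n<..b}" for n
      using eq[of "x0 + ?e n" b] e[of n] by (cases "x0 + ?e n < b") (auto simp del: of_nat_Suc)
    then show ?thesis
      using SUP_emeasure_incseq[OF _ inc, of M] SUP_emeasure_incseq[OF _ inc, of N] unfolding U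
      by (simp add: sets image_subset_iff del: of_nat_Suc)
  qed
  fix X assume "X \<in> range (\<lambda>(a, b). {a<..b::real})"
  then obtain a b where X: "X = {a<..b}" by auto
  \<comment> \<open>The case x0 = a stands apart: the closed interval contains x0 while
    \<open>{a<..b}\<close> does not.\<close>
  consider "x0 \<notin> {a..b}" "a < b" | "a < x0" "x0 \<le> b" | "x0 = a" | "b \<le> a" by fastforce
  then show "emeasure M X = emeasure N X"
  proof cases
    case 1 then show ?thesis using eq X by simp
  next
    case 2
    have "{a<..b} = {a<..<x0} \<union> ({x0} \<union> {x0<..b})" using 2 by auto
    moreover have "emeasure K ({a<..<x0} \<union> ({x0} \<union> {x0<..b})) = emeasure K {a<..<x0} + (emeasure K {x0} + emeasure K {x0<..b})"
      if K: "sets K = sets borel" for K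
    proof -
      have "emeasure K ({x0} \<union> {x0<..b}) = emeasure K {x0} + emeasure K {x0<..b}"
        by (rule plus_emeasure[symmetric]) (auto simp: K)
      moreover have "emeasure K ({a<..<x0} \<union> ({x0} \<union> {x0<..b})) = emeasure K {a<..<x0} + emeasure K ({x0} \<union> {x0<..b})"
        by (rule plus_emeasure[symmetric]) (auto simp: K)
      ultimately show ?thesis by (simp only:)
    qed
    ultimately show ?thesis using X sets left right pt by simp
  next
    case 3 then show ?thesis using X right by simp
  next
    case 4 then show ?thesis using X by simp
  qed
next
  show "(\<Union>i. {- real (i::nat)<..real i}) = UNIV"
    by (rule UN_Ioc_eq_UNIV)
qed (use fin sets in \<open>auto simp: borel_sigma_sets_Ioc Int_stable_def\<close>)

text \<open>Each part is isolated on a set where the others vanish: off all the exceptional sets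
  only the absolutely continuous part survives, and on the Lebesgue null sets minus the countable
  sets only the singular continuous one.\<close>

lemma lebesgue_decomposition_unique:
  assumes d1: "lebesgue_decomposition \<mu> a s d" and d2: "lebesgue_decomposition \<mu> a' s' d'"
  shows "a = a'" "s = s'"
proof -
  note d = d1[unfolded lebesgue_decomposition_def] d2[unfolded lebesgue_decomposition_def]
  have sets: "sets a = sets borel" "sets s = sets borel" "sets d = sets borel"
    "sets a' = sets borel" "sets s' = sets borel" "sets d' = sets borel" using d by auto
  have sum: "emeasure \<mu> A = emeasure a A + emeasure s A + emeasure d A"
    "emeasure \<mu> A = emeasure a' A + emeasure s' A + emeasure d' A" if "A \<in> sets borel" for A
    using d that by auto
  obtain N N' C C' where N: "N \<in> null_sets lborel" "emeasure s (- N) = 0" "N' \<in> null_sets lborel" "emeasure s' (- N') = 0"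
    and C: "countable C" "emeasure d (- C) = 0" "countable C'" "emeasure d' (- C') = 0"
    using d by blast
  have borel: "N \<in> sets borel" "N' \<in> sets borel" "C \<in> sets borel" "C' \<in> sets borel"
    using null_setsD2[OF N(1)] null_setsD2[OF N(3)] sets.countable[OF _ C(1), of borel] sets.countable[OF _ C(3), of borel]
    by simp_all
  have sub0: "emeasure m B = 0" if "emeasure m A = 0" "B \<subseteq> A" "A \<in> sets m" for m :: "real measure" and A B
    using emeasure_mono[OF that(2,3)] that(1) by simp
  have ac: "emeasure m B = 0" if "absolutely_continuous lborel m" "sets m = sets borel" "B \<subseteq> Z" "Z \<in> null_sets lborel"
    for m :: "real measure" and B Z
    using that sub0[of m Z B] unfolding absolutely_continuous_def by (auto simp: null_sets_def subset_iff)
  have aca: "absolutely_continuous lborel a" "absolutely_continuous lborel a'" using d by auto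
  have split: "emeasure m A = emeasure m (A \<inter> Y)" if "sets m = sets borel" "emeasure m (A - Y) = 0"
    "A \<in> sets borel" "Y \<in> sets borel" for m :: "real measure" and A Y
    using plus_emeasure[of "A \<inter> Y" m "A - Y"] that by (simp add: Int_Diff_Un Int_Diff_disjoint)
  show "a = a'"
  proof (rule measure_eqI)
    fix A assume "A \<in> sets a"
    then have A: "A \<in> sets borel" using sets by simp
    define Z where "Z = N \<union> N' \<union> C \<union> C'"
    have Z: "Z \<in> null_sets lborel" unfolding Z_def
      by (intro null_sets.Un N(1,3) countable_imp_null_set_lborel[OF C(1)] countable_imp_null_set_lborel[OF C(3)])
    have Zb: "- Z \<in> sets borel" using borel by (auto simp: Z_def)
    have AZ: "A \<inter> - Z \<in> sets borel" using A Zb by auto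
    have "emeasure a A = emeasure a (A \<inter> - Z)" "emeasure a' A = emeasure a' (A \<inter> - Z)"
      by (intro split sets A Zb ac[OF aca(1) _ _ Z] ac[OF aca(2) _ _ Z]; auto)+
    moreover have "emeasure s (A \<inter> - Z) = 0" "emeasure s' (A \<inter> - Z) = 0" "emeasure d (A \<inter> - Z) = 0" "emeasure d' (A \<inter> - Z) = 0"
      by (rule sub0[OF N(2)] sub0[OF N(4)] sub0[OF C(2)] sub0[OF C(4)]; use borel sets in \<open>auto simp: Z_def\<close>)+
    ultimately show "emeasure a A = emeasure a' A" using sum[OF AZ] by simp
  qed (simp add: sets)
  show "s = s'"
  proof (rule measure_eqI)
    fix A assume "A \<in> sets s"
    then have A: "A \<in> sets borel" using sets by simp
    define Z where "Z = N \<union> N'"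
    define D where "D = C \<union> C'"
    have Z: "Z \<in> null_sets lborel" unfolding Z_def using N by (intro null_sets.Un)
    have Y: "Z - D \<in> sets borel" using borel by (auto simp: Z_def D_def)
    have AY: "A \<inter> (Z - D) \<in> sets borel" using A Y by auto
    have D0: "D \<in> null_sets m" if "sets m = sets borel" "\<forall>x. emeasure m {x} = 0" for m :: "real measure"
    proof -
      have "(\<Union>x\<in>D. {x}) \<in> null_sets m"
        using C that by (intro null_sets_UN') (auto simp: D_def null_sets_def)
      then show ?thesis by simp
    qed
    have z: "emeasure m (A - (Z - D)) = 0" if m: "sets m = sets borel" "\<forall>x. emeasure m {x} = 0"
      and Q: "emeasure m (- Q) = 0" "Q \<subseteq> Z" "Q \<in> sets borel" for m :: "real measure" and Q
    proof -
      have "- Q \<in> null_sets m" using Q m by (auto simp: null_sets_def)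
      then have null: "- Q \<union> D \<in> null_sets m" using D0[OF m] by (rule null_sets.Un)
      show ?thesis
        by (rule sub0[OF null_setsD1[OF null] _ null_setsD2[OF null]]) (use Q(2) in auto)
    qed
    have pt: "\<forall>x. emeasure s {x} = 0" "\<forall>x. emeasure s' {x} = 0" using d by auto
    have "emeasure s A = emeasure s (A \<inter> (Z - D))"
      by (rule split[OF sets(2) z[OF sets(2) pt(1) N(2) _ borel(1)] A Y]) (simp add: Z_def)
    moreover have "emeasure s' A = emeasure s' (A \<inter> (Z - D))"
      by (rule split[OF sets(5) z[OF sets(5) pt(2) N(4) _ borel(2)] A Y]) (simp add: Z_def)
    moreover have "emeasure a (A \<inter> (Z - D)) = 0" "emeasure a' (A \<inter> (Z - D)) = 0"
      by (rule ac[OF aca(1) sets(1) _ Z] ac[OF aca(2) sets(4) _ Z]; auto)+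
    moreover have "emeasure d (A \<inter> (Z - D)) = 0" "emeasure d' (A \<inter> (Z - D)) = 0"
      by (rule sub0[OF C(2)] sub0[OF C(4)]; use borel sets in \<open>auto simp: D_def\<close>)+
    ultimately show "emeasure s A = emeasure s' A" using sum[OF AY] by simp
  qed (simp add: sets)
qed

lemma lebesgue_decomposition_parts:
  assumes "lebesgue_decomposition \<mu> a s d"
  shows "ac_part \<mu> = a" "sc_part \<mu> = s"
  unfolding ac_part_def sc_part_def
  using assms lebesgue_decomposition_unique[OF _ assms] by (blast intro: the_equality)+

section \<open>Regularity of freely infinitely divisible measures\<close>

context
  fixes \<mu> :: "real measure" and N :: "complex \<Rightarrow> complex"
  assumes \<mu>: "real_distribution \<mu>" and N: "sublinear_pick N" and F: "subordination N (F_transform \<mu>)"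
begin

interpretation \<mu>: real_distribution \<mu> by (rule \<mu>)

private abbreviation "E \<equiv> boundary_extension (F_transform \<mu>)"

text \<open>The boundary value of - Im G / pi. At a zero of \<open>E\<close>, division by zero makes
  the density 0.\<close>

definition stieltjes_density :: "real \<Rightarrow> real" where
  "stieltjes_density x = - Im (1 / E (complex_of_real x)) / pi"

text \<open>The expansion property makes \<open>E\<close> injective on the real line; its single
  possible zero is the only place for an atom.\<close>

private lemma E_inj:
  assumes "E (complex_of_real x) = 0" "E (complex_of_real y) = 0" shows "x = y"
  using boundary_extension_expanding[OF N F, of "complex_of_real x" "complex_of_real y"] assms
  by (simp del: of_real_diff add: of_real_diff[symmetric])

private lemma E_nonzero: "0 < Im z \<Longrightarrow> E z \<noteq> 0"
  using boundary_extension_eq[OF N F, of z] subordination_Im_pos[OF F, of z] by auto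

private lemma cauchy_E: "0 < Im z \<Longrightarrow> cauchy_transform \<mu> z = 1 / E z"
  by (simp add: boundary_extension_eq[OF N F] F_transform_def)

private lemma continuous_E_real: "continuous_on UNIV (\<lambda>x. E (complex_of_real x))"
  by (rule continuous_on_compose2[OF continuous_boundary_extension[OF N F]]) (auto intro!: continuous_intros)

lemma stieltjes_density_measurable [measurable]: "stieltjes_density \<in> borel_measurable borel"
proof -
  have [measurable]: "(\<lambda>x. E (complex_of_real x)) \<in> borel_measurable borel"
    by (rule borel_measurable_continuous_onI[OF continuous_E_real])
  show ?thesis unfolding stieltjes_density_def[abs_def] by measurable
qed

lemma stieltjes_density_nonneg: "0 \<le> stieltjes_density x"
  using boundary_extension_Im_nonneg[OF N F, of "complex_of_real x"]
  by (simp add: stieltjes_density_def Im_divide divide_nonpos_nonneg divide_nonpos_pos)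

private lemma vertical_tendsto:
  "((\<lambda>y. E (Complex x y)) \<longlongrightarrow> E (complex_of_real x)) (at_right 0)"
proof -
  have c: "continuous_on {0..} (\<lambda>y. E (Complex x y))"
    by (rule continuous_on_compose2[OF continuous_boundary_extension[OF N F]])
       (auto simp: Complex_eq intro!: continuous_intros)
  have "((\<lambda>y. E (Complex x y)) \<longlongrightarrow> E (Complex x 0)) (at 0 within {0..})"
    using c unfolding continuous_on_def by auto
  then have "((\<lambda>y. E (Complex x y)) \<longlongrightarrow> E (Complex x 0)) (at 0 within {0<..})"
    by (rule tendsto_within_subset) auto
  then show ?thesis by (simp add: complex_of_real_def)
qed

text \<open>The product of the Cauchy transform and \<open>E\<close> is 1 above the axis, so a
  finite vertical limit l satisfies l E(x) = 1. Hence \<open>E\<close> cannot vanish at x, and the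
  default value 0 at a zero does not interfere.\<close>

private lemma stieltjes_density_boundary:
  assumes l: "((\<lambda>y. cauchy_transform \<mu> (Complex x y)) \<longlongrightarrow> l) (at_right 0)"
  shows "stieltjes_density x = - Im l / pi"
proof -
  have "\<forall>\<^sub>F y in at_right (0::real). cauchy_transform \<mu> (Complex x y) * E (Complex x y) = 1"
    using eventually_at_right_less by eventually_elim (use cauchy_E E_nonzero in simp)
  then have "((\<lambda>y. cauchy_transform \<mu> (Complex x y) * E (Complex x y)) \<longlongrightarrow> 1) (at_right 0)"
    by (rule tendsto_eventually)
  from tendsto_unique[OF _ this tendsto_mult[OF l vertical_tendsto]]
  have "l * E (complex_of_real x) = 1" by simp
  then have "E (complex_of_real x) \<noteq> 0" by auto
  with \<open>l * _ = 1\<close> have "l = 1 / E (complex_of_real x)" by (simp add: nonzero_eq_divide_eq)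
  then show ?thesis by (simp add: stieltjes_density_def)
qed

private definition ys where "ys n = inverse (real (Suc n))"

private lemma ys: "0 < ys n" "ys n \<le> 1" "ys \<longlonglongrightarrow> 0"
  unfolding ys_def[abs_def] using LIMSEQ_inverse_real_of_nat by (simp_all add: field_simps)

private lemma vertical_seq: "(\<lambda>n. E (Complex x (ys n))) \<longlonglongrightarrow> E (complex_of_real x)"
proof (rule filterlim_compose[OF vertical_tendsto])
  have "ys n \<in> {0<..} \<and> ys n \<noteq> 0" for n using ys(1)[of n] by simp
  then show "filterlim ys (at_right 0) sequentially"
    unfolding filterlim_at by (intro conjI ys(3) always_eventually allI) auto
qed

text \<open>Where the Cauchy transform has a finite vertical limit, its product with the height
  tends to 0, and this product gives the point mass.\<close>

lemma measure_point_eq_0: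
  assumes x: "E (complex_of_real x) \<noteq> 0" shows "measure \<mu> {x} = 0"
proof -
  have "(\<lambda>n. \<i> * complex_of_real (ys n) * (1 / E (Complex x (ys n)))) \<longlonglongrightarrow> \<i> * complex_of_real 0 * (1 / E (complex_of_real x))"
    by (intro tendsto_intros ys(3) vertical_seq x)
  moreover have "(\<lambda>n. \<i> * complex_of_real (ys n) * (1 / E (Complex x (ys n)))) \<longlonglongrightarrow> complex_of_real (measure \<mu> {x})"
    using \<mu>.point_mass_limit[OF ys(1) ys(3), of x] cauchy_E[of "Complex x (ys _)"] ys(1) by simp
  ultimately have "complex_of_real (measure \<mu> {x}) = \<i> * complex_of_real 0 * (1 / E (complex_of_real x))"
    using LIMSEQ_unique by blast
  then show ?thesis by simp
qed

lemma at_most_one_atom: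
  assumes "0 < measure \<mu> {x}" "0 < measure \<mu> {y}" shows "x = y"
  using E_inj measure_point_eq_0 assms by (metis less_irrefl)

text \<open>Away from zeros of \<open>E\<close> the Cauchy transform extends continuously to a
  compact rectangle over the interval. It is bounded there, so dominated convergence takes the limit
  in Stieltjes inversion inside the integral. The endpoints have no mass, so their half weights are
  harmless.\<close>

private lemma interval_measure_eq:
  assumes ab: "a < b" and nz: "\<And>x. x \<in> {a..b} \<Longrightarrow> E (complex_of_real x) \<noteq> 0"
  shows "emeasure \<mu> {a<..b} = emeasure (density lborel (\<lambda>x. ennreal (stieltjes_density x))) {a<..b}"
proof -
  \<comment> \<open>Height 1 accommodates all the heights \<open>ys n\<close>.\<close>
  define R where "R = cbox (Complex a 0) (Complex b 1)"
  have Rnz: "E z \<noteq> 0" if "z \<in> R" for z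
  proof (cases "0 < Im z")
    case False
    then have "z = complex_of_real (Re z)" "Re z \<in> {a..b}" using that by (auto simp: R_def in_cbox_complex_iff complex_eq_iff)
    then show ?thesis using nz by metis
  qed (rule E_nonzero)
  have contR: "continuous_on R (\<lambda>z. 1 / E z)"
    by (intro continuous_intros continuous_on_subset[OF continuous_boundary_extension[OF N F]])
       (use Rnz in \<open>auto simp: R_def in_cbox_complex_iff\<close>)
  then have "bounded ((\<lambda>z. 1 / E z) ` R)"
    by (intro compact_imp_bounded compact_continuous_image) (auto simp: R_def)
  then obtain B where B: "\<And>z. z \<in> R \<Longrightarrow> cmod (1 / E z) \<le> B" by (auto simp: bounded_iff)
  have inR: "Complex x (ys n) \<in> R" "complex_of_real x \<in> R" if "x \<in> {a..b}" for x n
    using that ys(1,2)[of n] by (auto simp: R_def in_cbox_complex_iff)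
  have lim: "(\<lambda>n. \<integral>x\<in>{a..b}. - Im (cauchy_transform \<mu> (Complex x (ys n))) \<partial>lborel) \<longlonglongrightarrow>
      (\<integral>x\<in>{a..b}. pi * stieltjes_density x \<partial>lborel)"
    unfolding set_lebesgue_integral_def
  proof (rule integral_dominated_convergence[where w = "\<lambda>x. indicator {a..b} x *\<^sub>R B"])
    show "integrable lborel (\<lambda>x. indicator {a..b} x *\<^sub>R B)"
      by (intro integrable_scaleR_left integrable_real_indicator) (use ab in auto)
    show "(\<lambda>x. indicator {a..b} x *\<^sub>R (pi * stieltjes_density x)) \<in> borel_measurable lborel"
      by measurable
    show "(\<lambda>x. indicator {a..b} x *\<^sub>R - Im (cauchy_transform \<mu> (Complex x (ys n)))) \<in> borel_measurable lborel" for n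
    proof -
      have "continuous_on UNIV (\<lambda>x. cauchy_transform \<mu> (Complex x (ys n)))"
        by (rule continuous_on_compose2[OF holomorphic_on_imp_continuous_on[OF \<mu>.cauchy_transform_holomorphic]])
           (use ys(1) in \<open>auto simp: Complex_eq intro!: continuous_intros\<close>)
      then have [measurable]: "(\<lambda>x. cauchy_transform \<mu> (Complex x (ys n))) \<in> borel_measurable borel"
        by (rule borel_measurable_continuous_onI)
      show ?thesis by measurable
    qed
    show "AE x in lborel. (\<lambda>n. indicator {a..b} x *\<^sub>R - Im (cauchy_transform \<mu> (Complex x (ys n)))) \<longlonglongrightarrow>
        indicator {a..b} x *\<^sub>R (pi * stieltjes_density x)"
    proof (rule AE_I2)
      fix x
      show "(\<lambda>n. indicator {a..b} x *\<^sub>R - Im (cauchy_transform \<mu> (Complex x (ys n)))) \<longlonglongrightarrow>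
        indicator {a..b} x *\<^sub>R (pi * stieltjes_density x)"
      proof (cases "x \<in> {a..b}")
        case True
        have "(\<lambda>n. - Im (1 / E (Complex x (ys n)))) \<longlonglongrightarrow> - Im (1 / E (complex_of_real x))"
          by (intro tendsto_intros vertical_seq nz True)
        then show ?thesis using True cauchy_E[of "Complex x (ys _)"] ys(1)
          by (simp add: stieltjes_density_def del: atLeastAtMost_iff)
      qed (simp del: atLeastAtMost_iff)
    qed
    show "AE x in lborel. norm (indicator {a..b} x *\<^sub>R - Im (cauchy_transform \<mu> (Complex x (ys n)))) \<le> indicator {a..b} x *\<^sub>R B" for n
    proof (rule AE_I2)
      fix x
      show "norm (indicator {a..b} x *\<^sub>R - Im (cauchy_transform \<mu> (Complex x (ys n)))) \<le> indicator {a..b} x *\<^sub>R B"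
      proof (cases "x \<in> {a..b}")
        case True
        have "\<bar>Im (cauchy_transform \<mu> (Complex x (ys n)))\<bar> \<le> B"
          using B[OF inR(1)[OF True]] abs_Im_le_cmod order_trans cauchy_E[of "Complex x (ys n)"] ys(1) by fastforce
        then show ?thesis using True by (simp del: atLeastAtMost_iff)
      qed (simp del: atLeastAtMost_iff)
    qed
  qed
  have pts: "measure \<mu> {a} = 0" "measure \<mu> {b} = 0" using measure_point_eq_0 nz ab by auto
  have "measure \<mu> {a<..b} = measure \<mu> {a<..<b} + measure \<mu> {b}"
    using ab by (subst \<mu>.finite_measure_Union[symmetric]) (auto intro!: arg_cong[of _ _ "measure \<mu>"])
  then have m1: "measure \<mu> {a<..<b} = measure \<mu> {a<..b}" using pts by simp
  have "measure \<mu> {a..b} = measure \<mu> {a} + measure \<mu> {a<..b}"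
    using ab by (subst \<mu>.finite_measure_Union[symmetric]) (auto intro!: arg_cong[of _ _ "measure \<mu>"])
  then have m2: "measure \<mu> {a..b} = measure \<mu> {a<..b}" using pts by simp
  have "pi / 2 * (measure \<mu> {a<..<b} + measure \<mu> {a..b}) = (\<integral>x\<in>{a..b}. pi * stieltjes_density x \<partial>lborel)"
    by (rule LIMSEQ_unique[OF \<mu>.stieltjes_inversion[OF ab ys(1) ys(3)] lim])
  then have meas: "measure \<mu> {a<..b} = (\<integral>x\<in>{a..b}. stieltjes_density x \<partial>lborel)"
    unfolding m1 m2 by simp
  have bound: "\<bar>stieltjes_density x\<bar> \<le> B / pi" if "x \<in> {a..b}" for x
    using B[OF inR(2)[OF that]] abs_Im_le_cmod[of "1 / E (complex_of_real x)"]
    by (simp add: stieltjes_density_def divide_right_mono)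
  have int: "set_integrable lborel {a..b} stieltjes_density"
    unfolding set_integrable_def
    by (rule integrableI_bounded_set_indicator[where B = "B / pi"]) (use bound ab in auto)
  have "emeasure (density lborel (\<lambda>x. ennreal (stieltjes_density x))) {a<..b} =
      (\<integral>\<^sup>+x. ennreal (stieltjes_density x) * indicator {a<..b} x \<partial>lborel)"
    by (rule emeasure_density) auto
  also have "\<dots> = (\<integral>\<^sup>+x. ennreal (indicator {a..b} x *\<^sub>R stieltjes_density x) \<partial>lborel)"
  proof (rule nn_integral_cong_AE)
    have "AE x in lborel. x \<noteq> a" by (rule AE_lborel_singleton)
    then show "AE x in lborel. ennreal (stieltjes_density x) * indicator {a<..b} x = ennreal (indicator {a..b} x *\<^sub>R stieltjes_density x)"
      by eventually_elim (auto simp: indicator_def)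
  qed
  also have "\<dots> = ennreal (\<integral>x\<in>{a..b}. stieltjes_density x \<partial>lborel)"
    unfolding set_lebesgue_integral_def
    using int stieltjes_density_nonneg
    by (intro nn_integral_eq_integral) (auto simp: set_integrable_def)
  also have "\<dots> = emeasure \<mu> {a<..b}"
    using meas by (simp add: \<mu>.emeasure_eq_measure)
  finally show ?thesis by (rule sym)
qed

section \<open>The zero of the boundary value and the decomposition of the measure\<close>

private definition Z where "Z = {x. E (complex_of_real x) = 0}"

private lemma countable_Z: "countable Z"
proof -
  obtain x0 where "Z \<subseteq> {x0}" using E_inj unfolding Z_def by blast
  then show ?thesis by (rule countable_subset) simp
qed

private lemma Z_borel [measurable]: "Z \<in> sets borel"
  using countable_Z by (rule sets.countable[rotated]) simp

text \<open>Removing the zero of \<open>E\<close> removes the only possible atom, and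
  \<open>measure_eqI_off_point\<close> glues the interval identities on its two sides.\<close>

lemma density_off_zeros:
  "density \<mu> (indicator (- Z)) = density lborel (\<lambda>x. ennreal (stieltjes_density x))"
proof -
  let ?m = "density \<mu> (indicator (- Z) :: real \<Rightarrow> ennreal)"
  have m: "emeasure ?m A = emeasure \<mu> (A \<inter> - Z)" if "A \<in> sets borel" for A
    using that by (subst emeasure_density) (auto simp: nn_integral_indicator indicator_inter_arith[symmetric] Int_commute)
  obtain x0 where x0: "Z \<subseteq> {x0}" using E_inj unfolding Z_def by blast
  show ?thesis
  proof (rule measure_eqI_off_point[of _ _ x0])
    show "emeasure ?m {a<..b} \<noteq> \<infinity>" for a b
      by (simp add: m \<mu>.emeasure_eq_measure)
    show "emeasure ?m {a<..b} = emeasure (density lborel (\<lambda>x. ennreal (stieltjes_density x))) {a<..b}"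
      if "a < b" "x0 \<notin> {a..b}" for a b
    proof -
      have "{a<..b} \<inter> - Z = {a<..b}" using x0 that by auto
      then have "emeasure ?m {a<..b} = emeasure \<mu> {a<..b}" by (simp add: m)
      also have "\<dots> = emeasure (density lborel (\<lambda>x. ennreal (stieltjes_density x))) {a<..b}"
        by (rule interval_measure_eq[OF that(1)]) (use x0 that(2) in \<open>auto simp: Z_def\<close>)
      finally show ?thesis .
    qed
    have "emeasure ?m {x0} = emeasure \<mu> ({x0} \<inter> - Z)" by (rule m) simp
    also have "\<dots> = 0"
    proof (cases "x0 \<in> Z")
      case False
      then have "measure \<mu> {x0} = 0" by (intro measure_point_eq_0) (simp add: Z_def)
      then show ?thesis using False by (simp add: \<mu>.emeasure_eq_measure)
    qed simp
    finally have "emeasure ?m {x0} = 0" .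
    moreover have "emeasure (density lborel (\<lambda>x. ennreal (stieltjes_density x))) {x0} = 0"
    proof -
      have "{x0} \<in> null_sets lborel" by (simp add: finite_imp_null_set_lborel)
      then have "{x0} \<in> null_sets (density lborel (\<lambda>x. ennreal (stieltjes_density x)))"
        using absolutely_continuousI_density[of "\<lambda>x. ennreal (stieltjes_density x)" lborel]
        unfolding absolutely_continuous_def by auto
      then show ?thesis by (rule null_setsD1)
    qed
    ultimately show "emeasure ?m {x0} = emeasure (density lborel (\<lambda>x. ennreal (stieltjes_density x))) {x0}" by simp
  qed simp_all
qed

text \<open>The restriction of \<mu> to Z, at most one point, is the discrete part, and the rest has
  a density, so nothing is left for the singular continuous part.\<close>

lemma lebesgue_decomposition_stieltjes:
  "\<exists>d. lebesgue_decomposition \<mu> (density lborel (\<lambda>x. ennreal (stieltjes_density x))) (null_measure borel) d"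
proof -
  let ?d = "density \<mu> (indicator Z :: real \<Rightarrow> ennreal)"
  have m: "emeasure (density \<mu> (indicator Y :: real \<Rightarrow> ennreal)) A = emeasure \<mu> (A \<inter> Y)"
    if "A \<in> sets borel" "Y \<in> sets borel" for A Y
    using that by (subst emeasure_density) (auto simp: nn_integral_indicator indicator_inter_arith[symmetric] Int_commute)
  have "lebesgue_decomposition \<mu> (density lborel (\<lambda>x. ennreal (stieltjes_density x))) (null_measure borel) ?d"
    unfolding lebesgue_decomposition_def
  proof (intro conjI ballI allI)
    fix A :: "real set" assume A: "A \<in> sets borel"
    have "emeasure \<mu> A = emeasure \<mu> (A \<inter> - Z) + emeasure \<mu> (A \<inter> Z)"
      using A by (subst plus_emeasure) (auto intro!: arg_cong[of _ _ "emeasure \<mu>"])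
    then show "emeasure \<mu> A = emeasure (density lborel (\<lambda>x. ennreal (stieltjes_density x))) A +
        emeasure (null_measure borel) A + emeasure ?d A"
      unfolding density_off_zeros[symmetric] using A by (simp add: m)
  next
    show "absolutely_continuous lborel (density lborel (\<lambda>x. ennreal (stieltjes_density x)))"
      by (rule absolutely_continuousI_density) simp
    show "\<exists>N\<in>null_sets lborel. emeasure (null_measure borel) (- N) = 0"
      by (intro bexI[of _ "{}"]) auto
    show "\<exists>C. countable C \<and> emeasure ?d (- C) = 0"
      using countable_Z by (intro exI[of _ Z]) (simp add: m)
  qed simp_all
  then show ?thesis by blast
qed

lemma stieltjes_density_is_ac_density: "is_ac_density \<mu> stieltjes_density"
  unfolding is_ac_density_def
  using lebesgue_decomposition_stieltjes lebesgue_decomposition_parts(1) stieltjes_density_nonneg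
    stieltjes_density_boundary stieltjes_density_measurable by blast

text \<open>Positive density forces \<open>Im (E x)\<close> to be positive, so \<open>E\<close>
  continues to a holomorphic g near x with values in the half-plane. Then 1 / g has a Taylor series
  at x, and for real increments its imaginary part is a real power series.\<close>

lemma stieltjes_density_analytic:
  assumes x: "0 < stieltjes_density x" shows "real_analytic_at stieltjes_density x"
proof -
  let ?x = "complex_of_real x"
  have "Im (E ?x) \<noteq> 0"
  proof
    assume "Im (E ?x) = 0"
    then show False using x by (simp add: stieltjes_density_def Im_divide)
  qed
  then have pos: "0 < Im (E ?x)" using boundary_extension_Im_nonneg[OF N F, of ?x] by simp
  obtain r g where r: "0 < r" and g: "g holomorphic_on ball ?x r" "\<And>z. z \<in> ball ?x r \<Longrightarrow> 0 < Im (g z)"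
    "\<And>z. z \<in> ball ?x r \<Longrightarrow> 0 \<le> Im z \<Longrightarrow> E z = g z"
    by (rule boundary_extension_analytic[OF N F _ pos]) auto
  define h where "h = (\<lambda>z. 1 / g z)"
  have h: "h holomorphic_on ball ?x r"
    unfolding h_def using g(2) by (intro holomorphic_intros g(1)) force
  define c where "c n = - Im ((deriv ^^ n) h ?x / fact n) / pi" for n
  have "(\<lambda>n. c n * (y - x)^n) sums stieltjes_density y" if y: "\<bar>y - x\<bar> < r" for y
  proof -
    have yb: "complex_of_real y \<in> ball ?x r"
      using y by (simp add: dist_norm norm_minus_commute del: of_real_diff add: of_real_diff[symmetric])
    have "(\<lambda>n. (deriv ^^ n) h ?x / fact n * (complex_of_real y - ?x)^n) sums h (complex_of_real y)"
      by (rule holomorphic_power_series[OF h yb])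
    then have "(\<lambda>n. - Im ((deriv ^^ n) h ?x / fact n * (complex_of_real y - ?x)^n) / pi) sums (- Im (h (complex_of_real y)) / pi)"
      by (intro sums_divide sums_minus sums_Im)
    moreover have "- Im ((deriv ^^ n) h ?x / fact n * (complex_of_real y - ?x)^n) / pi = c n * (y - x)^n" for n
    proof -
      have e: "(complex_of_real y - ?x)^n = complex_of_real ((y - x)^n)" by simp
      have "- Im (w * complex_of_real v) / pi = - Im w / pi * v" for w v by simp
      then show ?thesis unfolding c_def e .
    qed
    moreover have "- Im (h (complex_of_real y)) / pi = stieltjes_density y"
      using g(3)[OF yb] by (simp add: stieltjes_density_def h_def)
    ultimately show ?thesis by simp
  qed
  then show ?thesis unfolding real_analytic_at_def using r by blast
qed

end

theorem proposition2p8: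
  fixes t :: real
  assumes "t > 1"
  shows
    "(\<forall>\<mu>\<in>inf_divisible (\<boxplus>).
        (\<forall>z\<in>upper_half_plane. Re (deriv (F_transform \<mu>) z) > 1 / 2) \<and>
        (\<exists>F. continuous_on {z. 0 \<le> Im z} F \<and>
             (\<forall>z\<in>upper_half_plane. F z = F_transform \<mu> z)) \<and>
        sc_part \<mu> = null_measure borel \<and>
        (\<forall>x y. measure \<mu> {x} > 0 \<and> measure \<mu> {y} > 0 \<longrightarrow> x = y) \<and>
        (\<exists>f. is_ac_density \<mu> f \<and> (\<forall>x. f x > 0 \<longrightarrow> real_analytic_at f x))) \<and>
     (\<forall>\<mu>. real_distribution \<mu> \<longrightarrow>
        is_right_inverse_H t \<mu> (omega_map t \<mu>) \<and>
        real_distribution (Psi t \<mu>) \<and>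
        (\<forall>z\<in>upper_half_plane. F_transform (Psi t \<mu>) z = omega_map t \<mu> z)) \<and>
     bij_betw (Psi t) (inf_divisible (\<uplus>)) (inf_divisible (\<boxplus>)) \<and>
     (\<forall>\<mu> \<nu>. real_distribution \<mu> \<and> real_distribution \<nu> \<longrightarrow>
        Psi t (\<mu> \<uplus> \<nu>) = Psi t \<mu> \<boxplus> Psi t \<nu>)"
proof (intro conjI)
  show "bij_betw (Psi t) (inf_divisible (\<uplus>)) (inf_divisible (\<boxplus>))"
    by (rule bij_betw_Psi[OF assms])
  show "\<forall>\<mu> \<nu>. real_distribution \<mu> \<and> real_distribution \<nu> \<longrightarrow> Psi t (\<mu> \<uplus> \<nu>) = Psi t \<mu> \<boxplus> Psi t \<nu>"
    using Psi_boolean_conv[OF assms] by blast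
  show "\<forall>\<mu>. real_distribution \<mu> \<longrightarrow>
        is_right_inverse_H t \<mu> (omega_map t \<mu>) \<and>
        real_distribution (Psi t \<mu>) \<and>
        (\<forall>z\<in>upper_half_plane. F_transform (Psi t \<mu>) z = omega_map t \<mu> z)"
    using omega_map_subordination[OF assms] Psi_F_transform[OF assms]
    by (auto simp: is_right_inverse_H_iff[OF assms])
  show "\<forall>\<mu>\<in>inf_divisible (\<boxplus>).
        (\<forall>z\<in>upper_half_plane. Re (deriv (F_transform \<mu>) z) > 1 / 2) \<and>
        (\<exists>F. continuous_on {z. 0 \<le> Im z} F \<and>
             (\<forall>z\<in>upper_half_plane. F z = F_transform \<mu> z)) \<and>
        sc_part \<mu> = null_measure borel \<and>
        (\<forall>x y. measure \<mu> {x} > 0 \<and> measure \<mu> {y} > 0 \<longrightarrow> x = y) \<and>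
        (\<exists>f. is_ac_density \<mu> f \<and> (\<forall>x. f x > 0 \<longrightarrow> real_analytic_at f x))"
  proof
    fix \<mu> assume id: "\<mu> \<in> inf_divisible (\<boxplus>)"
    then have \<mu>: "real_distribution \<mu>" by (simp add: inf_divisible_def)
    obtain N where N: "sublinear_pick N" and F: "subordination N (F_transform \<mu>)"
      using inf_divisible_free_subordination[OF id] by blast
    show "(\<forall>z\<in>upper_half_plane. Re (deriv (F_transform \<mu>) z) > 1 / 2) \<and>
        (\<exists>F. continuous_on {z. 0 \<le> Im z} F \<and>
             (\<forall>z\<in>upper_half_plane. F z = F_transform \<mu> z)) \<and>
        sc_part \<mu> = null_measure borel \<and>
        (\<forall>x y. measure \<mu> {x} > 0 \<and> measure \<mu> {y} > 0 \<longrightarrow> x = y) \<and>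
        (\<exists>f. is_ac_density \<mu> f \<and> (\<forall>x. f x > 0 \<longrightarrow> real_analytic_at f x))"
    proof (intro conjI)
      show "\<forall>z\<in>upper_half_plane. Re (deriv (F_transform \<mu>) z) > 1 / 2"
        using subordination_deriv[OF N F] by simp
      show "\<exists>F. continuous_on {z. 0 \<le> Im z} F \<and> (\<forall>z\<in>upper_half_plane. F z = F_transform \<mu> z)"
        using continuous_boundary_extension[OF N F] boundary_extension_eq[OF N F]
        by (intro exI[of _ "boundary_extension (F_transform \<mu>)"]) auto
      show "sc_part \<mu> = null_measure borel"
        using lebesgue_decomposition_stieltjes[OF \<mu> N F] lebesgue_decomposition_parts(2) by blast
      show "\<forall>x y. measure \<mu> {x} > 0 \<and> measure \<mu> {y} > 0 \<longrightarrow> x = y"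
        using at_most_one_atom[OF \<mu> N F] by blast
      show "\<exists>f. is_ac_density \<mu> f \<and> (\<forall>x. f x > 0 \<longrightarrow> real_analytic_at f x)"
        using stieltjes_density_is_ac_density[OF \<mu> N F] stieltjes_density_analytic[OF \<mu> N F] by blast
    qed
  qed
qed

end
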